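(* Let $n\ge 0$ be an integer. (i) If $m=1$, then $\sigma_s(X_{m,n})$ has the expected dimension for any $s\ge 1$. (ii) If $m=2$, then for any $s\ge 1$ the variety $\sigma_s(X_{m,n})$ has the expected dimension unless $(n,s)=(2k+1,3k+2)$ for some integer $k\geq 1$.
   Context: We work over $\mathbb{C}$. For an irreducible non-singular variety $X\subset \mathbb{P}^N$ of dimension $d$ and $s\ge 1$, the $s$-th secant variety $\sigma_s(X)$ is the Zariski closure of the union of the linear spans of all $s$-tuples of points of $X$. Its expected dimension is $\min\{N, s(d+1)-1\}$; we say $\sigma_s(X)$ has the expected dimension if $\dim\sigma_s(X)$ equals this number. $X_{m,n}$ denotes the Segre-Veronese variety $\mathbb{P}^m\times\mathbb{P}^n$ embedded in $\mathbb{P}^{(m+1)\binom{n+2}{2}-1}$ by the morphism given by $\mathcal{O}(1,2)$; it has dimension $m+n$. *)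

theory Defs
  imports
    "HOL-Analysis.Abstract_Topology"
    "HOL-Library.Function_Algebras"
    "HOL-Library.Poly_Mapping"
    "HOL-Library.Extended_Nat"
    Complex_Main
begin

section \<open>Projective space with coordinates indexed by a finite set\<close>

text \<open>
  The coordinate space \<open>\<complex>\<^sup>I\<close> consists of the functions vanishing outside \<open>I\<close>, and a point of
  \<open>\<P>(\<complex>\<^sup>I)\<close> is the set of all representatives (nonzero multiples) of a nonzero vector.
  For \<open>I = {..N}\<close> this is the usual \<open>\<P>\<^sup>N\<close>; for any finite \<open>I\<close> it is a projective space of
  dimension \<open>card I - 1\<close>.
\<close>

definition cscale :: "complex \<Rightarrow> ('i \<Rightarrow> complex) \<Rightarrow> ('i \<Rightarrow> complex)" where
  "cscale c v = (\<lambda>i. c * v i)"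

interpretation cvec: vector_space cscale
  by unfold_locales (auto simp: cscale_def fun_eq_iff algebra_simps)

definition coord_space :: "'i set \<Rightarrow> ('i \<Rightarrow> complex) set" where
  "coord_space I = {v. \<forall>i. i \<notin> I \<longrightarrow> v i = 0}"

definition proj_pt :: "('i \<Rightarrow> complex) \<Rightarrow> ('i \<Rightarrow> complex) set" where
  "proj_pt v = {cscale c v | c. c \<noteq> 0}"

definition proj_space :: "'i set \<Rightarrow> ('i \<Rightarrow> complex) set set" where
  "proj_space I = proj_pt ` (coord_space I - {0})"

definition proj_span :: "'i set \<Rightarrow> ('i \<Rightarrow> complex) set set \<Rightarrow> ('i \<Rightarrow> complex) set set" where
  "proj_span I S = {q \<in> proj_space I. q \<subseteq> cvec.span (\<Union>S)}"


section \<open>The Zariski topology\<close>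

text \<open>Polynomials are finitely supported functions from monomials (exponent vectors) to
  coefficients.\<close>

type_synonym 'i cpoly = "('i \<Rightarrow>\<^sub>0 nat) \<Rightarrow>\<^sub>0 complex"

definition mon_eval :: "('i \<Rightarrow>\<^sub>0 nat) \<Rightarrow> ('i \<Rightarrow> complex) \<Rightarrow> complex" where
  "mon_eval a v = (\<Prod>i\<in>Poly_Mapping.keys a. v i ^ Poly_Mapping.lookup a i)"

definition mon_degree :: "('i \<Rightarrow>\<^sub>0 nat) \<Rightarrow> nat" where
  "mon_degree a = (\<Sum>i\<in>Poly_Mapping.keys a. Poly_Mapping.lookup a i)"

definition poly_eval :: "'i cpoly \<Rightarrow> ('i \<Rightarrow> complex) \<Rightarrow> complex" where
  "poly_eval f v = (\<Sum>a\<in>Poly_Mapping.keys f. Poly_Mapping.lookup f a * mon_eval a v)"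

definition homogeneous_polys :: "'i set \<Rightarrow> 'i cpoly set" where
  "homogeneous_polys I =
    {f. \<exists>d. \<forall>a\<in>Poly_Mapping.keys f. Poly_Mapping.keys a \<subseteq> I \<and> mon_degree a = d}"

definition zero_locus :: "'i set \<Rightarrow> 'i cpoly set \<Rightarrow> ('i \<Rightarrow> complex) set set" where
  "zero_locus I F = {p \<in> proj_space I. \<forall>f\<in>F. \<forall>v\<in>p. poly_eval f v = 0}"

definition zariski :: "'i set \<Rightarrow> ('i \<Rightarrow> complex) set topology" where
  "zariski I = topology (\<lambda>U. \<exists>F\<subseteq>homogeneous_polys I. U = proj_space I - zero_locus I F)"

lemma mon_eval_superset:
  assumes "finite A" "Poly_Mapping.keys a \<subseteq> A"
  shows "mon_eval a v = (\<Prod>i\<in>A. v i ^ Poly_Mapping.lookup a i)"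
  unfolding mon_eval_def
  by (rule prod.mono_neutral_left) (use assms in \<open>auto simp: in_keys_iff\<close>)

lemma mon_eval_add: "mon_eval (a + b) v = mon_eval a v * mon_eval b v"
proof -
  let ?A = "Poly_Mapping.keys a \<union> Poly_Mapping.keys b"
  have "Poly_Mapping.keys (a + b) \<subseteq> ?A" by (rule keys_add)
  then show ?thesis
    by (simp add: mon_eval_superset[of ?A] lookup_add power_add prod.distrib)
qed

lemma mon_degree_superset:
  assumes "finite A" "Poly_Mapping.keys a \<subseteq> A"
  shows "mon_degree a = (\<Sum>i\<in>A. Poly_Mapping.lookup a i)"
  unfolding mon_degree_def
  by (rule sum.mono_neutral_left) (use assms in \<open>auto simp: in_keys_iff\<close>)

lemma mon_degree_add: "mon_degree (a + b) = mon_degree a + mon_degree b"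
proof -
  let ?A = "Poly_Mapping.keys a \<union> Poly_Mapping.keys b"
  have "Poly_Mapping.keys (a + b) \<subseteq> ?A" by (rule keys_add)
  then show ?thesis
    by (simp add: mon_degree_superset[of ?A] lookup_add sum.distrib)
qed

lemma mon_eval_cscale: "mon_eval a (cscale c v) = c ^ mon_degree a * mon_eval a v"
  by (simp add: mon_eval_def mon_degree_def cscale_def power_mult_distrib prod.distrib power_sum)

lemma poly_eval_superset:
  assumes "finite A" "Poly_Mapping.keys f \<subseteq> A"
  shows "poly_eval f v = (\<Sum>a\<in>A. Poly_Mapping.lookup f a * mon_eval a v)"
  unfolding poly_eval_def
  by (rule sum.mono_neutral_left) (use assms in \<open>auto simp: in_keys_iff\<close>)

lemma poly_eval_0 [simp]: "poly_eval 0 v = 0"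
  by (simp add: poly_eval_def)

lemma poly_eval_add: "poly_eval (f + g) v = poly_eval f v + poly_eval g v"
proof -
  let ?A = "Poly_Mapping.keys f \<union> Poly_Mapping.keys g"
  have "Poly_Mapping.keys (f + g) \<subseteq> ?A" by (rule keys_add)
  then show ?thesis
    by (simp add: poly_eval_superset[of ?A] lookup_add sum.distrib distrib_right)
qed

lemma poly_eval_sum: "poly_eval (\<Sum>x\<in>A. h x) v = (\<Sum>x\<in>A. poly_eval (h x) v)"
  by (induction A rule: infinite_finite_induct) (simp_all add: poly_eval_add)

lemma poly_eval_single: "poly_eval (Poly_Mapping.single a c) v = c * mon_eval a v"
  by (simp add: poly_eval_def)

lemma poly_as_sum:
  "f = (\<Sum>a\<in>Poly_Mapping.keys f. Poly_Mapping.single a (Poly_Mapping.lookup f a))"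
  by (rule poly_mapping_eqI)
     (auto simp: lookup_sum lookup_single when_def in_keys_iff
        sum.delta[OF finite_keys] cong: if_cong)

lemma poly_eval_mult: "poly_eval (f * g) v = poly_eval f v * poly_eval g v"
proof -
  let ?F = "Poly_Mapping.keys f" and ?G = "Poly_Mapping.keys g"
  have "f * g = (\<Sum>a\<in>?F. Poly_Mapping.single a (Poly_Mapping.lookup f a)) *
      (\<Sum>b\<in>?G. Poly_Mapping.single b (Poly_Mapping.lookup g b))"
    using poly_as_sum[of f] poly_as_sum[of g] by simp
  also have "\<dots> = (\<Sum>a\<in>?F. \<Sum>b\<in>?G.
      Poly_Mapping.single (a + b) (Poly_Mapping.lookup f a * Poly_Mapping.lookup g b))"
    by (simp add: sum_product mult_single)
  finally have "poly_eval (f * g) v = (\<Sum>a\<in>?F. \<Sum>b\<in>?G.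
      (Poly_Mapping.lookup f a * mon_eval a v) * (Poly_Mapping.lookup g b * mon_eval b v))"
    by (simp add: poly_eval_sum poly_eval_single mon_eval_add ac_simps)
  then show ?thesis
    by (simp add: sum_product poly_eval_def)
qed

lemma homogeneous_polys_mult:
  assumes "f \<in> homogeneous_polys I" "g \<in> homogeneous_polys I"
  shows "f * g \<in> homogeneous_polys I"
proof -
  obtain d e where
    d: "\<forall>a\<in>Poly_Mapping.keys f. Poly_Mapping.keys a \<subseteq> I \<and> mon_degree a = d" and
    e: "\<forall>a\<in>Poly_Mapping.keys g. Poly_Mapping.keys a \<subseteq> I \<and> mon_degree a = e"
    using assms by (auto simp: homogeneous_polys_def)
  have "Poly_Mapping.keys c \<subseteq> I \<and> mon_degree c = d + e" if c: "c \<in> Poly_Mapping.keys (f * g)" for c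
  proof -
    obtain a b where "a \<in> Poly_Mapping.keys f" "b \<in> Poly_Mapping.keys g" "c = a + b"
      using c keys_mult[of f g] by blast
    then show ?thesis
      using d e keys_add[of a b] by (fastforce simp: mon_degree_add)
  qed
  then show ?thesis by (auto simp: homogeneous_polys_def)
qed

lemma poly_eval_proj_pt_iff:
  assumes "f \<in> homogeneous_polys I"
  shows "(\<forall>w\<in>proj_pt v. poly_eval f w = 0) \<longleftrightarrow> poly_eval f v = 0"
proof -
  obtain d where d: "\<forall>a\<in>Poly_Mapping.keys f. mon_degree a = d"
    using assms by (auto simp: homogeneous_polys_def)
  have *: "poly_eval f (cscale c v) = c ^ d * poly_eval f v" for c
    using d by (auto simp: poly_eval_def mon_eval_cscale sum_distrib_left intro!: sum.cong)
  have "v \<in> proj_pt v"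
    by (auto simp: proj_pt_def cscale_def intro!: exI[of _ 1])
  then show ?thesis by (auto simp: proj_pt_def *)
qed

lemma zero_locus_Un_mult:
  assumes "F \<subseteq> homogeneous_polys I" "G \<subseteq> homogeneous_polys I"
  shows "zero_locus I F \<union> zero_locus I G = zero_locus I {f * g | f g. f \<in> F \<and> g \<in> G}"
proof -
  have "proj_pt v \<in> zero_locus I F \<union> zero_locus I G \<longleftrightarrow>
      proj_pt v \<in> zero_locus I {f * g | f g. f \<in> F \<and> g \<in> G}" (is "?l \<longleftrightarrow> ?r")
    if "proj_pt v \<in> proj_space I" for v
  proof -
    have *: "proj_pt v \<in> zero_locus I H \<longleftrightarrow> (\<forall>f\<in>H. poly_eval f v = 0)"
      if "H \<subseteq> homogeneous_polys I" for H
      using \<open>proj_pt v \<in> proj_space I\<close> poly_eval_proj_pt_iff[where I = I] that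
      unfolding zero_locus_def by blast
    have "?l \<longleftrightarrow> (\<forall>f\<in>F. poly_eval f v = 0) \<or> (\<forall>g\<in>G. poly_eval g v = 0)"
      using *[OF assms(1)] *[OF assms(2)] by blast
    also have "\<dots> \<longleftrightarrow> (\<forall>f\<in>F. \<forall>g\<in>G. poly_eval (f * g) v = 0)"
      by (auto simp: poly_eval_mult)
    also have "\<dots> \<longleftrightarrow> ?r"
      using assms homogeneous_polys_mult by (subst *) blast+
    finally show ?thesis .
  qed
  then have "p \<in> zero_locus I F \<union> zero_locus I G \<longleftrightarrow>
      p \<in> zero_locus I {f * g | f g. f \<in> F \<and> g \<in> G}" if "p \<in> proj_space I" for p
    using that unfolding proj_space_def by blast
  moreover have "zero_locus I H \<subseteq> proj_space I" for H
    by (auto simp: zero_locus_def)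
  ultimately show ?thesis by blast
qed

lemma istopology_zariski:
  "istopology (\<lambda>U. \<exists>F\<subseteq>homogeneous_polys I. U = proj_space I - zero_locus I F)"
  unfolding istopology_def
proof (intro conjI allI impI)
  fix S T
  assume "\<exists>F\<subseteq>homogeneous_polys I. S = proj_space I - zero_locus I F"
    and "\<exists>F\<subseteq>homogeneous_polys I. T = proj_space I - zero_locus I F"
  then obtain F G where F: "F \<subseteq> homogeneous_polys I" "S = proj_space I - zero_locus I F"
    and G: "G \<subseteq> homogeneous_polys I" "T = proj_space I - zero_locus I G"
    by blast
  let ?H = "{f * g | f g. f \<in> F \<and> g \<in> G}"
  have "?H \<subseteq> homogeneous_polys I"
    using F(1) G(1) homogeneous_polys_mult by blast
  moreover have "S \<inter> T = proj_space I - zero_locus I ?H"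
    using F(2) G(2) zero_locus_Un_mult[OF F(1) G(1)] by blast
  ultimately show "\<exists>F\<subseteq>homogeneous_polys I. S \<inter> T = proj_space I - zero_locus I F"
    by blast
next
  fix K
  assume "\<forall>U\<in>K. \<exists>F\<subseteq>homogeneous_polys I. U = proj_space I - zero_locus I F"
  then obtain F where F: "\<And>U. U \<in> K \<Longrightarrow> F U \<subseteq> homogeneous_polys I"
      "\<And>U. U \<in> K \<Longrightarrow> U = proj_space I - zero_locus I (F U)"
    by metis
  have "\<Union>K = (\<Union>U\<in>K. proj_space I - zero_locus I (F U))"
    using F(2) by auto
  also have "\<dots> = proj_space I - zero_locus I (\<Union>U\<in>K. F U)"
    by (auto simp: zero_locus_def)
  finally show "\<exists>F\<subseteq>homogeneous_polys I. \<Union>K = proj_space I - zero_locus I F"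
    using F(1) by (intro exI[of _ "\<Union>U\<in>K. F U"]) blast
qed

lemma openin_zariski:
  "openin (zariski I) U \<longleftrightarrow> (\<exists>F\<subseteq>homogeneous_polys I. U = proj_space I - zero_locus I F)"
  by (simp add: zariski_def topology_inverse'[OF istopology_zariski])

lemma topspace_zariski: "topspace (zariski I) = proj_space I"
proof -
  have "zero_locus I {1} = {}"
    by (auto simp: zero_locus_def proj_space_def proj_pt_def poly_eval_def mon_eval_def)
  moreover have "1 \<in> homogeneous_polys I"
    by (auto simp: homogeneous_polys_def mon_degree_def)
  ultimately have "openin (zariski I) (proj_space I)"
    unfolding openin_zariski by (intro exI[of _ "{1}"]) auto
  then show ?thesis
    unfolding topspace_def openin_zariski by blast
qed

lemma closedin_zariski:
  "closedin (zariski I) Z \<longleftrightarrow> (\<exists>F\<subseteq>homogeneous_polys I. Z = zero_locus I F)"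
proof -
  have sub: "zero_locus I F \<subseteq> proj_space I" for F
    by (auto simp: zero_locus_def)
  show ?thesis
    unfolding closedin_def topspace_zariski openin_zariski
    using sub by (metis Diff_Diff_Int double_diff Diff_subset order_refl inf.absorb2)
qed


section \<open>Dimension\<close>

definition irreducible_closedin :: "'a topology \<Rightarrow> 'a set \<Rightarrow> bool" where
  "irreducible_closedin T Z \<longleftrightarrow> closedin T Z \<and> Z \<noteq> {} \<and>
    (\<forall>A B. closedin T A \<and> closedin T B \<and> Z = A \<union> B \<longrightarrow> Z = A \<or> Z = B)"

text \<open>Krull dimension of a nonempty topological space; the empty space gets the value \<open>0\<close>.\<close>

definition krull_dim :: "'a topology \<Rightarrow> enat" where
  "krull_dim T = Sup {enat r | r. \<exists>C :: nat \<Rightarrow> 'a set.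
     (\<forall>i\<le>r. irreducible_closedin T (C i)) \<and> (\<forall>i<r. C i \<subset> C (Suc i))}"


section \<open>Secant varieties\<close>

text \<open>The \<open>s\<close>-tuples of points of \<open>X\<close> need not consist of distinct points.\<close>

definition secant_variety ::
    "'i set \<Rightarrow> ('i \<Rightarrow> complex) set set \<Rightarrow> nat \<Rightarrow> ('i \<Rightarrow> complex) set set" where
  "secant_variety I X s =
    zariski I closure_of
      (\<Union>p\<in>{p :: nat \<Rightarrow> ('i \<Rightarrow> complex) set. \<forall>j<s. p j \<in> X}. proj_span I (p ` {..<s}))"

definition expected_dim :: "nat \<Rightarrow> nat \<Rightarrow> nat \<Rightarrow> nat" where
  "expected_dim N d s = min N (s * (d + 1) - 1)"


section \<open>The Segre--Veronese variety of bidegree \<open>(1, 2)\<close>\<close>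

text \<open>The monomials \<open>x\<^sub>i y\<^sub>j y\<^sub>k\<close> with \<open>i \<le> m\<close> and \<open>j \<le> k \<le> n\<close> form a basis of the global sections
  of \<open>\<O>(1,2)\<close> on \<open>\<P>\<^sup>m \<times> \<P>\<^sup>n\<close>.\<close>

definition sv_index :: "nat \<Rightarrow> nat \<Rightarrow> (nat \<times> nat \<times> nat) set" where
  "sv_index m n = {(i, j, k). i \<le> m \<and> j \<le> k \<and> k \<le> n}"

definition sv_vec ::
    "nat \<Rightarrow> nat \<Rightarrow> (nat \<Rightarrow> complex) \<Rightarrow> (nat \<Rightarrow> complex) \<Rightarrow> (nat \<times> nat \<times> nat \<Rightarrow> complex)" where
  "sv_vec m n x y = (\<lambda>(i, j, k). if (i, j, k) \<in> sv_index m n then x i * y j * y k else 0)"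

definition segre_veronese :: "nat \<Rightarrow> nat \<Rightarrow> (nat \<times> nat \<times> nat \<Rightarrow> complex) set set" where
  "segre_veronese m n = {proj_pt (sv_vec m n x y) | x y.
     x \<in> coord_space {..m} - {0} \<and> y \<in> coord_space {..n} - {0}}"

lemma card_sv_index: "card (sv_index m n) = (m + 1) * ((n + 2) choose 2)"
proof -
  have "sv_index m n = {..m} \<times> (\<lambda>(k, j). (j, k)) ` (SIGMA k:{..n}. {..k})"
    by (auto simp: sv_index_def image_iff)
  moreover have "card ((\<lambda>(k, j). (j, k)) ` (SIGMA k:{..n}. {..k})) = (\<Sum>k\<le>n. Suc k)"
    by (subst card_image) (auto simp: inj_on_def)
  moreover have "(\<Sum>k\<le>n. Suc k) = ((n + 2) choose 2)"
    by (induction n) (auto simp: choose_two numeral_eq_Suc)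
  ultimately show ?thesis
    by (simp add: card_cartesian_product)
qed

lemma sv_vec_nonzero:
  assumes "x \<in> coord_space {..m} - {0}" "y \<in> coord_space {..n} - {0}"
  shows "sv_vec m n x y \<in> coord_space (sv_index m n) - {0}"
proof -
  obtain i j where ij: "x i \<noteq> 0" "y j \<noteq> 0"
    using assms by (auto simp: fun_eq_iff)
  then have "i \<le> m" "j \<le> n"
    using assms by (auto simp: coord_space_def)
  then have "sv_vec m n x y (i, j, j) \<noteq> 0"
    using ij by (simp add: sv_vec_def sv_index_def)
  then have "sv_vec m n x y \<noteq> 0" by auto
  then show ?thesis
    by (auto simp: coord_space_def sv_vec_def)
qed

lemma segre_veronese_subset: "segre_veronese m n \<subseteq> proj_space (sv_index m n)"
  using sv_vec_nonzero by (auto simp: segre_veronese_def proj_space_def)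

text \<open>The embedding is into projective space of dimension
  \<open>N = (m + 1) * ((n + 2) choose 2) - 1\<close>, and the embedded variety has dimension \<open>m + n\<close>.\<close>

definition sv_secant_has_expected_dim :: "nat \<Rightarrow> nat \<Rightarrow> nat \<Rightarrow> bool" where
  "sv_secant_has_expected_dim m n s \<longleftrightarrow>
    krull_dim (subtopology (zariski (sv_index m n))
      (secant_variety (sv_index m n) (segre_veronese m n) s)) =
    enat (expected_dim ((m + 1) * ((n + 2) choose 2) - 1) (m + n) s)"

end

theory Submission
  imports Defs "HOL-Computational_Algebra.Polynomial"
begin

text \<open>
  The number of parameters always bounds the dimension of a secant variety from above: a chain of
  \<open>r + 1\<close> irreducible closed sets yields \<open>r + 1\<close> polynomials that are algebraically independent on
  the cone over the largest one (lemma \<open>alg_indep_step\<close>), while polynomial functions are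
  algebraically dependent as soon as there are more of them than variables
  (\<open>polyfn_dependent\<close>, a count of monomials).  The ambient space has \<open>N + 1\<close> coordinates and
  \<open>s\<close> points of the variety depend on \<open>s (m + n + 1)\<close> parameters, scalars included.

  For the lower bound it suffices, as in Terracini's lemma, to find \<open>s\<close> points whose tangent spaces
  span a space of the expected dimension (\<open>krull_dim_secant_ge\<close>): if the parametrisation has
  linearly independent value and partial derivatives at a point, then the closures of the images of
  a flag of affine spaces form a strictly increasing chain of irreducible closed sets
  (\<open>krull_dim_closure_ge\<close>).

  The tangent space at \<open>x \<otimes> y\<^sup>2\<close> is annihilated by a functional \<open>F\<close>, regarded as a form
  \<open>F(x; y, z)\<close> that is symmetric bilinear in \<open>y\<close> and \<open>z\<close>, iff \<open>F(-; y, y) = 0\<close> and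
  \<open>F(x; y, -) = 0\<close>.  For \<open>m = 1\<close> the points \<open>x\<^sub>l \<otimes> e\<^sub>l\<^sup>2\<close> with basis vectors \<open>e\<^sub>0, \<dots>, e\<^sub>n\<close> and
  pairwise independent \<open>x\<^sub>l\<close> force \<open>F = 0\<close>: two conditions on the two-dimensional space belonging to
  \<open>e\<^sub>j e\<^sub>k\<close>.  These \<open>n + 1\<close> tangent spaces have exactly the right total dimension, so fewer points
  have independent tangent spaces and more points still fill the space.

  For \<open>m = 2\<close> the points come in triples over \<open>a\<^sub>r\<close>, \<open>b\<^sub>r\<close>, \<open>a\<^sub>r + b\<^sub>r\<close>, where the \<open>a\<^sub>r\<close>, \<open>b\<^sub>r\<close> are
  basis vectors, each triple accounting for two dimensions of the second factor; if there is an
  additional basis vector \<open>e\<close>, the first point of each triple is moved to \<open>e + a\<^sub>r\<close>.  The values of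
  \<open>F\<close> on two different triples satisfy 12 linear equations in 12 unknowns, which are independent
  unless the six first components lie on a conic (\<open>two_triples\<close>).  Taking the first components on
  the curve \<open>(1, t, t\<^sup>3)\<close> with positive parameters \<open>t\<close> excludes this, because a conic meets the curve
  in six points whose parameters have sum zero.  For \<open>n = 2 k\<close> the cases \<open>s = 3 k\<close> and
  \<open>s = 3 k + 1\<close> imply all others; for \<open>n = 2 k + 1\<close> the cases \<open>s = 3 k + 1\<close> and \<open>s = 3 k + 3\<close> leave
  only \<open>s = 3 k + 2\<close>, which is excluded for \<open>k \<ge> 1\<close> and treated separately for \<open>k = 0\<close>.
\<close>

section \<open>Polynomial functions\<close>

text \<open>Polynomial functions of one complex variable.\<close>

definition upoly :: "(complex \<Rightarrow> complex) \<Rightarrow> bool" where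
  "upoly h \<longleftrightarrow> (\<exists>P. h = poly P)"

lemma upoly_const: "upoly (\<lambda>t. c)"
  unfolding upoly_def by (rule exI[of _ "[:c:]"]) auto

lemma upoly_id: "upoly (\<lambda>t. t)"
  unfolding upoly_def by (rule exI[of _ "[:0, 1:]"]) auto

lemma upoly_add: "upoly f \<Longrightarrow> upoly g \<Longrightarrow> upoly (\<lambda>t. f t + g t)"
  unfolding upoly_def
  by (elim exE, rule_tac x = "P + Pa" in exI) (simp add: fun_eq_iff)

lemma upoly_mult: "upoly f \<Longrightarrow> upoly g \<Longrightarrow> upoly (\<lambda>t. f t * g t)"
  unfolding upoly_def
  by (elim exE, rule_tac x = "P * Pa" in exI) (simp add: fun_eq_iff)

lemma upoly_sum: "(\<And>x. x \<in> A \<Longrightarrow> upoly (f x)) \<Longrightarrow> upoly (\<lambda>t. \<Sum>x\<in>A. f x t)"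
  by (induction A rule: infinite_finite_induct) (simp_all add: upoly_add upoly_const)

lemma upoly_prod: "(\<And>x. x \<in> A \<Longrightarrow> upoly (f x)) \<Longrightarrow> upoly (\<lambda>t. \<Prod>x\<in>A. f x t)"
  by (induction A rule: infinite_finite_induct) (simp_all add: upoly_mult upoly_const)

lemma upoly_power: "upoly f \<Longrightarrow> upoly (\<lambda>t. f t ^ k)"
  by (induction k) (simp_all add: upoly_mult upoly_const)

lemma upoly_no_zero_divisors:
  assumes "upoly f" "upoly g" "\<And>t. f t * g t = 0" "f a \<noteq> 0"
  shows "g t = 0"
proof -
  obtain P Q where PQ: "f = poly P" "g = poly Q"
    using assms by (auto simp: upoly_def)
  have "poly (P * Q) = poly 0"
    using assms(3) by (auto simp: PQ)
  then have "P * Q = 0" by (simp only: poly_eq_poly_eq_iff)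
  moreover have "P \<noteq> 0" using assms(4) PQ by auto
  ultimately show ?thesis by (simp add: PQ)
qed

text \<open>Polynomial functions of the first \<open>M\<close> variables of a sequence.\<close>

inductive polyfn :: "nat \<Rightarrow> ((nat \<Rightarrow> complex) \<Rightarrow> complex) \<Rightarrow> bool" for M where
  const: "polyfn M (\<lambda>u. c)"
| var: "i < M \<Longrightarrow> polyfn M (\<lambda>u. u i)"
| add: "polyfn M f \<Longrightarrow> polyfn M g \<Longrightarrow> polyfn M (\<lambda>u. f u + g u)"
| mult: "polyfn M f \<Longrightarrow> polyfn M g \<Longrightarrow> polyfn M (\<lambda>u. f u * g u)"

lemma polyfn_sum: "(\<And>x. x \<in> A \<Longrightarrow> polyfn M (f x)) \<Longrightarrow> polyfn M (\<lambda>u. \<Sum>x\<in>A. f x u)"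
  by (induction A rule: infinite_finite_induct) (simp_all add: polyfn.add polyfn.const)

lemma polyfn_prod: "(\<And>x. x \<in> A \<Longrightarrow> polyfn M (f x)) \<Longrightarrow> polyfn M (\<lambda>u. \<Prod>x\<in>A. f x u)"
  by (induction A rule: infinite_finite_induct) (simp_all add: polyfn.mult polyfn.const)

lemma polyfn_power: "polyfn M f \<Longrightarrow> polyfn M (\<lambda>u. f u ^ k)"
  by (induction k) (simp_all add: polyfn.mult polyfn.const)

lemma upoly_polyfn:
  assumes "polyfn M h" "\<And>i. i < M \<Longrightarrow> upoly (\<lambda>t. g t i)"
  shows "upoly (\<lambda>t. h (g t))"
  using assms(1)
  by induction (simp_all add: upoly_const upoly_add upoly_mult assms(2))

lemma polyfn_subst:
  assumes "polyfn M h" "\<And>i. i < M \<Longrightarrow> polyfn M' (\<lambda>u. g u i)"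
  shows "polyfn M' (\<lambda>u. h (g u))"
  using assms(1)
  by induction (simp_all add: polyfn.intros assms(2))

text \<open>A polynomial function of several variables restricts to a polynomial on every line, so
  products of nonzero polynomial functions are nonzero.\<close>

lemma upoly_line:
  assumes "polyfn M h"
  shows "upoly (\<lambda>t. h (\<lambda>i. a i + t * (b i - a i)))"
  using assms
  by (rule upoly_polyfn) (intro upoly_add upoly_mult upoly_const upoly_id)

lemma polyfn_no_zero_divisors:
  assumes "polyfn M f" "polyfn M g" "\<And>u. f u * g u = 0" "f a \<noteq> 0"
  shows "g b = 0"
proof -
  let ?l = "\<lambda>t i. a i + t * (b i - a i)"
  have "g (?l 1) = 0"
    by (rule upoly_no_zero_divisors[of "\<lambda>t. f (?l t)" "\<lambda>t. g (?l t)" 0])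
       (use assms in \<open>auto intro: upoly_line\<close>)
  then show ?thesis by simp
qed


section \<open>Monomials and linear dependence\<close>

text \<open>Exponent vectors of \<open>k\<close> variables are lists of length \<open>k\<close>; the head is the exponent of the
  last variable, so that passing from \<open>k\<close> to \<open>Suc k\<close> variables is consing.\<close>

fun mon :: "(nat \<Rightarrow> 'a::comm_semiring_1) \<Rightarrow> nat list \<Rightarrow> 'a" where
  "mon f [] = 1"
| "mon f (e # a) = f (length a) ^ e * mon f a"

definition exps :: "nat \<Rightarrow> nat \<Rightarrow> nat list set" where
  "exps k d = {a. set a \<subseteq> {..d} \<and> length a = k}"

lemma finite_exps [simp]: "finite (exps k d)"
  by (simp add: exps_def finite_lists_length_eq)

lemma card_exps: "card (exps k d) = Suc d ^ k"
  by (simp add: exps_def card_lists_length_eq)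

lemma length_exps: "a \<in> exps k d \<Longrightarrow> length a = k"
  by (simp add: exps_def)

lemma exps_0 [simp]: "exps 0 d = {[]}"
  by (auto simp: exps_def)

lemma exps_Suc: "exps (Suc k) d = (\<lambda>(e, a). e # a) ` ({..d} \<times> exps k d)"
  by (auto simp: exps_def length_Suc_conv image_iff)

lemma sum_exps_Suc: "(\<Sum>a\<in>exps (Suc k) d. g a) = (\<Sum>e\<le>d. \<Sum>a\<in>exps k d. g (e # a))"
  unfolding exps_Suc
  by (subst sum.reindex)
     (auto simp: inj_on_def sum.cartesian_product intro!: sum.cong)

lemma exps_mono: "d \<le> d' \<Longrightarrow> exps k d \<subseteq> exps k d'"
  by (fastforce simp: exps_def)

lemma mon_cong: "(\<And>j. j < length a \<Longrightarrow> f j = g j) \<Longrightarrow> mon f a = mon g a"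
  by (induction a) auto

lemma mon_add:
  "length a = length b \<Longrightarrow> mon f (map2 (+) a b) = mon f a * mon f b"
  by (induction a b rule: list_induct2) (auto simp: power_add mult_ac)

lemma exps_add:
  assumes "a \<in> exps k d" "b \<in> exps k e"
  shows "map2 (+) a b \<in> exps k (d + e)"
proof -
  have "x + y \<le> d + e" if "(x, y) \<in> set (zip a b)" for x y
    using set_zip_leftD[OF that] set_zip_rightD[OF that] assms
    by (intro add_mono) (auto simp: exps_def)
  then show ?thesis using assms by (auto simp: exps_def)
qed

lemma mon_zero_exps: "mon f (replicate k 0) = 1"
  by (induction k) auto

lemma mon_single_exps:
  "i < k \<Longrightarrow> \<exists>a\<in>exps k 1. \<forall>f :: nat \<Rightarrow> 'a::comm_semiring_1. mon f a = f i"
proof (induction k)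
  case (Suc k)
  show ?case
  proof (cases "i = k")
    case True
    then show ?thesis
      by (intro bexI[of _ "1 # replicate k 0"]) (auto simp: mon_zero_exps exps_def)
  next
    case False
    then obtain a where a: "a \<in> exps k 1" "\<forall>f :: nat \<Rightarrow> 'a. mon f a = f i"
      using Suc by auto
    then show ?thesis
      by (intro bexI[of _ "0 # a"]) (auto simp: exps_def)
  qed
qed simp

text \<open>Distinct monomials are linearly independent functions.\<close>

lemma mon_independent:
  fixes c :: "nat list \<Rightarrow> complex"
  assumes "\<And>z. (\<Sum>a\<in>exps k d. c a * mon z a) = 0" "a \<in> exps k d"
  shows "c a = 0"
  using assms
proof (induction k arbitrary: c a)
  case (Suc k)
  obtain e b where a: "a = e # b" "e \<le> d" "b \<in> exps k d"
    using Suc.prems(2) by (auto simp: exps_Suc)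
  show ?case unfolding a(1)
  proof (rule Suc.IH[OF _ a(3)])
    fix z :: "nat \<Rightarrow> complex"
    have "(\<Sum>e\<le>d. (\<Sum>a\<in>exps k d. c (e # a) * mon z a) * t ^ e) = 0" for t
    proof -
      have "mon (z(k := t)) a = mon z a" if "a \<in> exps k d" for a
        using that by (intro mon_cong) (auto simp: length_exps)
      then have "(\<Sum>a\<in>exps k d. c (e # a) * mon z a) * t ^ e =
          (\<Sum>a\<in>exps k d. c (e # a) * mon (z(k := t)) (e # a))" for e
        unfolding sum_distrib_right
        by (intro sum.cong) (auto simp: length_exps mult_ac)
      then show ?thesis
        using Suc.prems(1)[of "z(k := t)"] by (simp only: sum_exps_Suc)
    qed
    then show "(\<Sum>a\<in>exps k d. c (e # a) * mon z a) = 0"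
      using a(2) polyfun_eq_0[of "\<lambda>e. \<Sum>a\<in>exps k d. c (e # a) * mon z a" d] by auto
  qed
qed simp

lemma sum_apply: "(\<Sum>x\<in>A. f x) i = (\<Sum>x\<in>A. f x i)"
  by (induction A rule: infinite_finite_induct) auto

text \<open>A finite family of functions that lies in the span of fewer functions is linearly dependent
  (as a family: repetitions count as dependence).\<close>

lemma family_dependent:
  fixes h :: "'a \<Rightarrow> 'b \<Rightarrow> complex"
  assumes "finite A" "finite B" "h ` A \<subseteq> cvec.span B" "card B < card A"
  shows "\<exists>c. (\<exists>a\<in>A. c a \<noteq> 0) \<and> (\<forall>u. (\<Sum>a\<in>A. c a * h a u) = 0)"
proof (cases "inj_on h A")
  case False
  then obtain a b where ab: "a \<in> A" "b \<in> A" "a \<noteq> b" "h a = h b"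
    by (auto simp: inj_on_def)
  define c where "c = (\<lambda>x. if x = a then 1 else if x = b then -1 else (0::complex))"
  have "(\<Sum>x\<in>A. c x * h x u) = (\<Sum>x\<in>{a, b}. c x * h x u)" for u
    by (rule sum.mono_neutral_right) (use ab assms(1) in \<open>auto simp: c_def\<close>)
  also have "\<dots> u = 0" for u
    using ab by (auto simp: c_def)
  finally show ?thesis
    using ab by (intro exI[of _ c]) (auto simp: c_def)
next
  case True
  have "cvec.dependent (h ` A)"
    using cvec.independent_span_bound[OF assms(2) _ assms(3)] assms(4) card_image[OF True]
    by auto
  then obtain u where u: "\<exists>v\<in>h ` A. u v \<noteq> 0" "(\<Sum>v\<in>h ` A. cscale (u v) v) = 0"
    using assms(1) by (auto simp: cvec.dependent_finite)
  have "(\<Sum>a\<in>A. u (h a) * h a x) = 0" for x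
  proof -
    have "(\<Sum>a\<in>A. cscale (u (h a)) (h a)) x = 0"
      using u(2) by (simp add: sum.reindex[OF True])
    then show ?thesis
      by (simp add: cscale_def sum_apply)
  qed
  then show ?thesis
    using u(1) by (intro exI[of _ "\<lambda>a. u (h a)"]) auto
qed

text \<open>The polynomial functions of degree at most \<open>d\<close> in each of the \<open>M\<close> variables.\<close>

definition mon_span :: "nat \<Rightarrow> nat \<Rightarrow> ((nat \<Rightarrow> complex) \<Rightarrow> complex) set" where
  "mon_span M d = cvec.span ((\<lambda>a u. mon u a) ` exps M d)"

lemma mon_span_mono: "d \<le> d' \<Longrightarrow> mon_span M d \<subseteq> mon_span M d'"
  unfolding mon_span_def by (intro cvec.span_mono image_mono exps_mono)

lemma mon_span_const: "(\<lambda>u. c) \<in> mon_span M d"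
proof -
  have "(\<lambda>u :: nat \<Rightarrow> complex. mon u (replicate M 0)) \<in> mon_span M d"
    unfolding mon_span_def by (intro cvec.span_base imageI) (auto simp: exps_def)
  then have "cscale c (\<lambda>u. mon u (replicate M 0)) \<in> mon_span M d"
    unfolding mon_span_def by (rule cvec.span_scale)
  then show ?thesis by (simp add: cscale_def mon_zero_exps)
qed

lemma mon_span_add: "f \<in> mon_span M d \<Longrightarrow> g \<in> mon_span M d \<Longrightarrow> (\<lambda>u. f u + g u) \<in> mon_span M d"
  using cvec.span_add[of f _ g] by (simp add: mon_span_def plus_fun_def)

lemma mon_span_mult:
  assumes "f \<in> mon_span M d" "g \<in> mon_span M e"
  shows "(\<lambda>u. f u * g u) \<in> mon_span M (d + e)"
proof -
  let ?S = "mon_span M (d + e)"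
  have sub: "cvec.subspace ?S" by (simp add: mon_span_def)
  have monom: "(\<lambda>u. mon u a * g u) \<in> ?S" if a: "a \<in> exps M d" for a
    using assms(2) unfolding mon_span_def[of M e]
  proof (induction rule: cvec.span_induct_alt)
    case base
    then show ?case using cvec.subspace_0[OF sub] by (simp add: zero_fun_def)
  next
    case (step c x y)
    then obtain b where b: "b \<in> exps M e" "x = (\<lambda>u. mon u b)" by auto
    have "(\<lambda>u. mon u a * x u) = (\<lambda>u. mon u (map2 (+) a b))"
      using a b by (subst mon_add) (auto simp: length_exps)
    moreover have "(\<lambda>u. mon u (map2 (+) a b)) \<in> ?S"
      unfolding mon_span_def by (intro cvec.span_base imageI exps_add a b(1))
    ultimately have "cscale c (\<lambda>u. mon u a * x u) + (\<lambda>u. mon u a * y u) \<in> ?S"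
      using step(2) sub by (auto intro: cvec.subspace_add cvec.subspace_scale)
    then show ?case
      by (simp add: cscale_def plus_fun_def algebra_simps)
  qed
  from assms(1) show ?thesis unfolding mon_span_def[of M d]
  proof (induction rule: cvec.span_induct_alt)
    case base
    then show ?case using cvec.subspace_0[OF sub] by (simp add: zero_fun_def)
  next
    case (step c x y)
    then have "cscale c (\<lambda>u. x u * g u) + (\<lambda>u. y u * g u) \<in> ?S"
      using monom by (auto intro!: cvec.subspace_add[OF sub] cvec.subspace_scale[OF sub])
    then show ?case
      by (simp add: cscale_def plus_fun_def algebra_simps)
  qed
qed

lemma mon_span_power:
  assumes "f \<in> mon_span M d"
  shows "(\<lambda>u. f u ^ e) \<in> mon_span M (d * e)"
proof (induction e)
  case (Suc e)
  then show ?case using mon_span_mult[OF assms Suc] by simp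
qed (simp add: mon_span_const)

lemma polyfn_mon_span: "polyfn M f \<Longrightarrow> \<exists>d. f \<in> mon_span M d"
proof (induction rule: polyfn.induct)
  case (var i)
  then obtain a where a: "a \<in> exps M 1" "\<forall>f :: nat \<Rightarrow> complex. mon f a = f i"
    using mon_single_exps by blast
  have "(\<lambda>u. mon u a) \<in> mon_span M 1"
    unfolding mon_span_def by (intro cvec.span_base imageI a(1))
  then show ?case using a(2) by auto
next
  case (add f g)
  then obtain d e where "f \<in> mon_span M d" "g \<in> mon_span M e" by auto
  then have "f \<in> mon_span M (max d e)" "g \<in> mon_span M (max d e)"
    using mon_span_mono by (meson max.cobounded1 max.cobounded2 subsetD)+
  then show ?case using mon_span_add by blast
qed (auto intro: mon_span_const mon_span_mult)

lemma mon_span_mon: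
  assumes "\<And>j. j < length a \<Longrightarrow> F j \<in> mon_span M d" "set a \<subseteq> {..t}"
  shows "(\<lambda>u. mon (\<lambda>j. F j u) a) \<in> mon_span M (length a * d * t)"
  using assms
proof (induction a)
  case (Cons e a)
  have "(\<lambda>u. F (length a) u ^ e) \<in> mon_span M (d * t)"
    using mon_span_power[of "F (length a)" M d e] mon_span_mono[of "d * e" "d * t" M] Cons.prems
    by auto
  moreover have "(\<lambda>u. mon (\<lambda>j. F j u) a) \<in> mon_span M (length a * d * t)"
    using Cons by auto
  ultimately show ?case
    using mon_span_mult by (fastforce simp: algebra_simps)
qed (simp add: mon_span_const)

text \<open>More than \<open>M\<close> polynomial functions of \<open>M\<close> variables are algebraically dependent: for large
  \<open>t\<close> there are more monomials with exponents at most \<open>t\<close> in these functions than monomials of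
  the corresponding degree in the \<open>M\<close> variables.\<close>

lemma polyfn_dependent:
  assumes F: "\<And>j. j < k \<Longrightarrow> polyfn M (F j)" and "M < k"
  shows "\<exists>t c. (\<exists>a\<in>exps k t. c a \<noteq> 0) \<and>
    (\<forall>u. (\<Sum>a\<in>exps k t. c a * mon (\<lambda>j. F j u) a) = 0)"
proof -
  have "\<forall>j<k. \<exists>d. F j \<in> mon_span M d" using polyfn_mon_span[OF F] by auto
  then obtain d where d: "\<And>j. j < k \<Longrightarrow> F j \<in> mon_span M (d j)" by metis
  define D where "D = (\<Sum>j<k. d j)"
  have D: "F j \<in> mon_span M D" if "j < k" for j
    using d[OF that] mon_span_mono[of "d j" D M] that
    by (auto simp: D_def intro: member_le_sum)
  define t where "t = (k * D + 1) ^ M"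
  let ?B = "(\<lambda>a u. mon u a) ` exps M (k * D * t) :: ((nat \<Rightarrow> complex) \<Rightarrow> complex) set"
  have "(\<lambda>a u. mon (\<lambda>j. F j u) a) ` exps k t \<subseteq> cvec.span ?B"
    using mon_span_mon[where F = F and M = M and d = D and t = t] D
    by (fastforce simp: mon_span_def exps_def)
  moreover have "card ?B < card (exps k t)"
  proof -
    have "card ?B \<le> (k * D * t + 1) ^ M"
      using card_image_le[of "exps M (k * D * t)" "\<lambda>a u. mon u a"] by (simp add: card_exps)
    also have "\<dots> \<le> ((k * D + 1) * (t + 1)) ^ M"
      by (intro power_mono) (auto simp: algebra_simps)
    also have "\<dots> = t * (t + 1) ^ M"
      by (simp only: power_mult_distrib t_def)
    also have "\<dots> < (t + 1) * (t + 1) ^ M" by simp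
    also have "\<dots> = (t + 1) ^ Suc M" by simp
    also have "\<dots> \<le> (t + 1) ^ k"
      using \<open>M < k\<close> by (intro power_increasing) auto
    finally show ?thesis by (simp add: card_exps)
  qed
  ultimately obtain c where "\<exists>a\<in>exps k t. c a \<noteq> 0"
    "\<forall>u. (\<Sum>a\<in>exps k t. c a * mon (\<lambda>j. F j u) a) = 0"
    using family_dependent[of "exps k t" ?B "\<lambda>a u. mon (\<lambda>j. F j u) a"] by auto
  then show ?thesis by blast
qed

section \<open>Polynomials and Zariski-closed sets\<close>

text \<open>The polynomials in the coordinates from \<open>I\<close>, homogeneous or not.\<close>

definition polys :: "'i set \<Rightarrow> 'i cpoly set" where
  "polys I = {f. \<forall>a\<in>Poly_Mapping.keys f. Poly_Mapping.keys a \<subseteq> I}"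

lemma homogeneous_polys_subset: "homogeneous_polys I \<subseteq> polys I"
  by (auto simp: homogeneous_polys_def polys_def)

lemma polys_single: "Poly_Mapping.keys a \<subseteq> I \<Longrightarrow> Poly_Mapping.single a c \<in> polys I"
  by (auto simp: polys_def)

lemma polys_add: "f \<in> polys I \<Longrightarrow> g \<in> polys I \<Longrightarrow> f + g \<in> polys I"
  using keys_add[of f g] unfolding polys_def by blast

lemma polys_mult:
  assumes "f \<in> polys I" "g \<in> polys I"
  shows "f * g \<in> polys I"
proof -
  have "Poly_Mapping.keys c \<subseteq> I" if c: "c \<in> Poly_Mapping.keys (f * g)" for c
  proof -
    obtain a b where "a \<in> Poly_Mapping.keys f" "b \<in> Poly_Mapping.keys g" "c = a + b"
      using c keys_mult[of f g] by blast
    then show ?thesis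
      using assms keys_add[of a b] unfolding polys_def by blast
  qed
  then show ?thesis by (auto simp: polys_def)
qed

lemma polys_const: "Poly_Mapping.single 0 c \<in> polys I"
  by (rule polys_single) simp

lemma polys_1: "1 \<in> polys I"
  using polys_const[of 1] by simp

lemma polys_0: "0 \<in> polys I"
  by (simp add: polys_def)

lemma polys_sum: "(\<And>x. x \<in> A \<Longrightarrow> f x \<in> polys I) \<Longrightarrow> (\<Sum>x\<in>A. f x) \<in> polys I"
  by (induction A rule: infinite_finite_induct) (simp_all add: polys_add polys_0)

lemma polys_power: "f \<in> polys I \<Longrightarrow> f ^ k \<in> polys I"
  by (induction k) (simp_all add: polys_mult polys_1)

lemma polys_mon: "(\<And>j. j < length a \<Longrightarrow> f j \<in> polys I) \<Longrightarrow> mon f a \<in> polys I"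
  by (induction a) (auto intro: polys_mult polys_power polys_1)

lemma poly_eval_const: "poly_eval (Poly_Mapping.single 0 c) v = c"
  by (simp add: poly_eval_single mon_eval_def)

lemma poly_eval_1: "poly_eval 1 v = 1"
  using poly_eval_const[of 1 v] by simp

lemma poly_eval_power: "poly_eval (f ^ k) v = poly_eval f v ^ k"
  by (induction k) (simp_all add: poly_eval_mult poly_eval_1)

lemma poly_eval_mon: "poly_eval (mon f a) v = mon (\<lambda>j. poly_eval (f j) v) a"
  by (induction a) (simp_all add: poly_eval_mult poly_eval_1 poly_eval_power)

text \<open>The coordinate functions.\<close>

definition var_poly :: "'i \<Rightarrow> 'i cpoly" where
  "var_poly i = Poly_Mapping.single (Poly_Mapping.single i 1) 1"

lemma polys_var: "i \<in> I \<Longrightarrow> var_poly i \<in> polys I"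
  by (simp add: var_poly_def polys_single)

lemma poly_eval_var: "poly_eval (var_poly i) v = v i"
  by (simp add: var_poly_def poly_eval_single mon_eval_def)

text \<open>The polynomial expression with coefficients \<open>c\<close> and degree at most \<open>d\<close> in each of the
  polynomials \<open>f 0, \<dots>, f (k - 1)\<close>.\<close>

definition poly_comb :: "nat \<Rightarrow> nat \<Rightarrow> (nat list \<Rightarrow> complex) \<Rightarrow> (nat \<Rightarrow> 'i cpoly) \<Rightarrow> 'i cpoly" where
  "poly_comb k d c f = (\<Sum>a\<in>exps k d. Poly_Mapping.single 0 (c a) * mon f a)"

lemma polys_comb: "(\<And>j. j < k \<Longrightarrow> f j \<in> polys I) \<Longrightarrow> poly_comb k d c f \<in> polys I"
  unfolding poly_comb_def
  by (intro polys_sum polys_mult polys_const polys_mon) (auto simp: length_exps)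

lemma poly_eval_comb:
  "poly_eval (poly_comb k d c f) v = (\<Sum>a\<in>exps k d. c a * mon (\<lambda>j. poly_eval (f j) v) a)"
  by (simp add: poly_comb_def poly_eval_sum poly_eval_mult poly_eval_const poly_eval_mon)

lemma polyfn_poly_eval:
  assumes "f \<in> polys I" "\<And>i. i \<in> I \<Longrightarrow> polyfn M (\<lambda>u. \<Phi> u i)"
  shows "polyfn M (\<lambda>u. poly_eval f (\<Phi> u))"
  unfolding poly_eval_def mon_eval_def
  by (intro polyfn_sum polyfn_prod polyfn.mult polyfn.const polyfn_power assms(2))
     (use assms(1) in \<open>auto simp: polys_def\<close>)

lemma upoly_poly_eval:
  assumes "f \<in> polys I" "\<And>i. i \<in> I \<Longrightarrow> upoly (\<lambda>t. \<Phi> t i)"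
  shows "upoly (\<lambda>t. poly_eval f (\<Phi> t))"
  unfolding poly_eval_def mon_eval_def
  by (intro upoly_sum upoly_prod upoly_mult upoly_const upoly_power assms(2))
     (use assms(1) in \<open>auto simp: polys_def\<close>)

text \<open>The homogeneous component of degree \<open>e\<close>.\<close>

definition hom_part :: "'i cpoly \<Rightarrow> nat \<Rightarrow> 'i cpoly" where
  "hom_part f e = (\<Sum>a\<in>{a \<in> Poly_Mapping.keys f. mon_degree a = e}.
     Poly_Mapping.single a (Poly_Mapping.lookup f a))"

lemma hom_part_homogeneous:
  assumes "f \<in> polys I"
  shows "hom_part f e \<in> homogeneous_polys I"
proof -
  have "Poly_Mapping.keys (hom_part f e) \<subseteq> {a \<in> Poly_Mapping.keys f. mon_degree a = e}"
  proof
    fix b assume "b \<in> Poly_Mapping.keys (hom_part f e)"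
    then have "Poly_Mapping.lookup (hom_part f e) b \<noteq> 0" by (simp add: in_keys_iff)
    then show "b \<in> {a \<in> Poly_Mapping.keys f. mon_degree a = e}"
      unfolding hom_part_def lookup_sum
      by (rule sum.not_neutral_contains_not_neutral)
         (auto simp: lookup_single when_def split: if_splits)
  qed
  then show ?thesis
    using assms unfolding homogeneous_polys_def polys_def by blast
qed

lemma poly_eval_cscale_hom_parts:
  obtains D where
    "\<And>c v. poly_eval f (cscale c v) = (\<Sum>e\<le>D. poly_eval (hom_part f e) v * c ^ e)"
    "\<And>e. e > D \<Longrightarrow> hom_part f e = 0"
proof
  let ?K = "Poly_Mapping.keys f"
  let ?D = "\<Sum>a\<in>?K. mon_degree a"
  have D: "mon_degree a \<le> ?D" if "a \<in> ?K" for a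
    using that by (intro member_le_sum) auto
  show "hom_part f e = 0" if "e > ?D" for e
  proof -
    have "{a \<in> ?K. mon_degree a = e} = {}" using D that by fastforce
    then show ?thesis by (simp only: hom_part_def sum.empty)
  qed
  show "poly_eval f (cscale c v) = (\<Sum>e\<le>?D. poly_eval (hom_part f e) v * c ^ e)" for c v
  proof -
    have "poly_eval f (cscale c v) =
        (\<Sum>a\<in>?K. Poly_Mapping.lookup f a * mon_eval a v * c ^ mon_degree a)"
      by (simp add: poly_eval_def mon_eval_cscale mult_ac)
    also have "\<dots> = (\<Sum>e\<le>?D. \<Sum>a\<in>{a \<in> ?K. mon_degree a = e}.
        Poly_Mapping.lookup f a * mon_eval a v * c ^ mon_degree a)"
      by (rule sum.group[symmetric]) (use D in auto)
    also have "\<dots> = (\<Sum>e\<le>?D. poly_eval (hom_part f e) v * c ^ e)"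
      by (intro sum.cong)
         (auto simp: hom_part_def poly_eval_sum poly_eval_single sum_distrib_right)
    finally show ?thesis .
  qed
qed

text \<open>The zero locus in projective space of a polynomial that need not be homogeneous is closed:
  a polynomial vanishes on a punctured line through the origin iff all its homogeneous components
  do.\<close>

lemma closedin_zero_locus_poly:
  assumes "f \<in> polys I"
  shows "closedin (zariski I) (zero_locus I {f})"
proof -
  have hom: "hom_part f e \<in> homogeneous_polys I" for e
    using assms by (rule hom_part_homogeneous)
  have "(\<forall>w\<in>proj_pt v. poly_eval f w = 0) \<longleftrightarrow> (\<forall>e. poly_eval (hom_part f e) v = 0)" for v
  proof -
    obtain D where D: "\<And>c v. poly_eval f (cscale c v) = (\<Sum>e\<le>D. poly_eval (hom_part f e) v * c ^ e)"
      "\<And>e. e > D \<Longrightarrow> hom_part f e = 0"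
      using poly_eval_cscale_hom_parts[of f] by blast
    let ?h = "\<lambda>c. \<Sum>e\<le>D. poly_eval (hom_part f e) v * c ^ e"
    have "(\<forall>w\<in>proj_pt v. poly_eval f w = 0) \<longleftrightarrow> (\<forall>c. c \<noteq> 0 \<longrightarrow> ?h c = 0)"
      by (auto simp: proj_pt_def D(1))
    also have "\<dots> \<longleftrightarrow> (\<forall>c. ?h c = 0)"
    proof (intro iffI allI)
      fix c assume *: "\<forall>c. c \<noteq> 0 \<longrightarrow> ?h c = 0"
      show "?h c = 0"
        by (rule upoly_no_zero_divisors[of "\<lambda>t. t" ?h 1])
           (use * in \<open>auto intro!: upoly_id upoly_sum upoly_mult upoly_power upoly_const\<close>)
    qed simp
    also have "\<dots> \<longleftrightarrow> (\<forall>e\<le>D. poly_eval (hom_part f e) v = 0)"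
      by (rule polyfun_eq_0)
    also have "\<dots> \<longleftrightarrow> (\<forall>e. poly_eval (hom_part f e) v = 0)"
      using D(2) by (metis not_le_imp_less poly_eval_0)
    finally show ?thesis .
  qed
  moreover have "(\<forall>w\<in>proj_pt v. poly_eval (hom_part f e) w = 0) \<longleftrightarrow> poly_eval (hom_part f e) v = 0" for v e
    using hom by (rule poly_eval_proj_pt_iff)
  ultimately have "(\<forall>w\<in>p. poly_eval f w = 0) \<longleftrightarrow> (\<forall>g\<in>range (hom_part f). \<forall>w\<in>p. poly_eval g w = 0)"
    if "p \<in> proj_space I" for p
    using that unfolding proj_space_def by (elim imageE) simp
  then have "zero_locus I {f} = zero_locus I (range (hom_part f))"
    unfolding zero_locus_def by (intro Collect_cong) blast
  then show ?thesis
    unfolding closedin_zariski using hom by blast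
qed

lemma vanish_on_closure:
  assumes f: "f \<in> polys I" and A: "A \<subseteq> proj_space I" and 0: "\<And>v. v \<in> \<Union>A \<Longrightarrow> poly_eval f v = 0"
    and v: "v \<in> \<Union>(zariski I closure_of A)"
  shows "poly_eval f v = 0"
proof -
  have "A \<subseteq> zero_locus I {f}"
    using A 0 by (auto simp: zero_locus_def)
  then have "zariski I closure_of A \<subseteq> zero_locus I {f}"
    using closedin_zero_locus_poly[OF f] by (rule closure_of_minimal)
  then show ?thesis using v by (auto simp: zero_locus_def)
qed

lemma in_proj_pt: "w \<in> proj_pt v \<longleftrightarrow> (\<exists>c. c \<noteq> 0 \<and> w = cscale c v)"
  by (auto simp: proj_pt_def)

lemma proj_pt_cscale:
  assumes "t \<noteq> 0"
  shows "proj_pt (cscale t v) = proj_pt v"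
proof -
  have "w \<in> proj_pt (cscale t v) \<longleftrightarrow> w \<in> proj_pt v" for w
  proof
    assume "w \<in> proj_pt (cscale t v)"
    then obtain c where "c \<noteq> 0" "w = cscale (c * t) v"
      by (auto simp: in_proj_pt cscale_def fun_eq_iff)
    then show "w \<in> proj_pt v" using assms by (auto simp: in_proj_pt intro!: exI[of _ "c * t"])
  next
    assume "w \<in> proj_pt v"
    then obtain c where "c \<noteq> 0" "w = cscale (c / t) (cscale t v)"
      using assms by (auto simp: in_proj_pt cscale_def fun_eq_iff)
    then show "w \<in> proj_pt (cscale t v)"
      using assms by (auto simp: in_proj_pt intro!: exI[of _ "c / t"])
  qed
  then show ?thesis by blast
qed

lemma self_in_proj_pt: "v \<in> proj_pt v"
  by (auto simp: in_proj_pt cscale_def intro!: exI[of _ 1])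

lemma closedin_subset_proj_space: "closedin (zariski I) Z \<Longrightarrow> Z \<subseteq> proj_space I"
  using closedin_subset by (fastforce simp: topspace_zariski)


section \<open>Algebraic independence bounds the dimension from above\<close>

text \<open>The polynomials \<open>f 0, \<dots>, f (k - 1)\<close> satisfy no algebraic relation as functions on \<open>S\<close>.\<close>

definition alg_indep :: "('i \<Rightarrow> complex) set \<Rightarrow> nat \<Rightarrow> (nat \<Rightarrow> 'i cpoly) \<Rightarrow> bool" where
  "alg_indep S k f \<longleftrightarrow>
    (\<forall>d c. (\<forall>v\<in>S. poly_eval (poly_comb k d c f) v = 0) \<longrightarrow> (\<forall>a\<in>exps k d. c a = 0))"

lemma alg_indepD:
  "alg_indep S k f \<Longrightarrow> (\<And>v. v \<in> S \<Longrightarrow> poly_eval (poly_comb k d c f) v = 0) \<Longrightarrow> a \<in> exps k d \<Longrightarrow>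
    c a = 0"
  unfolding alg_indep_def by blast

lemma alg_indep_mono: "alg_indep S k f \<Longrightarrow> S \<subseteq> S' \<Longrightarrow> alg_indep S' k f"
  unfolding alg_indep_def by blast

text \<open>An irreducible closed set \<open>Z'\<close> carries more algebraically independent functions than a
  closed proper subset \<open>Z\<close>: add a homogeneous polynomial \<open>g\<close> that vanishes on \<open>Z\<close> but not on
  \<open>Z'\<close>.  A relation on \<open>Z'\<close> may be divided by powers of \<open>g\<close>, since \<open>Z'\<close> is irreducible, until
  its restriction to \<open>Z\<close> is a nontrivial relation between the old functions.\<close>

lemma alg_indep_step:
  assumes irr: "irreducible_closedin (zariski I) Z'" and clZ: "closedin (zariski I) Z"
    and sub: "Z \<subset> Z'" and ind: "alg_indep (\<Union>Z) k f" and f: "\<And>j. j < k \<Longrightarrow> f j \<in> polys I"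
  obtains g where "g \<in> polys I" "alg_indep (\<Union>Z') (Suc k) (f(k := g))"
proof -
  have clZ': "closedin (zariski I) Z'" using irr by (simp add: irreducible_closedin_def)
  obtain F where F: "F \<subseteq> homogeneous_polys I" "Z = zero_locus I F"
    using clZ by (auto simp: closedin_zariski)
  obtain p where p: "p \<in> Z'" "p \<notin> Z" using sub by auto
  then obtain g w where g: "g \<in> F" "w \<in> p" "poly_eval g w \<noteq> 0"
    using closedin_subset_proj_space[OF clZ'] F(2) by (auto simp: zero_locus_def)
  have ghom: "g \<in> homogeneous_polys I" and gI: "g \<in> polys I"
    using g(1) F(1) homogeneous_polys_subset by auto
  have gZ: "poly_eval g v = 0" if "v \<in> \<Union>Z" for v
    using that g(1) F(2) by (auto simp: zero_locus_def)
  have "c a = 0" if rel: "\<And>v. v \<in> \<Union>Z' \<Longrightarrow> poly_eval (poly_comb (Suc k) d c (f(k := g))) v = 0"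
    and a: "a \<in> exps (Suc k) d" for c d a
  proof (rule ccontr)
    assume "c a \<noteq> 0"
    define N where "N = (\<lambda>e. e \<le> d \<and> (\<exists>b\<in>exps k d. c (e # b) \<noteq> 0))"
    have "\<exists>e. N e" using a \<open>c a \<noteq> 0\<close> by (auto simp: N_def exps_Suc)
    then obtain e0 where e0: "N e0" "\<And>e. e < e0 \<Longrightarrow> \<not> N e"
      using exists_least_iff[of N] by auto
    define P where "P = (\<lambda>e. poly_comb k d (\<lambda>b. c (e # b)) f)"
    define Q where "Q = (\<Sum>e\<in>{e0..d}. g ^ (e - e0) * P e)"
    have PI: "P e \<in> polys I" for e
      unfolding P_def by (rule polys_comb[OF f])
    have QI: "Q \<in> polys I"
      unfolding Q_def by (intro polys_sum polys_mult polys_power gI PI)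
    have split: "poly_eval (poly_comb (Suc k) d c (f(k := g))) v =
        (\<Sum>e\<le>d. poly_eval g v ^ e * poly_eval (P e) v)" for v
    proof -
      have "mon (\<lambda>j. poly_eval ((f(k := g)) j) v) b = mon (\<lambda>j. poly_eval (f j) v) b"
        if "b \<in> exps k d" for b
        using that by (intro mon_cong) (auto simp: length_exps)
      then show ?thesis
        unfolding P_def poly_eval_comb sum_exps_Suc sum_distrib_left
        by (intro sum.cong) (auto simp: length_exps mult_ac)
    qed
    have P0: "poly_eval (P e) v = 0" if "e < e0" for e v
      using e0(2)[OF that] e0(1) that by (auto simp: P_def N_def poly_eval_comb)
    have factor: "poly_eval g v ^ e0 * poly_eval Q v =
        poly_eval (poly_comb (Suc k) d c (f(k := g))) v" for v
    proof -
      have "poly_eval g v ^ e0 * poly_eval Q v =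
          (\<Sum>e\<in>{e0..d}. poly_eval g v ^ e * poly_eval (P e) v)"
        by (simp add: Q_def poly_eval_sum poly_eval_mult poly_eval_power sum_distrib_left
            mult.assoc[symmetric] power_add[symmetric])
      also have "\<dots> = (\<Sum>e\<le>d. poly_eval g v ^ e * poly_eval (P e) v)"
        by (rule sum.mono_neutral_left) (auto simp: P0)
      finally show ?thesis by (simp add: split)
    qed
    have gQ: "poly_eval g v = 0 \<or> poly_eval Q v = 0" if "v \<in> \<Union>Z'" for v
      using factor[of v] rel[OF that] by auto
    define A where "A = Z' \<inter> zero_locus I {g}"
    define B where "B = Z' \<inter> zero_locus I {Q}"
    have "closedin (zariski I) A" "closedin (zariski I) B"
      unfolding A_def B_def by (auto intro: closedin_Int clZ' closedin_zero_locus_poly gI QI)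
    moreover have "Z' = A \<union> B"
    proof -
      have "q \<in> zero_locus I {g} \<or> q \<in> zero_locus I {Q}" if q: "q \<in> Z'" for q
      proof -
        have qI: "q \<in> proj_space I" using q closedin_subset_proj_space[OF clZ'] by auto
        then obtain v where v: "q = proj_pt v" by (auto simp: proj_space_def)
        show ?thesis
        proof (cases "\<forall>w\<in>q. poly_eval g w = 0")
          case False
          have "poly_eval g w \<noteq> 0" if wq: "w \<in> q" for w
          proof -
            have "proj_pt w = proj_pt v" using wq v by (auto simp: in_proj_pt proj_pt_cscale)
            then show ?thesis
              using False poly_eval_proj_pt_iff[OF ghom, of w] v by auto
          qed
          then show ?thesis
            using gQ q qI by (auto simp: zero_locus_def)
        qed (use qI in \<open>auto simp: zero_locus_def\<close>)
      qed
      then show ?thesis by (auto simp: A_def B_def)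
    qed
    ultimately have "Z' = A \<or> Z' = B"
      using irr by (auto simp: irreducible_closedin_def)
    moreover have "Z' \<noteq> A"
      using p(1) g by (auto simp: A_def zero_locus_def)
    ultimately have QZ': "poly_eval Q v = 0" if "v \<in> \<Union>Z'" for v
      using that by (auto simp: B_def zero_locus_def)
    have "poly_eval (P e0) v = 0" if v: "v \<in> \<Union>Z" for v
    proof -
      have "poly_eval Q v = (\<Sum>e\<in>{e0..d}. if e = e0 then poly_eval (P e) v else 0)"
        unfolding Q_def poly_eval_sum poly_eval_mult poly_eval_power gZ[OF v]
        by (intro sum.cong) auto
      also have "\<dots> = poly_eval (P e0) v"
        using e0(1) by (simp add: N_def)
      finally show ?thesis using QZ'[of v] v sub by auto
    qed
    then have "\<forall>b\<in>exps k d. c (e0 # b) = 0"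
      using alg_indepD[OF ind, of d "\<lambda>b. c (e0 # b)"] unfolding P_def by blast
    then show False using e0(1) by (auto simp: N_def)
  qed
  then have "alg_indep (\<Union>Z') (Suc k) (f(k := g))"
    unfolding alg_indep_def by blast
  then show ?thesis using that gI by blast
qed

lemma alg_indep_chain:
  fixes C :: "nat \<Rightarrow> ('i \<Rightarrow> complex) set set"
  assumes "\<And>i. i \<le> r \<Longrightarrow> irreducible_closedin (zariski I) (C i)" "\<And>i. i < r \<Longrightarrow> C i \<subset> C (Suc i)"
  shows "\<exists>f. (\<forall>j<Suc r. f j \<in> polys I) \<and> alg_indep (\<Union>(C r)) (Suc r) f"
  using assms
proof (induction r)
  case 0
  then obtain p where p: "p \<in> C 0" and cl: "closedin (zariski I) (C 0)"
    by (auto simp: irreducible_closedin_def)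
  then obtain v where v: "p = proj_pt v" "v \<in> coord_space I" "v \<noteq> 0"
    using closedin_subset_proj_space[OF cl] by (auto simp: proj_space_def)
  then obtain i where i: "v i \<noteq> 0" "i \<in> I"
    by (auto simp: coord_space_def fun_eq_iff)
  have "alg_indep (\<Union>(C 0)) (Suc 0) (\<lambda>_. var_poly i)"
    unfolding alg_indep_def
  proof (intro allI impI ballI)
    fix d c a
    assume rel: "\<forall>w\<in>\<Union>(C 0). poly_eval (poly_comb (Suc 0) d c (\<lambda>_. var_poly i)) w = 0"
      and a: "a \<in> exps (Suc 0) d"
    let ?h = "\<lambda>t. \<Sum>e\<le>d. (c [e] * v i ^ e) * t ^ e"
    have "?h t = 0" if "t \<noteq> 0" for t
    proof -
      have "cscale t v \<in> p" using v(1) that by (auto simp: in_proj_pt)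
      then have "cscale t v \<in> \<Union>(C 0)" using p by blast
      then have "poly_eval (poly_comb (Suc 0) d c (\<lambda>_. var_poly i)) (cscale t v) = 0"
        using rel by blast
      then show ?thesis
        by (simp add: poly_eval_comb sum_exps_Suc poly_eval_var cscale_def power_mult_distrib mult_ac)
    qed
    then have "?h t = 0" for t
      by (intro upoly_no_zero_divisors[of "\<lambda>t. t" ?h 1])
         (auto intro!: upoly_id upoly_sum upoly_mult upoly_power upoly_const)
    then have "\<forall>e\<le>d. c [e] * v i ^ e = 0"
      using polyfun_eq_0[of "\<lambda>e. c [e] * v i ^ e" d] by simp
    then show "c a = 0"
      using a i(1) by (auto simp: exps_Suc)
  qed
  then show ?case
    using polys_var[OF i(2)] by (intro exI[of _ "\<lambda>_. var_poly i"]) simp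
next
  case (Suc r)
  have "\<exists>f. (\<forall>j<Suc r. f j \<in> polys I) \<and> alg_indep (\<Union>(C r)) (Suc r) f"
    by (rule Suc.IH) (simp_all add: Suc.prems)
  then obtain f where f: "\<forall>j<Suc r. f j \<in> polys I" "alg_indep (\<Union>(C r)) (Suc r) f"
    by blast
  have irr: "irreducible_closedin (zariski I) (C r)" "irreducible_closedin (zariski I) (C (Suc r))"
    by (simp_all add: Suc.prems)
  then have cl: "closedin (zariski I) (C r)"
    by (simp add: irreducible_closedin_def)
  obtain g where "g \<in> polys I" "alg_indep (\<Union>(C (Suc r))) (Suc (Suc r)) (f(Suc r := g))"
    using alg_indep_step[OF irr(2) cl Suc.prems(2)[OF lessI] f(2)] f(1) by blast
  moreover from this have "\<forall>j<Suc (Suc r). (f(Suc r := g)) j \<in> polys I"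
    using f(1) by (auto simp: less_Suc_eq)
  ultimately show ?case by blast
qed

lemma irreducible_closedin_subtopology:
  assumes "closedin T S"
  shows "irreducible_closedin (subtopology T S) Z \<longleftrightarrow> irreducible_closedin T Z \<and> Z \<subseteq> S"
  unfolding irreducible_closedin_def closedin_closed_subtopology[OF assms]
  by blast

text \<open>If every polynomial that vanishes on the image of a polynomial map in \<open>M\<close> variables also
  vanishes on the cone over \<open>A\<close>, then the closure of \<open>A\<close> has dimension at most \<open>M - 1\<close>.\<close>

lemma krull_dim_closure_le:
  fixes I :: "'i set"
  assumes A: "A \<subseteq> proj_space I"
    and poly: "\<And>i. i \<in> I \<Longrightarrow> polyfn M (\<lambda>u. \<Phi> u i)"
    and dense: "\<And>f v. f \<in> polys I \<Longrightarrow> (\<And>u. poly_eval f (\<Phi> u) = 0) \<Longrightarrow> v \<in> \<Union>A \<Longrightarrow> poly_eval f v = 0"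
  shows "krull_dim (subtopology (zariski I) (zariski I closure_of A)) \<le> enat (M - 1)"
  unfolding krull_dim_def
proof (rule Sup_least, clarify)
  let ?S = "zariski I closure_of A"
  fix r and C :: "nat \<Rightarrow> ('i \<Rightarrow> complex) set set"
  assume "\<forall>i\<le>r. irreducible_closedin (subtopology (zariski I) ?S) (C i)"
    and C2: "\<forall>i<r. C i \<subset> C (Suc i)"
  then have C1: "\<And>i. i \<le> r \<Longrightarrow> irreducible_closedin (zariski I) (C i)" "C r \<subseteq> ?S"
    by (auto simp: irreducible_closedin_subtopology)
  then obtain f where f: "\<And>j. j < Suc r \<Longrightarrow> f j \<in> polys I" "alg_indep (\<Union>(C r)) (Suc r) f"
    using alg_indep_chain[of r I C] C2 by auto
  then have ind: "alg_indep (\<Union>?S) (Suc r) f"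
    using C1(2) by (auto intro: alg_indep_mono)
  have "Suc r \<le> M"
  proof (rule ccontr)
    assume "\<not> Suc r \<le> M"
    then obtain d c where c: "\<exists>a\<in>exps (Suc r) d. c a \<noteq> 0"
      "\<forall>u. (\<Sum>a\<in>exps (Suc r) d. c a * mon (\<lambda>j. poly_eval (f j) (\<Phi> u)) a) = 0"
      using polyfn_dependent[of "Suc r" M "\<lambda>j u. poly_eval (f j) (\<Phi> u)"]
        polyfn_poly_eval[OF f(1) poly] by auto
    have QI: "poly_comb (Suc r) d c f \<in> polys I"
      using f(1) by (rule polys_comb)
    have "poly_eval (poly_comb (Suc r) d c f) v = 0" if "v \<in> \<Union>?S" for v
      using vanish_on_closure[OF QI A dense[OF QI] that] c(2) by (simp add: poly_eval_comb)
    then show False using alg_indepD[OF ind] c(1) by blast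
  qed
  then show "enat r \<le> enat (M - 1)" by simp
qed

section \<open>Chains of images bound the dimension from below\<close>

text \<open>The standard basis vectors.\<close>

definition unit_vec :: "'i \<Rightarrow> 'i \<Rightarrow> complex" where
  "unit_vec i = (\<lambda>j. if j = i then 1 else 0)"

lemma coord_space_expand:
  assumes "finite I" "v \<in> coord_space I"
  shows "v = (\<Sum>i\<in>I. cscale (v i) (unit_vec i))"
proof
  fix j
  have "(\<Sum>i\<in>I. v i * unit_vec i j) = (\<Sum>i\<in>I. if i = j then v i else 0)"
    by (intro sum.cong) (auto simp: unit_vec_def)
  then show "v j = (\<Sum>i\<in>I. cscale (v i) (unit_vec i)) j"
    using assms by (auto simp: sum_apply cscale_def coord_space_def)
qed

text \<open>Coordinates with respect to an extended basis are linear functionals.\<close>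

lemma representation_extend_basis:
  assumes "finite I" "v \<in> coord_space I" "cvec.independent B"
  shows "cvec.representation (cvec.extend_basis B) v w =
    (\<Sum>i\<in>I. cvec.representation (cvec.extend_basis B) (unit_vec i) w * v i)"
proof -
  let ?E = "cvec.extend_basis B"
  have E: "cvec.independent ?E" "\<And>v. v \<in> cvec.span ?E"
    using cvec.independent_extend_basis[OF assms(3)] cvec.span_extend_basis[OF assms(3)] by auto
  have "cvec.representation ?E v =
      cvec.representation ?E (\<Sum>i\<in>I. cscale (v i) (unit_vec i))"
    using coord_space_expand[OF assms(1,2)] by simp
  also have "\<dots> = (\<lambda>b. \<Sum>i\<in>I. v i * cvec.representation ?E (unit_vec i) b)"
    using E by (simp add: cvec.representation_sum cvec.representation_scale)
  finally show ?thesis by (simp add: mult.commute)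
qed

lemma dual_functionals:
  fixes w :: "nat \<Rightarrow> 'i \<Rightarrow> complex"
  assumes "finite I" "cvec.independent (w ` {..D})" "inj_on w {..D}" "\<And>b. b \<le> D \<Longrightarrow> w b \<in> coord_space I"
  shows "\<exists>l :: nat \<Rightarrow> 'i \<Rightarrow> complex.
    \<forall>a\<le>D. \<forall>b\<le>D. (\<Sum>i\<in>I. l a i * w b i) = (if a = b then 1 else 0)"
proof (intro exI allI impI)
  let ?E = "cvec.extend_basis (w ` {..D})"
  let ?l = "\<lambda>a i. cvec.representation ?E (unit_vec i) (w a)"
  fix a b assume ab: "a \<le> D" "b \<le> D"
  have "w b \<in> ?E" using cvec.extend_basis_superset[OF assms(2)] ab by auto
  then have "cvec.representation ?E (w b) = (\<lambda>v. if v = w b then 1 else 0)"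
    by (rule cvec.representation_basis[OF cvec.independent_extend_basis[OF assms(2)]])
  moreover have "w a = w b \<longleftrightarrow> a = b"
    using inj_on_eq_iff[OF assms(3)] ab by simp
  ultimately have "cvec.representation ?E (w b) (w a) = (if a = b then 1 else 0)"
    by simp
  then show "(\<Sum>i\<in>I. ?l a i * w b i) = (if a = b then 1 else 0)"
    using representation_extend_basis[OF assms(1) assms(4)[OF ab(2)] assms(2)] by simp
qed

text \<open>Vectors that are annihilated by no nonzero functional span the space.\<close>

lemma span_if_no_annihilator:
  assumes I: "finite I" and S: "S \<subseteq> coord_space I"
    and ann: "\<And>F i. (\<And>w. w \<in> S \<Longrightarrow> (\<Sum>i\<in>I. F i * w i) = 0) \<Longrightarrow> i \<in> I \<Longrightarrow> F i = 0"
    and v: "v \<in> coord_space I"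
  shows "v \<in> cvec.span S"
proof (rule ccontr)
  assume nv: "v \<notin> cvec.span S"
  obtain B where B: "B \<subseteq> S" "cvec.independent B" "S \<subseteq> cvec.span B"
    using cvec.maximal_independent_subset by metis
  have "cvec.span S = cvec.span B"
    using B by (metis cvec.span_mono cvec.span_minimal cvec.subspace_span subset_antisym)
  then have nvB: "v \<notin> cvec.span B" using nv by simp
  then have ind: "cvec.independent (insert v B)"
    using B(2) cvec.independent_insertI by blast
  let ?E = "cvec.extend_basis (insert v B)"
  have E: "cvec.independent ?E" "insert v B \<subseteq> ?E"
    using cvec.independent_extend_basis[OF ind] cvec.extend_basis_superset[OF ind] by auto
  define F where "F = (\<lambda>i. cvec.representation ?E (unit_vec i) v)"
  have rep: "(\<Sum>i\<in>I. F i * w i) = cvec.representation ?E w v" if "w \<in> coord_space I" for w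
    using representation_extend_basis[OF I that ind] by (simp add: F_def)
  have "cvec.representation ?E w v = 0" if "w \<in> cvec.span B" for w
    using that
  proof (induction rule: cvec.span_induct_alt)
    case base
    then show ?case
      using cvec.representation_zero[of ?E] by (simp add: zero_fun_def[symmetric])
  next
    case (step c x y)
    have sp: "\<And>x. x \<in> cvec.span ?E" using cvec.span_extend_basis[OF ind] by auto
    have "x \<noteq> v" using step(1) nvB cvec.span_base by auto
    then have "cvec.representation ?E x v = 0"
      using cvec.representation_basis[OF E(1), of x] E(2) step(1) by auto
    then show ?case
      unfolding cvec.representation_add[OF E(1) sp sp] cvec.representation_scale[OF E(1) sp]
      using step(2) by simp
  qed
  note * = this
  have "(\<Sum>i\<in>I. F i * w i) = 0" if "w \<in> S" for w
  proof -
    have "w \<in> coord_space I" "w \<in> cvec.span B" using that S B(3) by auto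
    then show ?thesis using * by (simp add: rep)
  qed
  then have "F i = 0" if "i \<in> I" for i using ann that by blast
  then have "cvec.representation ?E v v = 0" using rep[OF v] by simp
  moreover have "cvec.representation ?E v v = 1"
    using cvec.representation_basis[OF E(1), of v] E(2) by auto
  ultimately show False by simp
qed

lemma irreducible_closure_image:
  assumes poly: "\<And>i. i \<in> I \<Longrightarrow> polyfn M (\<lambda>u. \<Phi> u i)" and sp: "\<And>u. \<Phi> u \<in> coord_space I"
    and nz: "\<Phi> u0 \<noteq> 0"
  shows "irreducible_closedin (zariski I) (zariski I closure_of {proj_pt (\<Phi> u) | u. \<Phi> u \<noteq> 0})"
proof -
  let ?B = "{proj_pt (\<Phi> u) | u. \<Phi> u \<noteq> 0}"
  let ?Z = "zariski I closure_of ?B"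
  have BI: "?B \<subseteq> proj_space I" using sp by (auto simp: proj_space_def)
  then have BZ: "?B \<subseteq> ?Z" by (intro closure_of_subset) (simp add: topspace_zariski)
  obtain x where x: "\<Phi> u0 x \<noteq> 0" "x \<in> I"
    using nz sp[of u0] by (fastforce simp: coord_space_def fun_eq_iff)
  have notin: "\<exists>f\<in>homogeneous_polys I. (\<forall>p\<in>A. \<forall>v\<in>p. poly_eval f v = 0) \<and> (\<exists>u. poly_eval f (\<Phi> u) \<noteq> 0)"
    if A: "closedin (zariski I) A" and nB: "\<not> ?B \<subseteq> A" for A
  proof -
    obtain F where F: "F \<subseteq> homogeneous_polys I" "A = zero_locus I F"
      using A by (auto simp: closedin_zariski)
    obtain u where u: "\<Phi> u \<noteq> 0" "proj_pt (\<Phi> u) \<notin> A" using nB by auto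
    then obtain f where "f \<in> F" "\<not> (\<forall>w\<in>proj_pt (\<Phi> u). poly_eval f w = 0)"
      using F(2) BI by (auto simp: zero_locus_def)
    then have f: "f \<in> F" "f \<in> homogeneous_polys I" "poly_eval f (\<Phi> u) \<noteq> 0"
      using poly_eval_proj_pt_iff[of f I "\<Phi> u"] F(1) by auto
    moreover have "\<forall>p\<in>A. \<forall>v\<in>p. poly_eval f v = 0"
      using f(1) F(2) by (auto simp: zero_locus_def)
    ultimately show ?thesis by (intro bexI[of _ f] conjI exI[of _ u])
  qed
  have "?Z = A \<or> ?Z = B"
    if A: "closedin (zariski I) A" and B: "closedin (zariski I) B" and Z: "?Z = A \<union> B" for A B
  proof (rule ccontr)
    assume neq: "\<not> (?Z = A \<or> ?Z = B)"
    have nAB: "\<not> ?B \<subseteq> A" "\<not> ?B \<subseteq> B"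
      using closure_of_minimal[OF _ A, of ?B] closure_of_minimal[OF _ B, of ?B] Z neq by blast+
    obtain f a where
      f: "f \<in> homogeneous_polys I" "\<forall>p\<in>A. \<forall>v\<in>p. poly_eval f v = 0" "poly_eval f (\<Phi> a) \<noteq> 0"
      using notin[OF A nAB(1)] by blast
    obtain g b where
      g: "g \<in> homogeneous_polys I" "\<forall>p\<in>B. \<forall>v\<in>p. poly_eval g v = 0" "poly_eval g (\<Phi> b) \<noteq> 0"
      using notin[OF B nAB(2)] by blast
    have fg: "f \<in> polys I" "g \<in> polys I"
      using f(1) g(1) homogeneous_polys_subset by auto
    have pf: "polyfn M (\<lambda>u. poly_eval f (\<Phi> u))" "polyfn M (\<lambda>u. poly_eval g (\<Phi> u))"
      by (rule polyfn_poly_eval[OF fg(1) poly], assumption)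
         (rule polyfn_poly_eval[OF fg(2) poly], assumption)
    have "poly_eval f (\<Phi> u) * (poly_eval g (\<Phi> u) * \<Phi> u x) = 0" for u
    proof (cases "\<Phi> u = 0")
      case False
      then have "proj_pt (\<Phi> u) \<in> A \<union> B" using BZ Z by blast
      then show ?thesis using f(2) g(2) self_in_proj_pt by auto
    qed simp
    then have "poly_eval g (\<Phi> u) * \<Phi> u x = 0" for u
      by (rule polyfn_no_zero_divisors[OF pf(1) polyfn.mult[OF pf(2) poly[OF x(2)]] _ f(3)])
    then have "\<Phi> u x = 0" for u
      by (rule polyfn_no_zero_divisors[OF pf(2) poly[OF x(2)] _ g(3)])
    then show False using x(1) by blast
  qed
  moreover have "?Z \<noteq> {}" using BZ nz by blast
  ultimately show ?thesis
    unfolding irreducible_closedin_def by simp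
qed

text \<open>If the polynomials \<open>h 0, \<dots>, h (k - 1)\<close> in \<open>t\<close> are \<open>h j = t z\<^sub>j + O(t\<^sup>2)\<close>, then the terms of
  lowest total degree of a relation between them give a relation between the \<open>z\<^sub>j\<close>.\<close>

lemma lowest_terms_vanish:
  fixes z :: "nat \<Rightarrow> complex"
  assumes rel: "\<And>t. (\<Sum>a\<in>exps k d. c a * mon (\<lambda>j. h j t) a) = 0"
    and h: "\<And>j t. j < k \<Longrightarrow> h j t = t * (z j + t * poly (H j) t)"
    and low: "\<And>a. a \<in> exps k d \<Longrightarrow> c a \<noteq> 0 \<Longrightarrow> e \<le> sum_list a"
  shows "(\<Sum>a\<in>exps k d. (if sum_list a = e then c a else 0) * mon z a) = 0"
proof -
  let ?y = "\<lambda>t j. z j + t * poly (H j) t"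
  have mon_h: "mon (\<lambda>j. h j t) a = t ^ sum_list a * mon (?y t) a" if "length a \<le> k" for a t
    using that by (induction a) (auto simp: h power_mult_distrib power_add mult_ac)
  define R where "R = (\<lambda>t. \<Sum>a\<in>exps k d. (c a * t ^ (sum_list a - e)) * mon (?y t) a)"
  have "t ^ e * R t = (\<Sum>a\<in>exps k d. c a * mon (\<lambda>j. h j t) a)" for t
    unfolding R_def sum_distrib_left
  proof (intro sum.cong refl)
    fix a assume a: "a \<in> exps k d"
    show "t ^ e * (c a * t ^ (sum_list a - e) * mon (?y t) a) = c a * mon (\<lambda>j. h j t) a"
    proof (cases "c a = 0")
      case False
      then have "t ^ e * t ^ (sum_list a - e) = t ^ sum_list a"
        using low[OF a] by (simp add: power_add[symmetric])
      moreover have "mon (\<lambda>j. h j t) a = t ^ sum_list a * mon (?y t) a"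
        using mon_h a by (simp add: length_exps)
      ultimately show ?thesis by (simp add: algebra_simps)
    qed simp
  qed
  then have "t ^ e * R t = 0" for t using rel by simp
  moreover have "upoly (\<lambda>t. mon (?y t) a)" for a
    by (induction a)
       (auto intro!: upoly_mult upoly_power upoly_add upoly_const upoly_id simp: upoly_def[of "poly _"])
  then have "upoly R"
    unfolding R_def by (intro upoly_sum upoly_mult upoly_power upoly_const upoly_id)
  ultimately have "R 0 = 0"
    by (intro upoly_no_zero_divisors[of "\<lambda>t. t ^ e" R 1]) (auto intro: upoly_power upoly_id)
  moreover have "R 0 = (\<Sum>a\<in>exps k d. (if sum_list a = e then c a else 0) * mon z a)"
    unfolding R_def
  proof (intro sum.cong refl)
    fix a assume a: "a \<in> exps k d"
    show "c a * 0 ^ (sum_list a - e) * mon (?y 0) a = (if sum_list a = e then c a else 0) * mon z a"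
      using low[OF a] by (cases "c a = 0") auto
  qed
  ultimately show ?thesis by simp
qed

text \<open>The lower bound: \<open>\<Psi>\<close> maps affine \<open>D\<close>-space to the cone over \<open>A\<close>, and its value and partial
  derivatives at the origin are linearly independent.  The closures of the images of the coordinate
  flag then form a strictly increasing chain of irreducible closed sets.  Strictness: the cone over
  the image of \<open>i\<close>-space is parametrised by \<open>i + 1\<close> variables, so any \<open>i + 2\<close> functions satisfy a
  relation on it, while \<open>i + 2\<close> linear functionals dual to the value and the derivatives satisfy no
  relation on the next cone, by the lowest order terms at the origin.\<close>

lemma krull_dim_closure_ge:
  fixes I :: "'i set" and \<Psi> :: "(nat \<Rightarrow> complex) \<Rightarrow> 'i \<Rightarrow> complex"
  assumes I: "finite I" and A: "A \<subseteq> proj_space I"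
    and sp: "\<And>u. \<Psi> u \<in> coord_space I"
    and poly: "\<And>i. i \<in> I \<Longrightarrow> polyfn D (\<lambda>u. \<Psi> u i)"
    and mem: "\<And>u. \<Psi> u \<noteq> 0 \<Longrightarrow> proj_pt (\<Psi> u) \<in> A"
    and ind: "cvec.independent (w ` {..D})" "inj_on w {..D}" and w: "\<And>b. b \<le> D \<Longrightarrow> w b \<in> coord_space I"
    and expand: "\<And>u i. i \<in> I \<Longrightarrow> \<exists>H. \<forall>t. \<Psi> (\<lambda>j. t * u j) i =
      w 0 i + t * (\<Sum>j<D. u j * w (Suc j) i) + t\<^sup>2 * poly H t"
  shows "enat D \<le> krull_dim (subtopology (zariski I) (zariski I closure_of A))"
proof -
  define trunc :: "nat \<Rightarrow> (nat \<Rightarrow> complex) \<Rightarrow> nat \<Rightarrow> complex"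
    where "trunc = (\<lambda>i u j. if j < i then u j else 0)"
  define B where "B = (\<lambda>i. {proj_pt (\<Psi> (trunc i u)) | u. \<Psi> (trunc i u) \<noteq> 0})"
  define Z where "Z = (\<lambda>i. zariski I closure_of B i)"
  have "w 0 \<noteq> 0" using ind(1) cvec.dependent_zero[of "w ` {..D}"] by force
  then obtain x where x: "w 0 x \<noteq> 0" "x \<in> I"
    using w[of 0] by (fastforce simp: coord_space_def fun_eq_iff)
  have \<Psi>0: "\<Psi> (\<lambda>j. 0) i = w 0 i" if i: "i \<in> I" for i
  proof -
    obtain H where "\<forall>t. \<Psi> (\<lambda>j. t * 0) i = w 0 i + t * (\<Sum>j<D. 0 * w (Suc j) i) + t\<^sup>2 * poly H t"
      using expand[OF i, of "\<lambda>_. 0"] by blast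
    from this[rule_format, of 0] show ?thesis by simp
  qed
  have trunc0: "trunc i (\<lambda>j. 0) = (\<lambda>j. 0)" for i by (auto simp: trunc_def)
  have nz: "\<Psi> (trunc i (\<lambda>j. 0)) \<noteq> 0" for i
    using \<Psi>0[OF x(2)] x(1) by (auto simp: trunc0)
  have polyfn_trunc: "polyfn i (\<lambda>u. trunc i u j)" for i j
    by (cases "j < i") (simp_all add: trunc_def polyfn.var polyfn.const)
  have ptrunc: "polyfn i (\<lambda>u. \<Psi> (trunc i u) y)" if "y \<in> I" for i y
    using poly[OF that]
    by (rule polyfn_subst) (rule polyfn_trunc)
  have irr: "irreducible_closedin (zariski I) (Z i)" for i
    unfolding Z_def B_def by (rule irreducible_closure_image[OF ptrunc sp nz])
  have BA: "B i \<subseteq> A" for i using mem by (auto simp: B_def)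
  then have BI: "B i \<subseteq> proj_space I" for i using A by blast
  have BZ: "B i \<subseteq> Z i" for i
    unfolding Z_def using BI by (intro closure_of_subset) (simp add: topspace_zariski)
  have ZA: "Z i \<subseteq> zariski I closure_of A" for i
    unfolding Z_def by (intro closure_of_mono BA)
  have B_mono: "B i \<subseteq> B (Suc i)" for i
  proof -
    have "trunc i u = trunc (Suc i) (trunc i u)" for u by (auto simp: trunc_def)
    then have "proj_pt (\<Psi> (trunc i u)) \<in> B (Suc i)" if "\<Psi> (trunc i u) \<noteq> 0" for u
      unfolding B_def using that by (intro CollectI exI[of _ "trunc i u"]) simp
    then show ?thesis by (subst B_def) blast
  qed
  have Z_mono: "Z i \<subseteq> Z (Suc i)" for i
    unfolding Z_def by (intro closure_of_mono B_mono)
  obtain l where "\<forall>a\<le>D. \<forall>b\<le>D. (\<Sum>i\<in>I. l a i * w b i) = (if a = b then 1 else 0)"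
    using dual_functionals[OF I ind w] by blast
  then have l: "(\<Sum>i\<in>I. l a i * w b i) = (if a = b then 1 else 0)" if "a \<le> D" "b \<le> D" for a b
    using that by simp
  \<comment> \<open>The functional dual to the value of \<open>\<Psi>\<close> is shifted, so that all functions vanish at the
    base point.\<close>
  define L where "L = (\<lambda>a. (\<Sum>i\<in>I. Poly_Mapping.single 0 (l a i) * var_poly i) +
    Poly_Mapping.single 0 (if a = 0 then -1 else 0))"
  have LI: "L a \<in> polys I" for a
    unfolding L_def by (intro polys_add polys_sum polys_mult polys_const polys_var)
  have L: "poly_eval (L a) v = (\<Sum>i\<in>I. l a i * v i) + (if a = 0 then -1 else 0)" for a v
    by (simp add: L_def poly_eval_add poly_eval_sum poly_eval_mult poly_eval_const poly_eval_var)
  have strict: "Z i \<noteq> Z (Suc i)" if i: "i < D" for i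
  proof
    assume eq: "Z i = Z (Suc i)"
    let ?k = "Suc (Suc i)"
    let ?v = "\<lambda>u. cscale (u 0) (\<Psi> (trunc i (\<lambda>j. u (Suc j))))"
    have "polyfn (Suc i) (\<lambda>u. ?v u y)" if "y \<in> I" for y
    proof -
      have "polyfn (Suc i) (\<lambda>u. \<Psi> (trunc i (\<lambda>j. u (Suc j))) y)"
        using ptrunc[OF that]
        by (rule polyfn_subst) (rule polyfn.var, simp)
      then show ?thesis
        unfolding cscale_def by (intro polyfn.mult polyfn.var) auto
    qed
    then have "polyfn (Suc i) (\<lambda>u. poly_eval (L j) (?v u))" for j
      by (rule polyfn_poly_eval[OF LI])
    then have "\<exists>d c. (\<exists>a\<in>exps ?k d. c a \<noteq> 0) \<and>
        (\<forall>u. (\<Sum>a\<in>exps ?k d. c a * mon (\<lambda>j. poly_eval (L j) (?v u)) a) = 0)"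
      by (rule polyfn_dependent) simp
    then obtain d c where c: "\<exists>a\<in>exps ?k d. c a \<noteq> 0" and
      c0: "\<forall>u. (\<Sum>a\<in>exps ?k d. c a * mon (\<lambda>j. poly_eval (L j) (?v u)) a) = 0"
      by blast
    define Q where "Q = poly_comb ?k d c L"
    have QI: "Q \<in> polys I" unfolding Q_def by (rule polys_comb[OF LI])
    have "poly_eval Q v = 0" if v: "v \<in> \<Union>(B i)" for v
    proof -
      obtain u \<tau> where "v = cscale \<tau> (\<Psi> (trunc i u))"
        using v by (auto simp: B_def in_proj_pt)
      then show ?thesis
        using c0[rule_format, of "\<lambda>j. case j of 0 \<Rightarrow> \<tau> | Suc j \<Rightarrow> u j"] by (simp add: Q_def poly_eval_comb)
    qed
    then have QZ: "poly_eval Q v = 0" if "v \<in> \<Union>(Z i)" for v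
      using that unfolding Z_def by (rule vanish_on_closure[OF QI BI])
    have QB: "poly_eval Q v = 0" if "v \<in> \<Union>(B (Suc i))" for v
      using that BZ[of "Suc i"] eq by (intro QZ) blast
    define e where "e = Min (sum_list ` {a \<in> exps ?k d. c a \<noteq> 0})"
    have fin: "finite {a \<in> exps ?k d. c a \<noteq> 0}" by simp
    have low: "e \<le> sum_list a" if "a \<in> exps ?k d" "c a \<noteq> 0" for a
      unfolding e_def using that fin by (intro Min_le) auto
    have "e \<in> sum_list ` {a \<in> exps ?k d. c a \<noteq> 0}"
      unfolding e_def using c by (intro Min_in) auto
    then obtain a0 where a0: "a0 \<in> exps ?k d" "c a0 \<noteq> 0" "sum_list a0 = e" by auto
    have "(\<Sum>a\<in>exps ?k d. (if sum_list a = e then c a else 0) * mon z a) = 0" for z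
    proof -
      define u where "u = trunc (Suc i) (\<lambda>j. z (Suc j))"
      have tu: "(\<lambda>j. t * u j) = trunc (Suc i) (\<lambda>j. t * u j)" for t
        by (auto simp: u_def trunc_def)
      define y where "y = (\<lambda>t. cscale (1 + t * z 0) (\<Psi> (\<lambda>j. t * u j)))"
      have "\<exists>H. \<forall>y\<in>I. \<forall>t. \<Psi> (\<lambda>j. t * u j) y =
          w 0 y + t * (\<Sum>j<D. u j * w (Suc j) y) + t\<^sup>2 * poly (H y) t"
        by (intro bchoice ballI expand)
      then obtain H where "\<forall>y\<in>I. \<forall>t. \<Psi> (\<lambda>j. t * u j) y =
          w 0 y + t * (\<Sum>j<D. u j * w (Suc j) y) + t\<^sup>2 * poly (H y) t"
        by blast
      then have H: "\<Psi> (\<lambda>j. t * u j) y =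
          w 0 y + t * (\<Sum>j<D. u j * w (Suc j) y) + t\<^sup>2 * poly (H y) t" if "y \<in> I" for y t
        using that by blast
      have up\<Psi>: "upoly (\<lambda>t. \<Psi> (\<lambda>j. t * u j) y)" if "y \<in> I" for y
        using poly[OF that] by (rule upoly_polyfn) (intro upoly_mult upoly_id upoly_const)
      have upy: "upoly (\<lambda>t. y t i)" if "i \<in> I" for i
        unfolding y_def cscale_def
        by (intro upoly_mult upoly_add upoly_const upoly_id up\<Psi> that)
      \<comment> \<open>The relation holds where \<open>y t\<close> is nonzero, hence identically in \<open>t\<close>.\<close>
      have "poly_eval Q (y t) = 0" for t
      proof (rule upoly_no_zero_divisors[of "\<lambda>t. y t x" "\<lambda>t. poly_eval Q (y t)" 0])
        show "upoly (\<lambda>t. y t x)" by (rule upy[OF x(2)])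
        show "upoly (\<lambda>t. poly_eval Q (y t))" by (rule upoly_poly_eval[OF QI upy])
        show "y 0 x \<noteq> 0" using x \<Psi>0 by (simp add: y_def cscale_def)
        show "y t x * poly_eval Q (y t) = 0" for t
        proof (cases "y t x = 0")
          case False
          then have "1 + t * z 0 \<noteq> 0" "\<Psi> (\<lambda>j. t * u j) \<noteq> 0"
            by (auto simp: y_def cscale_def)
          then have "y t \<in> proj_pt (\<Psi> (\<lambda>j. t * u j))"
            unfolding in_proj_pt y_def by (intro exI[of _ "1 + t * z 0"]) simp
          moreover have "proj_pt (\<Psi> (\<lambda>j. t * u j)) \<in> B (Suc i)"
            unfolding B_def using tu[of t] \<open>\<Psi> (\<lambda>j. t * u j) \<noteq> 0\<close>
            by (intro CollectI exI[of _ "\<lambda>j. t * u j"]) simp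
          ultimately have "poly_eval Q (y t) = 0" by (intro QB) blast
          then show ?thesis by simp
        qed simp
      qed
      then have rel: "(\<Sum>a\<in>exps ?k d. c a * mon (\<lambda>j. poly_eval (L j) (y t)) a) = 0" for t
        by (simp add: Q_def poly_eval_comb)
      define K where "K = (\<lambda>a. (\<Sum>i\<in>I. smult (l a i)
        (H i + [:z 0:] * ([:\<Sum>j<D. u j * w (Suc j) i:] + [:0, 1:] * H i))))"
      have expansion: "poly_eval (L a) (y t) = t * (z a + t * poly (K a) t)" if a: "a < ?k" for a t
      proof -
        have "(\<Sum>y\<in>I. l a y * (\<Sum>j<D. u j * w (Suc j) y)) =
            (\<Sum>j<D. u j * (\<Sum>y\<in>I. l a y * w (Suc j) y))"
          by (simp add: sum_distrib_left mult_ac) (rule sum.swap)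
        also have "\<dots> = (\<Sum>j<D. if Suc j = a then u j else 0)"
          using l[of a] a i by (intro sum.cong) auto
        also have "\<dots> = (if a = 0 then 0 else z a)"
          using a i by (cases a) (auto simp: u_def trunc_def)
        finally have S: "(\<Sum>y\<in>I. l a y * (\<Sum>j<D. u j * w (Suc j) y)) = (if a = 0 then 0 else z a)" .
        have W: "(\<Sum>y\<in>I. l a y * w 0 y) = (if a = 0 then 1 else 0)"
          using l[of a 0] a i by auto
        have "(\<Sum>i\<in>I. l a i * y t i) = (\<Sum>i\<in>I.
            (1 + t * z 0) * (l a i * w 0 i) + t * (l a i * (\<Sum>j<D. u j * w (Suc j) i)) +
            t * t * (l a i * (poly (H i) t + z 0 * ((\<Sum>j<D. u j * w (Suc j) i) + t * poly (H i) t))))"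
          by (intro sum.cong) (auto simp: y_def cscale_def H algebra_simps power2_eq_square)
        also have "\<dots> = (1 + t * z 0) * (if a = 0 then 1 else 0) + t * (if a = 0 then 0 else z a) +
            t * t * poly (K a) t"
          unfolding sum.distrib sum_distrib_left[symmetric] S W
          by (simp add: K_def poly_sum distrib_left mult_ac)
        finally show ?thesis
          unfolding L by (auto simp: algebra_simps)
      qed
      show ?thesis
        by (rule lowest_terms_vanish[where h = "\<lambda>j t. poly_eval (L j) (y t)" and H = K])
           (simp_all add: rel expansion low)
    qed
    then have "(if sum_list a0 = e then c a0 else 0) = 0"
      by (rule mon_independent) (rule a0)
    then show False using a0 by simp
  qed
  have "irreducible_closedin (subtopology (zariski I) (zariski I closure_of A)) (Z i)" for i
    using irr ZA by (simp add: irreducible_closedin_subtopology)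
  moreover have "Z i \<subset> Z (Suc i)" if "i < D" for i
    using Z_mono strict[OF that] by blast
  ultimately show ?thesis
    unfolding krull_dim_def by (intro Sup_upper CollectI exI[of _ D] exI[of _ Z] conjI) simp_all
qed

section \<open>Parametrisation of the secant varieties\<close>

lemma finite_sv_index [simp]: "finite (sv_index m n)"
  by (rule card_ge_0_finite) (simp add: card_sv_index)

text \<open>A general vector of the cone over the \<open>s\<close>-th secant variety.\<close>

definition sv_sum ::
    "nat \<Rightarrow> nat \<Rightarrow> nat \<Rightarrow> (nat \<Rightarrow> nat \<Rightarrow> complex) \<Rightarrow> (nat \<Rightarrow> nat \<Rightarrow> complex) \<Rightarrow>
      nat \<times> nat \<times> nat \<Rightarrow> complex" where
  "sv_sum m n s x y = (\<Sum>l<s. sv_vec m n (x l) (y l))"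

text \<open>The points that these vectors represent; the secant variety is their closure.\<close>

definition sv_secant_points :: "nat \<Rightarrow> nat \<Rightarrow> nat \<Rightarrow> (nat \<times> nat \<times> nat \<Rightarrow> complex) set set" where
  "sv_secant_points m n s = {proj_pt (sv_sum m n s x y) | x y. sv_sum m n s x y \<noteq> 0}"

lemma sv_sum_apply:
  "(i, j, k) \<in> sv_index m n \<Longrightarrow> sv_sum m n s x y (i, j, k) = (\<Sum>l<s. x l i * y l j * y l k)"
  by (simp add: sv_sum_def sum_apply sv_vec_def)

lemma sv_sum_coord_space: "sv_sum m n s x y \<in> coord_space (sv_index m n)"
  by (auto simp: coord_space_def sv_sum_def sum_apply sv_vec_def)

lemma sv_secant_points_subset: "sv_secant_points m n s \<subseteq> proj_space (sv_index m n)"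
  using sv_sum_coord_space by (auto simp: sv_secant_points_def proj_space_def)

lemma in_span_image:
  assumes "v \<in> cvec.span (f ` A)" "finite A"
  shows "\<exists>c. v = (\<Sum>a\<in>A. cscale (c a) (f a))"
  using assms(1)
proof (induction rule: cvec.span_induct_alt)
  case base
  then show ?case by (intro exI[of _ "\<lambda>_. 0"]) simp
next
  case (step c x y)
  then obtain b d where b: "b \<in> A" "x = f b" and d: "y = (\<Sum>a\<in>A. cscale (d a) (f a))" by auto
  have "cscale c x = (\<Sum>a\<in>A. if a = b then cscale c (f a) else 0)"
    using assms(2) b by simp
  then have "cscale c x + y = (\<Sum>a\<in>A. (if a = b then cscale c (f a) else 0) + cscale (d a) (f a))"
    unfolding d sum.distrib by (rule arg_cong2[where f = "(+)", OF _ refl])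
  also have "\<dots> = (\<Sum>a\<in>A. cscale ((if a = b then c else 0) + d a) (f a))"
    by (intro sum.cong refl) (simp add: cvec.scale_left_distrib)
  finally show ?case by (intro exI[of _ "\<lambda>a. (if a = b then c else 0) + d a"])
qed

lemma secant_points_in_spans:
  fixes m n s :: nat
  defines "I \<equiv> sv_index m n" and "X \<equiv> segre_veronese m n"
  shows "(\<Union>p\<in>{p :: nat \<Rightarrow> (nat \<times> nat \<times> nat \<Rightarrow> complex) set. \<forall>j<s. p j \<in> X}. proj_span I (p ` {..<s})) =
    sv_secant_points m n s" (is "?L = _")
proof (intro subset_antisym subsetI)
  fix q assume "q \<in> ?L"
  then obtain p where p: "\<forall>j<s. p j \<in> X" "q \<in> proj_span I (p ` {..<s})" by blast
  then obtain v where v: "q = proj_pt v" "v \<in> coord_space I" "v \<noteq> 0"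
    by (auto simp: proj_span_def proj_space_def)
  have "\<forall>l\<in>{..<s}. \<exists>x y. p l = proj_pt (sv_vec m n x y)"
    using p(1) unfolding X_def segre_veronese_def by blast
  then obtain x where "\<forall>l\<in>{..<s}. \<exists>y. p l = proj_pt (sv_vec m n (x l) y)"
    by (rule bchoice[THEN exE])
  then obtain y where "\<forall>l\<in>{..<s}. p l = proj_pt (sv_vec m n (x l) (y l))"
    by (rule bchoice[THEN exE])
  then have xy: "p l = proj_pt (sv_vec m n (x l) (y l))" if "l < s" for l
    using that by simp
  let ?f = "\<lambda>l. sv_vec m n (x l) (y l)"
  have "\<Union>(p ` {..<s}) \<subseteq> cvec.span (?f ` {..<s})"
    by (auto simp: xy in_proj_pt intro!: cvec.span_scale[OF cvec.span_base])
  then have "cvec.span (\<Union>(p ` {..<s})) \<subseteq> cvec.span (?f ` {..<s})"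
    by (intro cvec.span_minimal) auto
  moreover have "v \<in> cvec.span (\<Union>(p ` {..<s}))"
    using p(2) v(1) self_in_proj_pt[of v] by (auto simp: proj_span_def)
  ultimately obtain c where c: "v = (\<Sum>l<s. cscale (c l) (?f l))"
    using in_span_image[of v ?f "{..<s}"] by blast
  also have "\<dots> = sv_sum m n s (\<lambda>l. cscale (c l) (x l)) y"
    unfolding sv_sum_def by (intro sum.cong) (auto simp: cscale_def sv_vec_def)
  finally show "q \<in> sv_secant_points m n s"
    using v by (auto simp: sv_secant_points_def)
next
  fix q assume "q \<in> sv_secant_points m n s"
  then obtain x y where q: "q = proj_pt (sv_sum m n s x y)" "sv_sum m n s x y \<noteq> 0"
    by (auto simp: sv_secant_points_def)
  define t where "t = (\<lambda>k (z :: nat \<Rightarrow> complex) i. if i \<le> k then z i else 0)"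
  have t: "sv_vec m n (t m a) (t n b) = sv_vec m n a b" for a b
    by (auto simp: sv_vec_def t_def sv_index_def fun_eq_iff)
  have tX: "proj_pt (sv_vec m n a b) \<in> X" if "sv_vec m n a b \<noteq> 0" for a b
  proof -
    have "sv_vec m n (t m a) (t n b) \<noteq> 0" using that t by simp
    then have "t m a \<noteq> 0" "t n b \<noteq> 0"
      by (auto simp: sv_vec_def fun_eq_iff split: if_splits)
    moreover have "t m a \<in> coord_space {..m}" "t n b \<in> coord_space {..n}"
      by (auto simp: t_def coord_space_def)
    ultimately have "proj_pt (sv_vec m n (t m a) (t n b)) \<in> X"
      unfolding X_def segre_veronese_def by blast
    then show ?thesis by (simp add: t)
  qed
  \<comment> \<open>Summands that vanish are replaced by an arbitrary point of the variety.\<close>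
  have "sv_vec m n (unit_vec 0) (unit_vec 0) (0, 0, 0) \<noteq> 0"
    by (simp add: sv_vec_def sv_index_def unit_vec_def)
  then have nz: "sv_vec m n (unit_vec 0) (unit_vec 0) \<noteq> 0" by auto
  define p where "p = (\<lambda>l. if sv_vec m n (x l) (y l) = 0
    then proj_pt (sv_vec m n (unit_vec 0) (unit_vec 0)) else proj_pt (sv_vec m n (x l) (y l)))"
  have "\<forall>l<s. p l \<in> X" using tX nz by (auto simp: p_def)
  moreover have "q \<in> proj_span I (p ` {..<s})"
  proof -
    have "sv_vec m n (x l) (y l) \<in> cvec.span (\<Union>(p ` {..<s}))" if "l < s" for l
    proof (cases "sv_vec m n (x l) (y l) = 0")
      case False
      then have "sv_vec m n (x l) (y l) \<in> p l"
        using self_in_proj_pt by (simp add: p_def)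
      then show ?thesis using that by (intro cvec.span_base) auto
    qed (simp add: cvec.span_zero)
    then have "sv_sum m n s x y \<in> cvec.span (\<Union>(p ` {..<s}))"
      unfolding sv_sum_def by (intro cvec.span_sum) auto
    then have "q \<subseteq> cvec.span (\<Union>(p ` {..<s}))"
      by (auto simp: q(1) in_proj_pt intro: cvec.span_scale)
    moreover have "q \<in> proj_space I"
      using q sv_sum_coord_space unfolding proj_space_def I_def by blast
    ultimately show ?thesis by (simp add: proj_span_def)
  qed
  ultimately show "q \<in> ?L" by blast
qed

lemma krull_dim_le_card:
  assumes A: "A \<subseteq> proj_space I" and I: "finite I"
  shows "krull_dim (subtopology (zariski I) (zariski I closure_of A)) \<le> enat (card I - 1)"
proof -
  obtain h where h: "bij_betw h I {0..<card I}"
    using ex_bij_betw_finite_nat[OF I] by blast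
  show ?thesis
  proof (rule krull_dim_closure_le[OF A, where \<Phi> = "\<lambda>u i. if i \<in> I then u (h i) else 0"])
    show "polyfn (card I) (\<lambda>u. if i \<in> I then u (h i) else 0)" if "i \<in> I" for i
      using that bij_betwE[OF h] by (simp add: polyfn.var)
    fix f v
    assume f: "\<And>u. poly_eval f (\<lambda>i. if i \<in> I then u (h i) else 0) = 0" and "v \<in> \<Union>A"
    then obtain p where p: "p \<in> A" "v \<in> p" by blast
    then have "p \<in> proj_space I" using A by blast
    then obtain w where w: "w \<in> coord_space I" "p = proj_pt w" by (auto simp: proj_space_def)
    moreover obtain c where "v = cscale c w" using p(2) unfolding w(2) in_proj_pt by blast
    ultimately have "v \<in> coord_space I" by (auto simp: coord_space_def cscale_def)
    then have "v = (\<lambda>i. if i \<in> I then v (inv_into I h (h i)) else 0)"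
      using h by (auto simp: bij_betw_def inv_into_f_f coord_space_def)
    then show "poly_eval f v = 0" using f[of "\<lambda>j. v (inv_into I h j)"] by simp
  qed
qed

text \<open>On the dense set where the zeroth coordinates of all \<open>y\<^sub>l\<close> are nonzero, these coordinates may
  be normalised to \<open>1\<close>; so \<open>m + n + 1\<close> parameters per point suffice.\<close>

lemma krull_dim_secant_le:
  "krull_dim (subtopology (zariski (sv_index m n))
     (zariski (sv_index m n) closure_of sv_secant_points m n s)) \<le> enat (s * (m + n + 1) - 1)"
proof (rule krull_dim_closure_le[OF sv_secant_points_subset])
  let ?b = "m + n + 1"
  let ?x = "\<lambda>u l i. u (l * ?b + i) :: complex"
  let ?y = "\<lambda>u l j. if j = 0 then 1 else u (l * ?b + m + j) :: complex"
  have less: "l * ?b + r < s * ?b" if "l < s" "r < ?b" for l r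
  proof -
    have "l * ?b + r < Suc l * ?b" using that by simp
    also have "\<dots> \<le> s * ?b" using that by (intro mult_right_mono) auto
    finally show ?thesis .
  qed
  have px: "polyfn (s * ?b) (\<lambda>u. ?x u l i)" if "l < s" "i \<le> m" for l i
    by (intro polyfn.var less) (use that in auto)
  have py: "polyfn (s * ?b) (\<lambda>u. ?y u l j)" if "l < s" "j \<le> n" for l j
    using polyfn.var[OF less[of l "m + j"]] that
    by (cases "j = 0") (simp_all add: polyfn.const add.assoc)
  show "polyfn (s * ?b) (\<lambda>u. sv_sum m n s (?x u) (?y u) a)" if "a \<in> sv_index m n" for a
  proof -
    obtain i j k where a: "a = (i, j, k)" by (cases a)
    then have "i \<le> m" "j \<le> n" "k \<le> n" using that by (auto simp: sv_index_def)
    moreover have "sv_sum m n s (?x u) (?y u) a = (\<Sum>l<s. ?x u l i * ?y u l j * ?y u l k)" for u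
      using that unfolding a by (rule sv_sum_apply)
    ultimately show ?thesis
      by (simp only:) (intro polyfn_sum polyfn.mult px py; simp)
  qed
  fix f v
  assume f: "f \<in> polys (sv_index m n)" and f0: "\<And>u. poly_eval f (sv_sum m n s (?x u) (?y u)) = 0"
    and v: "v \<in> \<Union>(sv_secant_points m n s)"
  have chart: "poly_eval f (sv_sum m n s x y) = 0" if nz: "\<And>l. l < s \<Longrightarrow> y l 0 \<noteq> 0" for x y
  proof -
    define u where "u = (\<lambda>r. let l = r div ?b; i = r mod ?b in
      if i \<le> m then x l i * (y l 0)\<^sup>2 else y l (i - m) / y l 0)"
    have u: "u (l * ?b + r) = (if r \<le> m then x l r * (y l 0)\<^sup>2 else y l (r - m) / y l 0)"
      if r: "r < ?b" for l r
    proof -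
      have "(l * ?b + r) div ?b = l" "(l * ?b + r) mod ?b = r"
        using r by (metis add.commute div_less div_mult_self3 add_0_right not_less0, metis mod_less mod_mult_self3)
      then show ?thesis by (simp only: u_def Let_def)
    qed
    have ux: "u (l * ?b + i) = x l i * (y l 0)\<^sup>2" if "i \<le> m" for l i
      using u[of i l] that by simp
    have uy: "u (l * ?b + m + j) = y l j / y l 0" if "j \<noteq> 0" "j \<le> n" for l j
      using u[of "m + j" l] that by (simp add: add.assoc)
    have "sv_sum m n s (?x u) (?y u) = sv_sum m n s x y"
      unfolding sv_sum_def
    proof (intro sum.cong refl)
      fix l assume l: "l \<in> {..<s}"
      have y: "?y u l j = y l j / y l 0" if "j \<le> n" for j
        using nz l uy that by auto
      show "sv_vec m n (?x u l) (?y u l) = sv_vec m n (x l) (y l)"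
      proof
        fix a :: "nat \<times> nat \<times> nat"
        obtain i j k where a: "a = (i, j, k)" by (cases a)
        show "sv_vec m n (?x u l) (?y u l) a = sv_vec m n (x l) (y l) a"
        proof (cases "a \<in> sv_index m n")
          case True
          then have "i \<le> m" "j \<le> n" "k \<le> n" by (auto simp: a sv_index_def)
          then have "?x u l i * ?y u l j * ?y u l k = x l i * y l j * y l k"
            using nz l by (simp only: ux y) (simp add: field_simps power2_eq_square)
          then show ?thesis using True by (simp only: a sv_vec_def case_prod_conv if_True)
        qed (simp add: a sv_vec_def)
      qed
    qed
    then show ?thesis using f0[of u] by simp
  qed
  have all: "poly_eval f (sv_sum m n s x y) = 0" for x y
  proof -
    let ?l = "\<lambda>t l j. y l j + t * (1 - y l j)"
    let ?g = "\<lambda>t. \<Prod>l<s. ?l t l 0"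
    have uf: "upoly (\<lambda>t. poly_eval f (sv_sum m n s x (?l t)))"
    proof (rule upoly_poly_eval[OF f])
      fix a assume a: "a \<in> sv_index m n"
      obtain i j k where ijk: "a = (i, j, k)" by (cases a)
      show "upoly (\<lambda>t. sv_sum m n s x (?l t) a)"
        using a unfolding ijk
        by (simp only: sv_sum_apply) (intro upoly_sum upoly_mult upoly_add upoly_const upoly_id)
    qed
    have ug: "upoly ?g"
      by (intro upoly_prod upoly_mult upoly_add upoly_const upoly_id)
    have "?g t * poly_eval f (sv_sum m n s x (?l t)) = 0" for t
      using chart[of "?l t" x] by (cases "?g t = 0") auto
    from upoly_no_zero_divisors[OF ug uf this, of 1 0] show ?thesis by simp
  qed
  obtain c x y where "v = cscale c (sv_sum m n s x y)"
    using v by (auto simp: sv_secant_points_def in_proj_pt)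
  moreover have "cscale c (sv_sum m n s x y) = sv_sum m n s (\<lambda>l. cscale c (x l)) y"
    unfolding sv_sum_def cvec.scale_sum_right
    by (intro sum.cong) (auto simp: cscale_def sv_vec_def)
  ultimately show "poly_eval f v = 0" using all by simp
qed


section \<open>Tangent spaces and a criterion for the expected dimension\<close>

text \<open>A functional \<open>F\<close> on the ambient space, polarised in the quadratic variable: a form that is
  linear in \<open>x\<close> and symmetric bilinear in \<open>y\<close>, \<open>z\<close>, with \<open>sv_form m n F x y y\<close> twice the value of
  \<open>F\<close> at \<open>sv_vec m n x y\<close>.\<close>

definition sv_form :: "nat \<Rightarrow> nat \<Rightarrow> (nat \<times> nat \<times> nat \<Rightarrow> complex) \<Rightarrow>
    (nat \<Rightarrow> complex) \<Rightarrow> (nat \<Rightarrow> complex) \<Rightarrow> (nat \<Rightarrow> complex) \<Rightarrow> complex" where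
  "sv_form m n F x y z =
    (\<Sum>a\<in>sv_index m n. case a of (i, j, k) \<Rightarrow> F a * (x i * (y j * z k + z j * y k)))"

lemma sv_form_commute: "sv_form m n F x y z = sv_form m n F x z y"
  unfolding sv_form_def by (intro sum.cong) (auto simp: algebra_simps)

lemma sv_form_scale1: "sv_form m n F (\<lambda>i. c * x i) y z = c * sv_form m n F x y z"
  unfolding sv_form_def sum_distrib_left by (intro sum.cong) (auto simp: algebra_simps)

lemma sv_form_add2: "sv_form m n F x (\<lambda>i. y i + y' i) z = sv_form m n F x y z + sv_form m n F x y' z"
  unfolding sv_form_def sum.distrib[symmetric] by (intro sum.cong) (auto simp: algebra_simps)

lemma sv_form_add3: "sv_form m n F x z (\<lambda>i. y i + y' i) = sv_form m n F x z y + sv_form m n F x z y'"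
  using sv_form_add2 by (simp add: sv_form_commute[of m n F x z])

lemma sum_unit_vec: "i \<le> (k::nat) \<Longrightarrow> (\<Sum>a\<le>k. f a * unit_vec a i) = f i"
proof -
  assume "i \<le> k"
  have "(\<Sum>a\<le>k. f a * unit_vec a i) = (\<Sum>a\<le>k. if a = i then f a else 0)"
    by (intro sum.cong) (auto simp: unit_vec_def)
  then show ?thesis using \<open>i \<le> k\<close> by simp
qed

lemma sv_form_expand1: "sv_form m n F x y z = (\<Sum>i\<le>m. x i * sv_form m n F (unit_vec i) y z)"
proof -
  have "(\<Sum>i\<le>m. x i * sv_form m n F (unit_vec i) y z) =
      (\<Sum>a\<in>sv_index m n. \<Sum>b\<le>m. x b * (case a of (i, j, k) \<Rightarrow>
        F a * (unit_vec b i * (y j * z k + z j * y k))))"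
    unfolding sv_form_def sum_distrib_left by (rule sum.swap)
  also have "\<dots> = sv_form m n F x y z"
    unfolding sv_form_def
  proof (intro sum.cong refl)
    fix a assume "a \<in> sv_index m n"
    then obtain i j k where a: "a = (i, j, k)" "i \<le> m" by (auto simp: sv_index_def)
    have "(\<Sum>b\<le>m. x b * (F a * (unit_vec b i * (y j * z k + z j * y k)))) =
        F a * (\<Sum>b\<le>m. x b * unit_vec b i) * (y j * z k + z j * y k)"
      by (simp add: sum_distrib_left sum_distrib_right mult_ac)
    then show "(\<Sum>b\<le>m. x b * (case a of (i, j, k) \<Rightarrow> F a * (unit_vec b i * (y j * z k + z j * y k)))) =
        (case a of (i, j, k) \<Rightarrow> F a * (x i * (y j * z k + z j * y k)))"
      using a by (simp add: sum_unit_vec)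
  qed
  finally show ?thesis by simp
qed

lemma sv_form_expand3: "sv_form m n F x y z = (\<Sum>j\<le>n. z j * sv_form m n F x y (unit_vec j))"
proof -
  have "(\<Sum>j\<le>n. z j * sv_form m n F x y (unit_vec j)) =
      (\<Sum>a\<in>sv_index m n. \<Sum>b\<le>n. z b * (case a of (i, j, k) \<Rightarrow>
        F a * (x i * (y j * unit_vec b k + unit_vec b j * y k))))"
    unfolding sv_form_def sum_distrib_left by (rule sum.swap)
  also have "\<dots> = sv_form m n F x y z"
    unfolding sv_form_def
  proof (intro sum.cong refl)
    fix a assume "a \<in> sv_index m n"
    then obtain i j k where a: "a = (i, j, k)" "j \<le> n" "k \<le> n" by (auto simp: sv_index_def)
    have "(\<Sum>b\<le>n. z b * (F a * (x i * (y j * unit_vec b k + unit_vec b j * y k)))) =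
        F a * (x i * (y j * (\<Sum>b\<le>n. z b * unit_vec b k) + (\<Sum>b\<le>n. z b * unit_vec b j) * y k))"
      by (simp add: sum_distrib_left sum_distrib_right sum.distrib algebra_simps)
    then show "(\<Sum>b\<le>n. z b * (case a of (i, j, k) \<Rightarrow>
        F a * (x i * (y j * unit_vec b k + unit_vec b j * y k)))) =
        (case a of (i, j, k) \<Rightarrow> F a * (x i * (y j * z k + z j * y k)))"
      using a by (simp add: sum_unit_vec)
  qed
  finally show ?thesis by simp
qed

lemma sv_form_unit:
  assumes "i \<le> m" "j \<le> k" "k \<le> n"
  shows "sv_form m n F (unit_vec i) (unit_vec j) (unit_vec k) = (if j = k then 2 else 1) * F (i, j, k)"
proof -
  have "sv_form m n F (unit_vec i) (unit_vec j) (unit_vec k) =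
      (\<Sum>a\<in>sv_index m n. if a = (i, j, k) then (if j = k then 2 else 1) * F (i, j, k) else 0)"
    unfolding sv_form_def using assms
    by (intro sum.cong) (auto simp: unit_vec_def sv_index_def split: if_splits)
  moreover have "(i, j, k) \<in> sv_index m n" using assms by (simp add: sv_index_def)
  ultimately show ?thesis by simp
qed

text \<open>Tangent vector at \<open>sv_vec m n x y\<close> in the direction \<open>(x', y')\<close>.\<close>

definition sv_tangent :: "nat \<Rightarrow> nat \<Rightarrow> (nat \<Rightarrow> complex) \<Rightarrow> (nat \<Rightarrow> complex) \<Rightarrow>
    (nat \<Rightarrow> complex) \<Rightarrow> (nat \<Rightarrow> complex) \<Rightarrow> nat \<times> nat \<times> nat \<Rightarrow> complex" where
  "sv_tangent m n x y x' y' = (\<lambda>(i, j, k). if (i, j, k) \<in> sv_index m n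
     then x' i * y j * y k + x i * (y j * y' k + y' j * y k) else 0)"

lemma sv_tangent_coord_space: "sv_tangent m n x y x' y' \<in> coord_space (sv_index m n)"
  by (auto simp: coord_space_def sv_tangent_def)

lemma pairing_sv_tangent:
  "2 * (\<Sum>a\<in>sv_index m n. F a * sv_tangent m n x y x' y' a) =
    sv_form m n F x' y y + 2 * sv_form m n F x y y'"
  unfolding sv_form_def sum_distrib_left sum.distrib[symmetric]
  by (intro sum.cong) (auto simp: sv_tangent_def algebra_simps)

text \<open>The functional \<open>F\<close> annihilates the tangent space at \<open>sv_vec m n x y\<close>.\<close>

definition sv_annihilates :: "nat \<Rightarrow> nat \<Rightarrow> (nat \<times> nat \<times> nat \<Rightarrow> complex) \<Rightarrow>
    (nat \<Rightarrow> complex) \<Rightarrow> (nat \<Rightarrow> complex) \<Rightarrow> bool" where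
  "sv_annihilates m n F x y \<longleftrightarrow>
    (\<forall>x'. sv_form m n F x' y y = 0) \<and> (\<forall>y'. sv_form m n F x y y' = 0)"

text \<open>There are \<open>s\<close> points whose tangent spaces span, together with at most \<open>q\<close> further vectors, the
  whole ambient space.\<close>

definition sv_tangents_span :: "nat \<Rightarrow> nat \<Rightarrow> nat \<Rightarrow> nat \<Rightarrow> bool" where
  "sv_tangents_span m n s q \<longleftrightarrow> (\<exists>x y E.
    (\<forall>l<s. x l 0 \<noteq> 0 \<and> (\<exists>j\<le>n. y l j \<noteq> 0)) \<and>
    finite E \<and> card E \<le> q \<and> E \<subseteq> coord_space (sv_index m n) \<and>
    (\<forall>F. (\<forall>l<s. sv_annihilates m n F (x l) (y l)) \<longrightarrow>
       (\<forall>e\<in>E. (\<Sum>a\<in>sv_index m n. F a * e a) = 0) \<longrightarrow> (\<forall>a\<in>sv_index m n. F a = 0)))"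

lemma sv_tangents_spanI:
  assumes "\<And>l. l < s \<Longrightarrow> x l 0 \<noteq> 0" "\<And>l. l < s \<Longrightarrow> \<exists>j\<le>n. y l j \<noteq> 0"
    "finite E" "card E \<le> q" "E \<subseteq> coord_space (sv_index m n)"
    "\<And>F a. (\<And>l. l < s \<Longrightarrow> sv_annihilates m n F (x l) (y l)) \<Longrightarrow>
       (\<And>e. e \<in> E \<Longrightarrow> (\<Sum>a\<in>sv_index m n. F a * e a) = 0) \<Longrightarrow> a \<in> sv_index m n \<Longrightarrow> F a = 0"
  shows "sv_tangents_span m n s q"
  unfolding sv_tangents_span_def
  by (intro exI[of _ x] exI[of _ y] exI[of _ E] conjI allI impI ballI) (simp_all add: assms)

lemma sv_tangents_spanE:
  assumes "sv_tangents_span m n s q"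
  obtains x y E where "\<And>l. l < s \<Longrightarrow> x l 0 \<noteq> 0" "\<And>l. l < s \<Longrightarrow> \<exists>j\<le>n. y l j \<noteq> 0"
    "finite E" "card E \<le> q" "E \<subseteq> coord_space (sv_index m n)"
    "\<And>F a. (\<And>l. l < s \<Longrightarrow> sv_annihilates m n F (x l) (y l)) \<Longrightarrow>
       (\<And>e. e \<in> E \<Longrightarrow> (\<Sum>a\<in>sv_index m n. F a * e a) = 0) \<Longrightarrow> a \<in> sv_index m n \<Longrightarrow> F a = 0"
proof -
  obtain x y E where xy: "\<forall>l<s. x l 0 \<noteq> 0 \<and> (\<exists>j\<le>n. y l j \<noteq> 0)"
    and E: "finite E" "card E \<le> q" "E \<subseteq> coord_space (sv_index m n)"
    and ann: "\<forall>F. (\<forall>l<s. sv_annihilates m n F (x l) (y l)) \<longrightarrow>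
       (\<forall>e\<in>E. (\<Sum>a\<in>sv_index m n. F a * e a) = 0) \<longrightarrow> (\<forall>a\<in>sv_index m n. F a = 0)"
    using assms unfolding sv_tangents_span_def by (elim exE conjE)
  show ?thesis
  proof (rule that[of x y E])
    show "x l 0 \<noteq> 0" "\<exists>j\<le>n. y l j \<noteq> 0" if "l < s" for l using xy that by auto
    show "F a = 0" if "\<And>l. l < s \<Longrightarrow> sv_annihilates m n F (x l) (y l)"
      "\<And>e. e \<in> E \<Longrightarrow> (\<Sum>a\<in>sv_index m n. F a * e a) = 0" "a \<in> sv_index m n" for F a
      using ann[rule_format, of F a] that by blast
  qed (fact E)+
qed

lemma sv_tangents_span_more_points:
  assumes "sv_tangents_span m n s q" "s \<le> s'"
  shows "sv_tangents_span m n s' q"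
  using assms(1)
proof (rule sv_tangents_spanE)
  fix x y E
  assume xyE: "\<And>l. l < s \<Longrightarrow> x l 0 \<noteq> 0" "\<And>l. l < s \<Longrightarrow> \<exists>j\<le>n. y l j \<noteq> 0"
    "finite E" "card E \<le> q" "E \<subseteq> coord_space (sv_index m n)"
    and ann: "\<And>F a. (\<And>l. l < s \<Longrightarrow> sv_annihilates m n F (x l) (y l)) \<Longrightarrow>
       (\<And>e. e \<in> E \<Longrightarrow> (\<Sum>a\<in>sv_index m n. F a * e a) = 0) \<Longrightarrow> a \<in> sv_index m n \<Longrightarrow> F a = 0"
  let ?x = "\<lambda>l. if l < s then x l else (\<lambda>_. 1)" and ?y = "\<lambda>l. if l < s then y l else (\<lambda>_. 1)"
  show ?thesis
  proof (rule sv_tangents_spanI[of s' ?x n ?y E])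
    show "?x l 0 \<noteq> 0" "\<exists>j\<le>n. ?y l j \<noteq> 0" for l
      using xyE(1,2)[of l] by auto
    fix F a
    assume F: "\<And>l. l < s' \<Longrightarrow> sv_annihilates m n F (?x l) (?y l)"
      and FE: "\<And>e. e \<in> E \<Longrightarrow> (\<Sum>a\<in>sv_index m n. F a * e a) = 0" and a: "a \<in> sv_index m n"
    have "sv_annihilates m n F (x l) (y l)" if "l < s" for l
      using F[of l] that assms(2) by simp
    from ann[OF this FE a] show "F a = 0" .
  qed (fact xyE)+
qed

text \<open>A point may be traded for \<open>m + n + 1\<close> vectors that span its tangent space; one of the obvious
  \<open>m + n + 2\<close> generators is redundant because of the two ways of scaling \<open>x \<otimes> y\<^sup>2\<close>.\<close>

lemma sv_tangents_span_fewer_points_step: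
  assumes "sv_tangents_span m n (Suc s) q"
  shows "sv_tangents_span m n s (q + (m + n + 1))"
  using assms
proof (rule sv_tangents_spanE)
  fix x y E
  assume xyE: "\<And>l. l < Suc s \<Longrightarrow> x l 0 \<noteq> 0" "\<And>l. l < Suc s \<Longrightarrow> \<exists>j\<le>n. y l j \<noteq> 0"
    "finite E" "card E \<le> q" "E \<subseteq> coord_space (sv_index m n)"
    and ann: "\<And>F a. (\<And>l. l < Suc s \<Longrightarrow> sv_annihilates m n F (x l) (y l)) \<Longrightarrow>
       (\<And>e. e \<in> E \<Longrightarrow> (\<Sum>a\<in>sv_index m n. F a * e a) = 0) \<Longrightarrow> a \<in> sv_index m n \<Longrightarrow> F a = 0"
  obtain j0 where j0: "j0 \<le> n" "y s j0 \<noteq> 0" using xyE(2)[of s] by auto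
  let ?g1 = "\<lambda>i. sv_tangent m n (x s) (y s) (unit_vec i) (\<lambda>_. 0)"
  let ?g2 = "\<lambda>j. sv_tangent m n (x s) (y s) (\<lambda>_. 0) (unit_vec j)"
  let ?E = "E \<union> (?g1 ` {..m} \<union> ?g2 ` ({..n} - {j0}))"
  have "card (?g1 ` {..m} \<union> ?g2 ` ({..n} - {j0})) \<le> (m + 1) + n"
    using card_Un_le[of "?g1 ` {..m}" "?g2 ` ({..n} - {j0})"] card_image_le[of "{..m}" ?g1]
      card_image_le[of "{..n} - {j0}" ?g2] j0 by simp
  then have "card ?E \<le> q + (m + n + 1)"
    using card_Un_le[of E "?g1 ` {..m} \<union> ?g2 ` ({..n} - {j0})"] xyE(4) by linarith
  moreover have "?E \<subseteq> coord_space (sv_index m n)"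
    using xyE(5) sv_tangent_coord_space by auto
  moreover have "F a = 0"
    if F: "\<And>l. l < s \<Longrightarrow> sv_annihilates m n F (x l) (y l)"
      and FE: "\<And>e. e \<in> ?E \<Longrightarrow> (\<Sum>a\<in>sv_index m n. F a * e a) = 0" and a: "a \<in> sv_index m n" for F a
  proof -
    have zero1: "sv_form m n F (\<lambda>_. 0) a b = 0" for a b by (simp add: sv_form_def)
    have zero2: "sv_form m n F a b (\<lambda>_. 0) = 0" for a b by (simp add: sv_form_def)
    have "sv_form m n F (unit_vec i) (y s) (y s) = 0" if "i \<le> m" for i
      using FE[of "?g1 i"] that pairing_sv_tangent[of F m n "x s" "y s" "unit_vec i" "\<lambda>_. 0"]
      by (auto simp: zero2)
    then have 1: "sv_form m n F x' (y s) (y s) = 0" for x'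
      by (subst sv_form_expand1) simp
    have 2: "sv_form m n F (x s) (y s) (unit_vec j) = 0" if "j \<le> n" "j \<noteq> j0" for j
      using FE[of "?g2 j"] that pairing_sv_tangent[of F m n "x s" "y s" "\<lambda>_. 0" "unit_vec j"]
      by (auto simp: zero1)
    have "0 = (\<Sum>j\<le>n. y s j * sv_form m n F (x s) (y s) (unit_vec j))"
      using 1[of "x s"] by (subst (asm) sv_form_expand3) simp
    also have "\<dots> = (\<Sum>j\<le>n. if j = j0 then y s j0 * sv_form m n F (x s) (y s) (unit_vec j0) else 0)"
      using 2 by (intro sum.cong) auto
    also have "\<dots> = y s j0 * sv_form m n F (x s) (y s) (unit_vec j0)"
      using j0 by simp
    finally have "sv_form m n F (x s) (y s) (unit_vec j) = 0" if "j \<le> n" for j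
      using 2 j0 that by auto
    then have "sv_form m n F (x s) (y s) y' = 0" for y'
      by (subst sv_form_expand3) simp
    then have "sv_annihilates m n F (x l) (y l)" if "l < Suc s" for l
      using F[of l] 1 that by (auto simp: less_Suc_eq sv_annihilates_def)
    from ann[OF this _ a] FE show ?thesis by blast
  qed
  ultimately show ?thesis
    using xyE(1-3) by (intro sv_tangents_spanI[of s x n y ?E]) auto
qed

lemma sv_tangents_span_fewer_points:
  assumes "sv_tangents_span m n (s + d) q"
  shows "sv_tangents_span m n s (q + d * (m + n + 1))"
  using assms
proof (induction d arbitrary: q)
  case (Suc d)
  then have "sv_tangents_span m n (s + d) (q + (m + n + 1))"
    using sv_tangents_span_fewer_points_step by simp
  from Suc.IH[OF this] show ?case by (simp add: algebra_simps)
qed simp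

lemma inj_unit_vec: "inj_on unit_vec I"
proof (rule inj_onI)
  fix i j :: 'a assume "unit_vec i = unit_vec j"
  then have "unit_vec i i = unit_vec j i" by simp
  then show "i = j" by (simp add: unit_vec_def split: if_splits)
qed

lemma independent_unit_vec:
  assumes "finite I"
  shows "cvec.independent (unit_vec ` I)"
proof (rule cvec.independent_if_scalars_zero)
  fix f v assume 0: "(\<Sum>v\<in>unit_vec ` I. cscale (f v) v) = 0" and "v \<in> unit_vec ` I"
  then obtain i where i: "i \<in> I" "v = unit_vec i" by blast
  have "0 = (\<Sum>b\<in>I. cscale (f (unit_vec b)) (unit_vec b)) i"
    using 0 by (simp add: sum.reindex[OF inj_unit_vec])
  also have "\<dots> = (\<Sum>b\<in>I. if b = i then f (unit_vec b) else 0)"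
    unfolding sum_apply by (intro sum.cong) (auto simp: cscale_def unit_vec_def)
  finally show "f v = 0" using i assms by simp
qed (use assms in simp)

lemma coord_space_subset_span:
  assumes "finite I"
  shows "coord_space I \<subseteq> cvec.span (unit_vec ` I)"
proof
  fix v :: "'a \<Rightarrow> complex" assume "v \<in> coord_space I"
  from coord_space_expand[OF assms this] show "v \<in> cvec.span (unit_vec ` I)"
    by (metis (no_types, lifting) cvec.span_sum cvec.span_scale cvec.span_base imageI)
qed

text \<open>The easy half of Terracini's lemma: the dimension of the secant variety is at least the
  dimension of the span of the tangent spaces at \<open>s\<close> points.  The point at which the
  parametrisation is differentiated has to be nonzero; doubling one of the summands achieves this
  without changing the tangent spaces.\<close>

lemma krull_dim_secant_ge:
  assumes span: "sv_tangents_span m n s q" and s: "s \<ge> 1"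
  shows "enat (card (sv_index m n) - q - 1) \<le> krull_dim (subtopology (zariski (sv_index m n))
     (zariski (sv_index m n) closure_of sv_secant_points m n s))"
  using span
proof (rule sv_tangents_spanE)
  let ?I = "sv_index m n"
  fix x0 y E
  assume xyE: "\<And>l. l < s \<Longrightarrow> x0 l 0 \<noteq> 0" "\<And>l. l < s \<Longrightarrow> \<exists>j\<le>n. y l j \<noteq> 0"
    "finite E" "card E \<le> q" "E \<subseteq> coord_space ?I"
    and ann: "\<And>F a. (\<And>l. l < s \<Longrightarrow> sv_annihilates m n F (x0 l) (y l)) \<Longrightarrow>
       (\<And>e. e \<in> E \<Longrightarrow> (\<Sum>a\<in>?I. F a * e a) = 0) \<Longrightarrow> a \<in> ?I \<Longrightarrow> F a = 0"
  obtain x where nz: "sv_sum m n s x y \<noteq> 0"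
    and ann_x: "\<And>F l. l < s \<Longrightarrow> sv_annihilates m n F (x l) (y l) \<Longrightarrow> sv_annihilates m n F (x0 l) (y l)"
  proof (cases "sv_sum m n s x0 y = 0")
    case False
    then show ?thesis using that by blast
  next
    case True
    define x where "x = (\<lambda>l i. (if l = 0 then 2 else 1) * x0 l i)"
    obtain j where j: "j \<le> n" "y 0 j \<noteq> 0" using xyE(2)[of 0] s by auto
    have mem: "(0, j, j) \<in> ?I" using j by (simp add: sv_index_def)
    have "sv_sum m n s x y (0, j, j) =
        (\<Sum>l<s. x0 l 0 * y l j * y l j + (if l = 0 then x0 0 0 * y 0 j * y 0 j else 0))"
      unfolding sv_sum_apply[OF mem] by (intro sum.cong) (auto simp: x_def)
    also have "\<dots> = sv_sum m n s x0 y (0, j, j) + x0 0 0 * y 0 j * y 0 j"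
      unfolding sum.distrib sv_sum_apply[OF mem] using s by simp
    finally have "sv_sum m n s x y (0, j, j) \<noteq> 0" using True xyE(1)[of 0] s j by simp
    then have "sv_sum m n s x y \<noteq> 0" by auto
    moreover have "sv_annihilates m n F (x0 l) (y l)" if "sv_annihilates m n F (x l) (y l)" for F l
    proof -
      have "sv_form m n F (x l) (y l) z = (if l = 0 then 2 else 1) * sv_form m n F (x0 l) (y l) z" for z
        unfolding x_def by (rule sv_form_scale1)
      then show ?thesis using that by (auto simp: sv_annihilates_def split: if_splits)
    qed
    ultimately show ?thesis using that by blast
  qed
  define \<phi> where "\<phi> = sv_sum m n s x y"
  define dir where "dir = (\<lambda>X Y. \<Sum>l<s. sv_tangent m n (x l) (y l) (X l) (Y l))"
  define T where "T = {dir X Y | X Y. True}"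
  have dirT: "dir X Y \<in> T" for X Y unfolding T_def by blast
  have dir_coord: "dir X Y \<in> coord_space ?I" for X Y
    by (auto simp: dir_def coord_space_def sum_apply sv_tangent_def)
  then have T_coord: "T \<subseteq> coord_space ?I" by (auto simp: T_def)
  have "\<phi> = dir x (\<lambda>_ _. 0)"
    unfolding \<phi>_def dir_def sv_sum_def
    by (intro sum.cong) (auto simp: sv_vec_def sv_tangent_def fun_eq_iff)
  then have \<phi>T: "\<phi> \<in> T" using dirT by simp
  have \<phi>_indep: "cvec.independent {\<phi>}" using nz by (simp add: \<phi>_def)
  obtain B where B: "{\<phi>} \<subseteq> B" "B \<subseteq> T" "cvec.independent B" "T \<subseteq> cvec.span B"
    using cvec.maximal_independent_subset_extend[OF _ \<phi>_indep, of T] \<phi>T by blast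
  have all: "coord_space ?I \<subseteq> cvec.span (T \<union> E)"
  proof
    fix v assume v: "v \<in> coord_space ?I"
    show "v \<in> cvec.span (T \<union> E)"
    proof (rule span_if_no_annihilator[OF _ _ _ v])
      show "finite ?I" by simp
      show "T \<union> E \<subseteq> coord_space ?I" using T_coord xyE(5) by blast
      fix F a
      assume F: "\<And>w. w \<in> T \<union> E \<Longrightarrow> (\<Sum>a\<in>?I. F a * w a) = 0" and a: "a \<in> ?I"
      have "sv_annihilates m n F (x l) (y l)" if l: "l < s" for l
      proof -
        have *: "sv_form m n F x' (y l) (y l) + 2 * sv_form m n F (x l) (y l) y' = 0" for x' y'
        proof -
          let ?X = "\<lambda>k. if k = l then x' else (\<lambda>_. 0)" and ?Y = "\<lambda>k. if k = l then y' else (\<lambda>_. 0)"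
          have "dir ?X ?Y = (\<Sum>k<s. if k = l then sv_tangent m n (x l) (y l) x' y' else 0)"
            unfolding dir_def by (intro sum.cong) (auto simp: sv_tangent_def fun_eq_iff)
          also have "\<dots> = sv_tangent m n (x l) (y l) x' y'" using l by simp
          finally have "sv_tangent m n (x l) (y l) x' y' \<in> T \<union> E"
            using dirT[of ?X ?Y] by simp
          from F[OF this] show ?thesis using pairing_sv_tangent[of F m n "x l" "y l" x' y'] by simp
        qed
        have "sv_form m n F (\<lambda>_. 0) a b = 0" "sv_form m n F a b (\<lambda>_. 0) = 0" for a b
          by (simp_all add: sv_form_def)
        then show ?thesis
          using *[of _ "\<lambda>_. 0"] *[of "\<lambda>_. 0"] by (simp add: sv_annihilates_def)
      qed
      then have "sv_annihilates m n F (x0 l) (y l)" if "l < s" for l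
        using ann_x that by blast
      from ann[OF this _ a] F show "F a = 0" by blast
    qed
  qed
  have "T \<union> E \<subseteq> cvec.span (B \<union> E)"
    using B(4) cvec.span_mono[of B "B \<union> E"] cvec.span_superset[of "B \<union> E"] by blast
  then have "cvec.span (T \<union> E) \<subseteq> cvec.span (B \<union> E)"
    by (intro cvec.span_minimal) auto
  moreover have units: "unit_vec ` ?I \<subseteq> coord_space ?I"
    by (auto simp: unit_vec_def coord_space_def)
  ultimately have "unit_vec ` ?I \<subseteq> cvec.span (B \<union> E)" using all by blast
  moreover have finB: "finite B"
    using cvec.independent_span_bound[of "unit_vec ` ?I" B] B(2,3) T_coord
      coord_space_subset_span[of ?I] by auto
  ultimately have "card (unit_vec ` ?I) \<le> card (B \<union> E)"
    using cvec.independent_span_bound[of "B \<union> E" "unit_vec ` ?I"] independent_unit_vec[of ?I] xyE(3)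
    by simp
  then have cardB: "card ?I \<le> card B + q"
    using card_Un_le[of B E] xyE(4) by (simp add: card_image[OF inj_unit_vec])
  define D where "D = card ?I - q - 1"
  have "D \<le> card (B - {\<phi>})" using cardB B(1) finB by (simp add: D_def card_Diff_singleton)
  then obtain W where W: "W \<subseteq> B - {\<phi>}" "card W = D" "finite W"
    by (rule obtain_subset_with_card_n)
  then obtain h where h: "bij_betw h {0..<D} W"
    using ex_bij_betw_nat_finite[of W] by blast
  have hW: "h j \<in> B" "h j \<noteq> \<phi>" if "j < D" for j
    using bij_betwE[OF h] W(1) that by auto
  define w where "w = case_nat \<phi> h"
  have wB: "w b \<in> B" if "b \<le> D" for b
    using hW B(1) that by (cases b) (auto simp: w_def)
  have w_inj: "inj_on w {..D}"
  proof (rule inj_onI)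
    fix a b assume ab: "a \<in> {..D}" "b \<in> {..D}" "w a = w b"
    have "inj_on h {0..<D}" using h by (simp add: bij_betw_def)
    moreover have "w 0 \<noteq> w (Suc j)" if "Suc j \<le> D" for j
      using hW(2)[of j] that by (auto simp: w_def)
    ultimately show "a = b"
      using ab by (cases a; cases b) (auto simp: w_def dest: inj_onD)
  qed
  have w_ind: "cvec.independent (w ` {..D})"
    by (rule cvec.independent_mono[OF B(3)]) (use wB in auto)
  have "\<forall>j\<in>{..<D}. \<exists>X Y. h j = dir X Y"
    using hW B(2) by (fastforce simp: T_def)
  then obtain X where "\<forall>j\<in>{..<D}. \<exists>Y. h j = dir (X j) Y"
    by (rule bchoice[THEN exE])
  then obtain Y where XY: "\<forall>j\<in>{..<D}. h j = dir (X j) (Y j)"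
    by (rule bchoice[THEN exE])
  let ?x = "\<lambda>u l i. x l i + (\<Sum>j<D. u j * X j l i)"
  let ?y = "\<lambda>u l i. y l i + (\<Sum>j<D. u j * Y j l i)"
  have "enat D \<le> krull_dim (subtopology (zariski ?I) (zariski ?I closure_of sv_secant_points m n s))"
  proof (rule krull_dim_closure_ge[where \<Psi> = "\<lambda>u. sv_sum m n s (?x u) (?y u)" and w = w])
    show "finite ?I" by simp
    show "sv_secant_points m n s \<subseteq> proj_space ?I" by (rule sv_secant_points_subset)
    show "sv_sum m n s (?x u) (?y u) \<in> coord_space ?I" for u by (rule sv_sum_coord_space)
    show "proj_pt (sv_sum m n s (?x u) (?y u)) \<in> sv_secant_points m n s"
      if "sv_sum m n s (?x u) (?y u) \<noteq> 0" for u
      unfolding sv_secant_points_def using that by blast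
    show "cvec.independent (w ` {..D})" "inj_on w {..D}" by (fact w_ind w_inj)+
    show "w b \<in> coord_space ?I" if "b \<le> D" for b using wB[OF that] B(2) T_coord by blast
    fix a assume a: "a \<in> ?I"
    obtain i j k where ijk: "a = (i, j, k)" by (cases a)
    show "polyfn D (\<lambda>u. sv_sum m n s (?x u) (?y u) a)"
      using a unfolding ijk
      by (simp only: sv_sum_apply)
         (intro polyfn_sum polyfn.mult polyfn.add polyfn.const polyfn.var; simp)
    fix u :: "nat \<Rightarrow> complex"
    let ?\<alpha> = "\<lambda>l. \<Sum>r<D. u r * X r l i" and ?\<beta> = "\<lambda>l. \<Sum>r<D. u r * Y r l j"
      and ?\<gamma> = "\<lambda>l. \<Sum>r<D. u r * Y r l k"
    let ?H = "\<Sum>l<s. [:?\<alpha> l * (y l j * ?\<gamma> l + ?\<beta> l * y l k) + x l i * ?\<beta> l * ?\<gamma> l,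
      ?\<alpha> l * ?\<beta> l * ?\<gamma> l:]"
    have w0: "w 0 a = (\<Sum>l<s. x l i * y l j * y l k)"
      using a unfolding ijk by (simp add: w_def \<phi>_def sv_sum_apply)
    have "w (Suc r) a = (\<Sum>l<s. X r l i * y l j * y l k + x l i * (y l j * Y r l k + Y r l j * y l k))"
      if "r < D" for r
      using XY that a unfolding ijk by (simp add: w_def dir_def sum_apply sv_tangent_def)
    then have "(\<Sum>r<D. u r * w (Suc r) a) = (\<Sum>r<D. \<Sum>l<s.
        u r * (X r l i * y l j * y l k + x l i * (y l j * Y r l k + Y r l j * y l k)))"
      by (simp add: sum_distrib_left)
    also have "\<dots> = (\<Sum>l<s. \<Sum>r<D.
        u r * (X r l i * y l j * y l k + x l i * (y l j * Y r l k + Y r l j * y l k)))"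
      by (rule sum.swap)
    also have "\<dots> = (\<Sum>l<s. ?\<alpha> l * y l j * y l k + x l i * (y l j * ?\<gamma> l + ?\<beta> l * y l k))"
      by (intro sum.cong refl)
         (simp add: sum_distrib_left sum_distrib_right sum.distrib algebra_simps)
    finally have w1: "(\<Sum>r<D. u r * w (Suc r) a) =
        (\<Sum>l<s. ?\<alpha> l * y l j * y l k + x l i * (y l j * ?\<gamma> l + ?\<beta> l * y l k))" .
    show "\<exists>H. \<forall>t. sv_sum m n s (?x (\<lambda>r. t * u r)) (?y (\<lambda>r. t * u r)) a =
        w 0 a + t * (\<Sum>r<D. u r * w (Suc r) a) + t\<^sup>2 * poly H t"
    proof (intro exI[of _ ?H] allI)
      fix t :: complex
      have pull: "(\<Sum>r<D. t * u r * f r) = t * (\<Sum>r<D. u r * f r)" for f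
        by (simp add: sum_distrib_left mult.assoc)
      have "sv_sum m n s (?x (\<lambda>r. t * u r)) (?y (\<lambda>r. t * u r)) a =
          (\<Sum>l<s. (x l i + t * ?\<alpha> l) * (y l j + t * ?\<beta> l) * (y l k + t * ?\<gamma> l))"
        using a unfolding ijk by (simp only: sv_sum_apply pull)
      also have "\<dots> = (\<Sum>l<s. x l i * y l j * y l k +
          t * (?\<alpha> l * y l j * y l k + x l i * (y l j * ?\<gamma> l + ?\<beta> l * y l k)) +
          t\<^sup>2 * (?\<alpha> l * (y l j * ?\<gamma> l + ?\<beta> l * y l k) + x l i * ?\<beta> l * ?\<gamma> l +
            t * (?\<alpha> l * ?\<beta> l * ?\<gamma> l)))"
        by (intro sum.cong refl) (simp add: algebra_simps power2_eq_square)
      also have "\<dots> = w 0 a + t * (\<Sum>r<D. u r * w (Suc r) a) + t\<^sup>2 * poly ?H t"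
      proof -
        have "poly ?H t = (\<Sum>l<s. ?\<alpha> l * (y l j * ?\<gamma> l + ?\<beta> l * y l k) + x l i * ?\<beta> l * ?\<gamma> l +
            t * (?\<alpha> l * ?\<beta> l * ?\<gamma> l))"
          by (simp add: poly_sum)
        moreover have "(\<Sum>l<s. f l + t * g l + t\<^sup>2 * h l) =
            (\<Sum>l<s. f l) + t * (\<Sum>l<s. g l) + t\<^sup>2 * (\<Sum>l<s. h l)" for f g h :: "nat \<Rightarrow> complex"
          by (simp add: sum.distrib sum_distrib_left)
        ultimately show ?thesis unfolding w0 w1 by (simp only:)
      qed
      finally show "sv_sum m n s (?x (\<lambda>r. t * u r)) (?y (\<lambda>r. t * u r)) a =
          w 0 a + t * (\<Sum>r<D. u r * w (Suc r) a) + t\<^sup>2 * poly ?H t" .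
    qed
  qed
  then show ?thesis by (simp add: D_def)
qed

lemma expected_dim_if_tangents_span:
  assumes "sv_tangents_span m n s q" "s \<ge> 1"
    and q: "q = (m + 1) * ((n + 2) choose 2) - s * (m + n + 1)"
  shows "sv_secant_has_expected_dim m n s"
proof -
  let ?I = "sv_index m n"
  let ?S = "zariski ?I closure_of sv_secant_points m n s"
  have pos: "s * (m + n + 1) \<ge> 1" "(m + 1) * ((n + 2) choose 2) \<ge> 1"
    using assms(2) zero_less_binomial[of 2 "n + 2"] by (auto simp: Suc_le_eq)
  have sec: "secant_variety ?I (segre_veronese m n) s = ?S"
    unfolding secant_variety_def secant_points_in_spans ..
  have "krull_dim (subtopology (zariski ?I) ?S) \<le> enat (card ?I - 1)"
    by (intro krull_dim_le_card sv_secant_points_subset finite_sv_index)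
  moreover have "krull_dim (subtopology (zariski ?I) ?S) \<le> enat (s * (m + n + 1) - 1)"
    by (rule krull_dim_secant_le)
  moreover have "enat (card ?I - q - 1) \<le> krull_dim (subtopology (zariski ?I) ?S)"
    by (rule krull_dim_secant_ge[OF assms(1,2)])
  moreover have "card ?I - q - 1 = min (card ?I - 1) (s * (m + n + 1) - 1)"
    using pos unfolding q card_sv_index by linarith
  ultimately have "krull_dim (subtopology (zariski ?I) ?S) = enat (min (card ?I - 1) (s * (m + n + 1) - 1))"
    by (intro antisym) (auto simp: min_def)
  then show ?thesis
    unfolding sv_secant_has_expected_dim_def sec expected_dim_def card_sv_index by simp
qed

section \<open>Explicit configurations of points\<close>

text \<open>Points on the curve \<open>(1, t, t\<^sup>3)\<close>.  A linear form restricts to this curve as a cubic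
  without quadratic term, so its three roots have sum zero.\<close>

definition curve_pt :: "nat \<Rightarrow> nat \<Rightarrow> complex" where
  "curve_pt t i = (if i = 0 then 1 else if i = 1 then of_nat t else if i = 2 then of_nat t ^ 3 else 0)"

lemma sv_form_curve_pt_1:
  "sv_form 1 n F (curve_pt t) y z = sv_form 1 n F (unit_vec 0) y z + of_nat t * sv_form 1 n F (unit_vec 1) y z"
  by (subst sv_form_expand1) (simp add: curve_pt_def)

lemma sv_form_curve_pt_2:
  "sv_form 2 n F (curve_pt t) y z = sv_form 2 n F (unit_vec 0) y z +
     of_nat t * sv_form 2 n F (unit_vec 1) y z + of_nat t ^ 3 * sv_form 2 n F (unit_vec 2) y z"
  by (subst sv_form_expand1) (simp add: curve_pt_def numeral_2_eq_2)

lemma of_nat_sum_nonzero: "a > 0 \<Longrightarrow> of_nat a + of_nat b + of_nat c \<noteq> (0 :: complex)"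
  by (simp flip: of_nat_add)

text \<open>A cubic without quadratic term that has three distinct roots of nonzero sum is zero.\<close>

lemma sparse_cubic_three_roots:
  fixes A B C :: complex
  assumes "A + t * B + t ^ 3 * C = 0" "A + u * B + u ^ 3 * C = 0" "A + v * B + v ^ 3 * C = 0"
    and ne: "t \<noteq> u" "t \<noteq> v" "u \<noteq> v" "t + u + v \<noteq> 0"
  shows "A = 0" "B = 0" "C = 0"
proof -
  have "(t - u) * (B + (t\<^sup>2 + t * u + u\<^sup>2) * C) = 0" "(t - v) * (B + (t\<^sup>2 + t * v + v\<^sup>2) * C) = 0"
    using assms(1-3) by algebra+
  then have 1: "B + (t\<^sup>2 + t * u + u\<^sup>2) * C = 0" "B + (t\<^sup>2 + t * v + v\<^sup>2) * C = 0"
    using ne by simp_all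
  then have "(u - v) * (t + u + v) * C = 0" by algebra
  then show "C = 0" using ne by simp
  then show "B = 0" using 1 by simp
  then show "A = 0" using assms(1) \<open>C = 0\<close> by simp
qed

lemma sparse_cubic_two_roots:
  fixes A B C :: complex
  assumes "A + t * B + t ^ 3 * C = 0" "A + u * B + u ^ 3 * C = 0" "t \<noteq> u"
  shows "B = - (t\<^sup>2 + t * u + u\<^sup>2) * C" "A = t * u * (t + u) * C"
proof -
  have "(t - u) * (B + (t\<^sup>2 + t * u + u\<^sup>2) * C) = 0"
    using assms(1,2) by algebra
  then have "B + (t\<^sup>2 + t * u + u\<^sup>2) * C = 0" using assms(3) by simp
  then show "B = - (t\<^sup>2 + t * u + u\<^sup>2) * C" by algebra
  then show "A = t * u * (t + u) * C" using assms(1) by algebra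
qed

text \<open>The interaction of two triples of points.  The unknowns are the coefficients of four sparse
  cubics \<open>f\<^sub>i\<^sub>j\<close>; the roots \<open>t\<^sub>i\<close> and \<open>u\<^sub>j\<close> of \<open>f\<^sub>i\<^sub>j\<close> leave one scalar \<open>c\<^sub>i\<^sub>j\<close> each, and the further roots
  \<open>u\<^sub>3\<close> of the row sums and \<open>t\<^sub>3\<close> of the column sums give four equations between these.  Geometrically,
  a nonzero solution corresponds to a conic through the six points of the plane, and six distinct
  points on the curve lie on a conic iff their parameters have sum zero.\<close>

lemma two_triples:
  fixes A11 A12 A21 A22 B11 B12 B21 B22 C11 C12 C21 C22 t1 t2 t3 u1 u2 u3 :: complex
  assumes f11: "A11 + t1 * B11 + t1 ^ 3 * C11 = 0" "A11 + u1 * B11 + u1 ^ 3 * C11 = 0"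
    and f12: "A12 + t1 * B12 + t1 ^ 3 * C12 = 0" "A12 + u2 * B12 + u2 ^ 3 * C12 = 0"
    and f21: "A21 + t2 * B21 + t2 ^ 3 * C21 = 0" "A21 + u1 * B21 + u1 ^ 3 * C21 = 0"
    and f22: "A22 + t2 * B22 + t2 ^ 3 * C22 = 0" "A22 + u2 * B22 + u2 ^ 3 * C22 = 0"
    and rows: "(A11 + A12) + u3 * (B11 + B12) + u3 ^ 3 * (C11 + C12) = 0"
      "(A21 + A22) + u3 * (B21 + B22) + u3 ^ 3 * (C21 + C22) = 0"
    and cols: "(A11 + A21) + t3 * (B11 + B21) + t3 ^ 3 * (C11 + C21) = 0"
      "(A12 + A22) + t3 * (B12 + B22) + t3 ^ 3 * (C12 + C22) = 0"
    and ne: "t1 \<noteq> u1" "t1 \<noteq> u2" "t1 \<noteq> u3" "t2 \<noteq> u1" "t2 \<noteq> u2" "t2 \<noteq> u3" "t3 \<noteq> u1" "t3 \<noteq> u2" "t3 \<noteq> u3"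
      "t1 \<noteq> t2" "t1 \<noteq> t3" "t2 \<noteq> t3" "u1 \<noteq> u2" "u1 \<noteq> u3" "u2 \<noteq> u3"
    and sums: "t1 + u1 + u3 \<noteq> 0" "t1 + u2 + u3 \<noteq> 0" "t2 + u1 + u3 \<noteq> 0" "t2 + u2 + u3 \<noteq> 0"
      "u1 + t1 + t3 \<noteq> 0" "u1 + t2 + t3 \<noteq> 0" "u2 + t1 + t3 \<noteq> 0" "u2 + t2 + t3 \<noteq> 0"
      "t1 + t2 + t3 + u1 + u2 + u3 \<noteq> 0"
  shows "C11 = 0" "C12 = 0" "C21 = 0" "C22 = 0"
proof -
  note AB = sparse_cubic_two_roots[OF f11 ne(1)] sparse_cubic_two_roots[OF f12 ne(2)]
    sparse_cubic_two_roots[OF f21 ne(4)] sparse_cubic_two_roots[OF f22 ne(5)]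
  have "(u3 - t1) * (C11 * (u3 - u1) * (t1 + u1 + u3) + C12 * (u3 - u2) * (t1 + u2 + u3)) = 0"
    using rows(1) unfolding AB by algebra
  then have R1: "C11 * (u3 - u1) * (t1 + u1 + u3) + C12 * (u3 - u2) * (t1 + u2 + u3) = 0"
    using ne by simp
  have "(u3 - t2) * (C21 * (u3 - u1) * (t2 + u1 + u3) + C22 * (u3 - u2) * (t2 + u2 + u3)) = 0"
    using rows(2) unfolding AB by algebra
  then have R2: "C21 * (u3 - u1) * (t2 + u1 + u3) + C22 * (u3 - u2) * (t2 + u2 + u3) = 0"
    using ne by simp
  have "(t3 - u1) * (C11 * (t3 - t1) * (u1 + t1 + t3) + C21 * (t3 - t2) * (u1 + t2 + t3)) = 0"
    using cols(1) unfolding AB by algebra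
  then have K1: "C11 * (t3 - t1) * (u1 + t1 + t3) + C21 * (t3 - t2) * (u1 + t2 + t3) = 0"
    using ne by simp
  have "(t3 - u2) * (C12 * (t3 - t1) * (u2 + t1 + t3) + C22 * (t3 - t2) * (u2 + t2 + t3)) = 0"
    using cols(2) unfolding AB by algebra
  then have K2: "C12 * (t3 - t1) * (u2 + t1 + t3) + C22 * (t3 - t2) * (u2 + t2 + t3) = 0"
    using ne by simp
  define d1 d2 e1 e2 where d: "d1 = u3 - u1" "d2 = u3 - u2" "e1 = t3 - t1" "e2 = t3 - t2"
  define P11 P12 P21 P22 where
    P: "P11 = t1 + u1 + u3" "P12 = t1 + u2 + u3" "P21 = t2 + u1 + u3" "P22 = t2 + u2 + u3"
  define Q11 Q12 Q21 Q22 where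
    Q: "Q11 = u1 + t1 + t3" "Q12 = u1 + t2 + t3" "Q21 = u2 + t1 + t3" "Q22 = u2 + t2 + t3"
  have lin: "C11 * d1 * P11 + C12 * d2 * P12 = 0" "C21 * d1 * P21 + C22 * d2 * P22 = 0"
    "C11 * e1 * Q11 + C21 * e2 * Q12 = 0" "C12 * e1 * Q21 + C22 * e2 * Q22 = 0"
    using R1 R2 K1 K2 by (simp_all add: d P Q)
  \<comment> \<open>Eliminating all unknowns but \<open>C11\<close> leaves a determinant that factors.\<close>
  have "C11 * d1 * e1 * (Q11 * P21 * Q22 * P12 - P11 * Q21 * P22 * Q12) = 0"
    using lin by algebra
  moreover have "Q11 * P21 * Q22 * P12 - P11 * Q21 * P22 * Q12 =
      (t1 - t2) * (u1 - u2) * (t3 - u3) * (t1 + t2 + t3 + u1 + u2 + u3)"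
    unfolding P Q by algebra
  moreover have "d1 \<noteq> 0" "e1 \<noteq> 0" "d2 \<noteq> 0" "e2 \<noteq> 0" using ne by (simp_all add: d)
  ultimately show "C11 = 0" using ne sums(9) by auto
  then show "C12 = 0" using lin(1) \<open>d2 \<noteq> 0\<close> sums(2) by (simp add: P)
  show "C21 = 0" using \<open>C11 = 0\<close> lin(3) \<open>e2 \<noteq> 0\<close> sums(6) by (simp add: Q)
  then show "C22 = 0" using lin(2) \<open>d2 \<noteq> 0\<close> sums(4) by (simp add: P)
qed

text \<open>Vanishing of a form, for \<open>m = 2\<close>, in a given pair of vectors of the quadratic variable.\<close>

definition sv_vanishes :: "nat \<Rightarrow> (nat \<times> nat \<times> nat \<Rightarrow> complex) \<Rightarrow> (nat \<Rightarrow> complex) \<Rightarrow> (nat \<Rightarrow> complex) \<Rightarrow> bool"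
  where "sv_vanishes n F y z \<longleftrightarrow> (\<forall>x. sv_form 2 n F x y z = 0)"

lemma sv_vanishesD: "sv_vanishes n F y z \<Longrightarrow> sv_form 2 n F x y z = 0"
  by (simp add: sv_vanishes_def)

lemma sv_vanishes_commute: "sv_vanishes n F y z \<Longrightarrow> sv_vanishes n F z y"
  by (simp add: sv_vanishes_def sv_form_commute[of 2 n F _ z])

lemma sv_vanishesI:
  assumes "sv_form 2 n F (unit_vec 0) y z = 0" "sv_form 2 n F (unit_vec 1) y z = 0"
    "sv_form 2 n F (unit_vec 2) y z = 0"
  shows "sv_vanishes n F y z"
  unfolding sv_vanishes_def
proof
  show "sv_form 2 n F x y z = 0" for x
    by (subst sv_form_expand1) (use assms in \<open>simp add: numeral_2_eq_2\<close>)
qed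

lemma sv_vanishes_three_points:
  assumes "sv_form 2 n F (curve_pt t) y z = 0" "sv_form 2 n F (curve_pt u) y z = 0"
    "sv_form 2 n F (curve_pt v) y z = 0" and ne: "t \<noteq> u" "t \<noteq> v" "u \<noteq> v"
  shows "sv_vanishes n F y z"
proof -
  have "of_nat (t + u + v) \<noteq> (0 :: complex)"
    using ne unfolding of_nat_eq_0_iff by linarith
  then have "of_nat t + of_nat u + of_nat v \<noteq> (0 :: complex)"
    by simp
  note roots = sparse_cubic_three_roots[OF assms(1-3)[unfolded sv_form_curve_pt_2] _ _ _ this]
  show ?thesis
    by (rule sv_vanishesI; rule roots) (use ne in simp_all)
qed

text \<open>The previous elimination, for the values of a form on \<open>{a, b, a + b} \<times> {c, d, c + d}\<close>.\<close>

lemma sv_vanishes_two_triples: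
  assumes t: "distinct [t1, t2, t3, u1, u2, u3]" "0 \<notin> {t1, t2, t3, u1, u2, u3}"
    and a: "\<And>z. z \<in> {c, d} \<Longrightarrow> sv_form 2 n F (curve_pt t1) a z = 0"
    and b: "\<And>z. z \<in> {c, d} \<Longrightarrow> sv_form 2 n F (curve_pt t2) b z = 0"
    and ab: "\<And>z. z \<in> {c, d} \<Longrightarrow> sv_form 2 n F (curve_pt t3) a z + sv_form 2 n F (curve_pt t3) b z = 0"
    and c: "\<And>z. z \<in> {a, b} \<Longrightarrow> sv_form 2 n F (curve_pt u1) z c = 0"
    and d: "\<And>z. z \<in> {a, b} \<Longrightarrow> sv_form 2 n F (curve_pt u2) z d = 0"
    and cd: "\<And>z. z \<in> {a, b} \<Longrightarrow> sv_form 2 n F (curve_pt u3) z c + sv_form 2 n F (curve_pt u3) z d = 0"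
  shows "sv_vanishes n F a c" "sv_vanishes n F a d" "sv_vanishes n F b c" "sv_vanishes n F b d"
proof -
  let ?f = "\<lambda>i. sv_form 2 n F (unit_vec i)"
  let ?t1 = "of_nat t1 :: complex" and ?t2 = "of_nat t2 :: complex" and ?t3 = "of_nat t3 :: complex"
  let ?u1 = "of_nat u1 :: complex" and ?u2 = "of_nat u2 :: complex" and ?u3 = "of_nat u3 :: complex"
  have eqs: "?f 0 a c + ?t1 * ?f 1 a c + ?t1 ^ 3 * ?f 2 a c = 0"
      "?f 0 a c + ?u1 * ?f 1 a c + ?u1 ^ 3 * ?f 2 a c = 0"
      "?f 0 a d + ?t1 * ?f 1 a d + ?t1 ^ 3 * ?f 2 a d = 0"
      "?f 0 a d + ?u2 * ?f 1 a d + ?u2 ^ 3 * ?f 2 a d = 0"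
      "?f 0 b c + ?t2 * ?f 1 b c + ?t2 ^ 3 * ?f 2 b c = 0"
      "?f 0 b c + ?u1 * ?f 1 b c + ?u1 ^ 3 * ?f 2 b c = 0"
      "?f 0 b d + ?t2 * ?f 1 b d + ?t2 ^ 3 * ?f 2 b d = 0"
      "?f 0 b d + ?u2 * ?f 1 b d + ?u2 ^ 3 * ?f 2 b d = 0"
    using a b c d by (simp_all add: sv_form_curve_pt_2)
  have sums: "(?f 0 a c + ?f 0 a d) + ?u3 * (?f 1 a c + ?f 1 a d) + ?u3 ^ 3 * (?f 2 a c + ?f 2 a d) = 0"
      "(?f 0 b c + ?f 0 b d) + ?u3 * (?f 1 b c + ?f 1 b d) + ?u3 ^ 3 * (?f 2 b c + ?f 2 b d) = 0"
      "(?f 0 a c + ?f 0 b c) + ?t3 * (?f 1 a c + ?f 1 b c) + ?t3 ^ 3 * (?f 2 a c + ?f 2 b c) = 0"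
      "(?f 0 a d + ?f 0 b d) + ?t3 * (?f 1 a d + ?f 1 b d) + ?t3 ^ 3 * (?f 2 a d + ?f 2 b d) = 0"
    using cd[of a] cd[of b] ab[of c] ab[of d] by (simp_all add: sv_form_curve_pt_2 algebra_simps)
  have pos: "t1 > 0" "t2 > 0" "t3 > 0" "u1 > 0" "u2 > 0" "u3 > 0" using t(2) by auto
  have six: "?t1 + ?t2 + ?t3 + ?u1 + ?u2 + ?u3 \<noteq> 0"
    using pos by (simp flip: of_nat_add)
  note C = two_triples[OF eqs sums _ _ _ _ _ _ _ _ _ _ _ _ _ _ _
      of_nat_sum_nonzero of_nat_sum_nonzero of_nat_sum_nonzero of_nat_sum_nonzero
      of_nat_sum_nonzero of_nat_sum_nonzero of_nat_sum_nonzero of_nat_sum_nonzero six]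
  have C0: "?f 2 a c = 0" "?f 2 a d = 0" "?f 2 b c = 0" "?f 2 b d = 0"
    by (rule C; use t(1) pos in simp)+
  have van: "sv_vanishes n F y z"
    if "?f 0 y z + of_nat t * ?f 1 y z + of_nat t ^ 3 * ?f 2 y z = 0"
      "?f 0 y z + of_nat u * ?f 1 y z + of_nat u ^ 3 * ?f 2 y z = 0" "t \<noteq> u" "?f 2 y z = 0" for y z t u
    using sparse_cubic_two_roots[OF that(1,2)] that(3,4) by (intro sv_vanishesI) simp_all
  show "sv_vanishes n F a c" "sv_vanishes n F a d" "sv_vanishes n F b c" "sv_vanishes n F b d"
    using van[OF eqs(1,2)] van[OF eqs(3,4)] van[OF eqs(5,6)] van[OF eqs(7,8)] C0 t(1) by simp_all
qed

text \<open>A functional \<open>F\<close> that annihilates the tangent spaces of the basic configuration: triples of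
  points with second components \<open>e + a\<^sub>r\<close>, \<open>b\<^sub>r\<close> and \<open>a\<^sub>r + b\<^sub>r\<close>, and first components
  consecutive points of the curve.  The vector \<open>e\<close> may be zero.\<close>

locale point_triples =
  fixes n k :: nat and F :: "nat \<times> nat \<times> nat \<Rightarrow> complex"
    and e :: "nat \<Rightarrow> complex" and a b :: "nat \<Rightarrow> nat \<Rightarrow> complex"
  assumes point_ea: "r < k \<Longrightarrow> sv_annihilates 2 n F (curve_pt (3 * r + 1)) (\<lambda>i. e i + a r i)"
    and point_b: "r < k \<Longrightarrow> sv_annihilates 2 n F (curve_pt (3 * r + 2)) (b r)"
    and point_ab: "r < k \<Longrightarrow> sv_annihilates 2 n F (curve_pt (3 * r + 3)) (\<lambda>i. a r i + b r i)"
    and vanishes_ee: "sv_vanishes n F e e"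
begin

abbreviation G :: "(nat \<Rightarrow> complex) \<Rightarrow> (nat \<Rightarrow> complex) \<Rightarrow> (nat \<Rightarrow> complex) \<Rightarrow> complex" where
  "G \<equiv> sv_form 2 n F"

text \<open>The conditions on the squares express the form on a triple by its values at \<open>(e, a\<^sub>r)\<close>.\<close>

lemma square_ea: "r < k \<Longrightarrow> G x (a r) (a r) = - 2 * G x e (a r)"
proof -
  assume "r < k"
  then have "G x (\<lambda>i. e i + a r i) (\<lambda>i. e i + a r i) = 0"
    using point_ea by (auto simp: sv_annihilates_def)
  then have "G x e e + 2 * G x e (a r) + G x (a r) (a r) = 0"
    by (simp add: sv_form_add2 sv_form_add3 sv_form_commute[of 2 n F x "a r" e] algebra_simps)
  then show ?thesis
    using sv_vanishesD[OF vanishes_ee] by (simp add: eq_neg_iff_add_eq_0 add.commute)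
qed

lemma square_b: "r < k \<Longrightarrow> G x (b r) (b r) = 0"
  using point_b by (auto simp: sv_annihilates_def)

lemma mixed_ab: "r < k \<Longrightarrow> G x (a r) (b r) = G x e (a r)"
proof -
  assume r: "r < k"
  then have "G x (\<lambda>i. a r i + b r i) (\<lambda>i. a r i + b r i) = 0"
    using point_ab by (auto simp: sv_annihilates_def)
  then have "G x (a r) (a r) + 2 * G x (a r) (b r) + G x (b r) (b r) = 0"
    by (simp add: sv_form_add2 sv_form_add3 sv_form_commute[of 2 n F x "b r" "a r"] algebra_simps)
  then show ?thesis using square_ea[OF r] square_b[OF r] by simp
qed

lemma line_ea: "r < k \<Longrightarrow> G (curve_pt (3 * r + 1)) e z + G (curve_pt (3 * r + 1)) (a r) z = 0"
  using point_ea by (simp add: sv_annihilates_def sv_form_add2)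

lemma line_b: "r < k \<Longrightarrow> G (curve_pt (3 * r + 2)) (b r) z = 0"
  using point_b by (simp add: sv_annihilates_def)

lemma line_ab: "r < k \<Longrightarrow> G (curve_pt (3 * r + 3)) (a r) z + G (curve_pt (3 * r + 3)) (b r) z = 0"
  using point_ab by (simp add: sv_annihilates_def sv_form_add2)

lemma vanishes_ea:
  assumes r: "r < k"
  shows "sv_vanishes n F e (a r)"
proof (rule sv_vanishes_three_points)
  show "G (curve_pt (3 * r + 1)) e (a r) = 0"
    using line_ea[OF r, of e] sv_vanishesD[OF vanishes_ee]
    by (simp add: sv_form_commute[of 2 n F _ "a r" e])
  show "G (curve_pt (3 * r + 2)) e (a r) = 0"
    using line_b[OF r, of "a r"] mixed_ab[OF r] by (simp add: sv_form_commute[of 2 n F _ "b r" "a r"])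
  show "G (curve_pt (3 * r + 3)) e (a r) = 0"
    using line_ab[OF r, of "a r"] square_ea[OF r] mixed_ab[OF r]
    by (simp add: sv_form_commute[of 2 n F _ "b r" "a r"])
qed auto

lemma vanishes_eb:
  assumes r: "r < k"
  shows "sv_vanishes n F e (b r)"
proof (rule sv_vanishes_three_points)
  note ea = sv_vanishesD[OF vanishes_ea[OF r]]
  show "G (curve_pt (3 * r + 1)) e (b r) = 0"
    using line_ea[OF r, of "b r"] mixed_ab[OF r] ea by simp
  show "G (curve_pt (3 * r + 2)) e (b r) = 0"
    using line_b[OF r, of e] by (simp add: sv_form_commute[of 2 n F _ "b r" e])
  show "G (curve_pt (3 * r + 3)) e (b r) = 0"
    using line_ab[OF r, of e] ea
    by (simp add: sv_form_commute[of 2 n F _ "b r" e] sv_form_commute[of 2 n F _ "a r" e])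
qed auto

lemma line_a:
  assumes "r < k" "sv_vanishes n F e z"
  shows "G (curve_pt (3 * r + 1)) (a r) z = 0"
  using line_ea[OF assms(1), of z] sv_vanishesD[OF assms(2)] by simp

lemma vanishes_triples:
  assumes r: "r < k" and r': "r' < k"
  shows "sv_vanishes n F (a r) (a r')" "sv_vanishes n F (a r) (b r')" "sv_vanishes n F (b r) (b r')"
proof -
  have "sv_vanishes n F (a r) (a r') \<and> sv_vanishes n F (a r) (b r') \<and> sv_vanishes n F (b r) (b r')"
  proof (cases "r = r'")
    case True
    then show ?thesis
      using square_ea[OF r] mixed_ab[OF r] square_b[OF r] sv_vanishesD[OF vanishes_ea[OF r]]
      by (simp add: sv_vanishes_def)
  next
    case False
    have dist: "distinct [3 * r + 1, 3 * r + 2, 3 * r + 3, 3 * r' + 1, 3 * r' + 2, 3 * r' + 3]"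
      using False by (cases "r < r'") auto
    have a': "G (curve_pt (3 * r' + 1)) z (a r') = 0" if "sv_vanishes n F e z" for z
      using line_a[OF r' that] by (simp add: sv_form_commute[of 2 n F _ z])
    have b': "G (curve_pt (3 * r' + 2)) z (b r') = 0" for z
      using line_b[OF r', of z] by (simp add: sv_form_commute[of 2 n F _ z])
    have ab': "G (curve_pt (3 * r' + 3)) z (a r') + G (curve_pt (3 * r' + 3)) z (b r') = 0" for z
      using line_ab[OF r', of z] by (simp add: sv_form_commute[of 2 n F _ z])
    have ea: "sv_vanishes n F e z" if "z \<in> {a r, b r, a r', b r'}" for z
      using that vanishes_ea[OF r] vanishes_eb[OF r] vanishes_ea[OF r'] vanishes_eb[OF r'] by auto
    have pos: "0 \<notin> {3 * r + 1, 3 * r + 2, 3 * r + 3, 3 * r' + 1, 3 * r' + 2, 3 * r' + 3}" by simp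
    have A: "G (curve_pt (3 * r + 1)) (a r) z = 0" if "z \<in> {a r', b r'}" for z
      by (rule line_a[OF r ea]) (use that in auto)
    have A': "G (curve_pt (3 * r' + 1)) z (a r') = 0" if "z \<in> {a r, b r}" for z
      by (rule a'[OF ea]) (use that in auto)
    have "sv_vanishes n F (a r) (a r')" "sv_vanishes n F (a r) (b r')" "sv_vanishes n F (b r) (b r')"
      using sv_vanishes_two_triples[OF dist pos A line_b[OF r] line_ab[OF r] A' b' ab'] by blast+
    then show ?thesis by blast
  qed
  then show "sv_vanishes n F (a r) (a r')" "sv_vanishes n F (a r) (b r')" "sv_vanishes n F (b r) (b r')"
    by auto
qed

lemma vanishes_span:
  assumes "y \<in> {e} \<union> a ` {..<k} \<union> b ` {..<k}" "z \<in> {e} \<union> a ` {..<k} \<union> b ` {..<k}"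
  shows "sv_vanishes n F y z"
  using assms
  by (auto intro: vanishes_ee vanishes_ea vanishes_eb vanishes_triples
      vanishes_ea[THEN sv_vanishes_commute] vanishes_eb[THEN sv_vanishes_commute]
      vanishes_triples(2)[THEN sv_vanishes_commute])

end

text \<open>The second components in the order in which the triples are listed.\<close>

definition triple_pt :: "(nat \<Rightarrow> complex) \<Rightarrow> (nat \<Rightarrow> nat \<Rightarrow> complex) \<Rightarrow> (nat \<Rightarrow> nat \<Rightarrow> complex) \<Rightarrow>
    nat \<Rightarrow> nat \<Rightarrow> complex" where
  "triple_pt e a b l = (if l mod 3 = 0 then (\<lambda>i. e i + a (l div 3) i)
     else if l mod 3 = 1 then b (l div 3) else (\<lambda>i. a (l div 3) i + b (l div 3) i))"

lemma point_triplesI: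
  assumes ann: "\<And>l. l < 3 * k \<Longrightarrow> sv_annihilates 2 n F (curve_pt (l + 1)) (triple_pt e a b l)"
    and ee: "sv_vanishes n F e e"
  shows "point_triples n k F e a b"
proof
  fix r assume r: "r < k"
  have "(3 * r + 0) div 3 = r" "(3 * r + 0) mod 3 = 0" "(3 * r + 1) div 3 = r" "(3 * r + 1) mod 3 = 1"
    "(3 * r + 2) div 3 = r" "(3 * r + 2) mod 3 = 2"
    by presburger+
  then have t: "triple_pt e a b (3 * r + 0) = (\<lambda>i. e i + a r i)" "triple_pt e a b (3 * r + 1) = b r"
    "triple_pt e a b (3 * r + 2) = (\<lambda>i. a r i + b r i)"
    unfolding triple_pt_def by (simp_all only: if_True if_False) simp_all
  have s: "3 * r + 0 + 1 = 3 * r + 1" "3 * r + 1 + 1 = 3 * r + 2" "3 * r + 2 + 1 = 3 * r + 3"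
    by simp_all
  have "3 * r + 0 < 3 * k" "3 * r + 1 < 3 * k" "3 * r + 2 < 3 * k"
    using r by simp_all
  from this[THEN ann]
  show "sv_annihilates 2 n F (curve_pt (3 * r + 1)) (\<lambda>i. e i + a r i)"
    "sv_annihilates 2 n F (curve_pt (3 * r + 2)) (b r)"
    "sv_annihilates 2 n F (curve_pt (3 * r + 3)) (\<lambda>i. a r i + b r i)"
    unfolding t s .
qed (rule ee)

lemma triple_pt_nonzero:
  assumes "l < 3 * k"
    and a: "\<And>r. r < k \<Longrightarrow> \<exists>j\<le>n. a r j = 1 \<and> e j = 0 \<and> b r j = 0"
    and b: "\<And>r. r < k \<Longrightarrow> \<exists>j\<le>n. b r j = 1"
  shows "\<exists>j\<le>n. triple_pt e a b l j \<noteq> 0"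
proof -
  have r: "l div 3 < k" using assms(1) by (simp add: less_mult_imp_div_less mult.commute)
  show ?thesis using a[OF r] b[OF r] by (fastforce simp: triple_pt_def)
qed

lemma sv_tangents_span_coordinatesI:
  assumes "\<And>l. l < s \<Longrightarrow> x l 0 \<noteq> 0" "\<And>l. l < s \<Longrightarrow> \<exists>j\<le>n. y l j \<noteq> 0"
    and J: "J \<subseteq> sv_index m n" "card J \<le> q"
    and ann: "\<And>F a. (\<And>l. l < s \<Longrightarrow> sv_annihilates m n F (x l) (y l)) \<Longrightarrow>
       (\<And>b. b \<in> J \<Longrightarrow> F b = 0) \<Longrightarrow> a \<in> sv_index m n \<Longrightarrow> F a = 0"
  shows "sv_tangents_span m n s q"
proof (rule sv_tangents_spanI[of s x n y "unit_vec ` J"])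
  have fin: "finite J" using J(1) finite_sv_index by (rule finite_subset)
  then show "finite (unit_vec ` J)" by simp
  show "card (unit_vec ` J) \<le> q" using card_image_le[OF fin, of unit_vec] J(2) by linarith
  show "unit_vec ` J \<subseteq> coord_space (sv_index m n)"
    using J(1) by (auto simp: unit_vec_def coord_space_def)
  fix F a
  assume F: "\<And>l. l < s \<Longrightarrow> sv_annihilates m n F (x l) (y l)"
    and E: "\<And>e. e \<in> unit_vec ` J \<Longrightarrow> (\<Sum>a\<in>sv_index m n. F a * e a) = 0" and a: "a \<in> sv_index m n"
  have "F b = 0" if b: "b \<in> J" for b
  proof -
    have "0 = (\<Sum>a\<in>sv_index m n. F a * unit_vec b a)" using E b by simp
    also have "\<dots> = (\<Sum>a\<in>sv_index m n. if a = b then F a else 0)"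
      by (intro sum.cong) (auto simp: unit_vec_def)
    also have "\<dots> = F b" using b J(1) by auto
    finally show ?thesis by simp
  qed
  from ann[OF F this a] show "F a = 0" .
qed (fact assms)+

lemma functional_zero:
  assumes "\<And>j k. j \<le> n \<Longrightarrow> k \<le> n \<Longrightarrow> sv_vanishes n F (unit_vec j) (unit_vec k)" "a \<in> sv_index 2 n"
  shows "F a = 0"
proof -
  obtain i j k where a: "a = (i, j, k)" "i \<le> 2" "j \<le> k" "k \<le> n"
    using assms(2) by (auto simp: sv_index_def)
  then have "sv_form 2 n F (unit_vec i) (unit_vec j) (unit_vec k) = 0"
    using assms(1) by (simp add: sv_vanishes_def)
  then show ?thesis using sv_form_unit[OF a(2-4), of F] a(1) by (simp split: if_splits)
qed

lemma sv_vanishes_unit: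
  assumes "j \<le> k" "k \<le> n" "F (0, j, k) = 0" "F (1, j, k) = 0" "F (2, j, k) = 0"
  shows "sv_vanishes n F (unit_vec j) (unit_vec k)"
  using assms by (intro sv_vanishesI) (simp_all add: sv_form_unit)

lemma curve_pt_0 [simp]: "curve_pt t 0 = 1"
  by (simp add: curve_pt_def)

text \<open>For \<open>m = 1\<close> the coordinate points \<open>y\<^sub>l\<close> with pairwise distinct first components suffice.\<close>

lemma tangents_span_1: "sv_tangents_span 1 n (n + 1) 0"
proof (rule sv_tangents_span_coordinatesI[where x = curve_pt and y = unit_vec and J = "{}"])
  show "\<exists>j\<le>n. (unit_vec l j :: complex) \<noteq> 0" if "l < n + 1" for l
    using that by (intro exI[of _ l]) (simp add: unit_vec_def)
  fix F a
  assume F: "\<And>l. l < n + 1 \<Longrightarrow> sv_annihilates 1 n F (curve_pt l) (unit_vec l)"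
    and a: "a \<in> sv_index 1 n"
  obtain i j k where ijk: "a = (i, j, k)" "i \<le> 1" "j \<le> k" "k \<le> n"
    using a by (auto simp: sv_index_def)
  let ?f = "\<lambda>i. sv_form 1 n F (unit_vec i) (unit_vec j) (unit_vec k)"
  have "?f i = 0"
  proof (cases "j = k")
    case True
    then show ?thesis using F[of j] ijk by (simp add: sv_annihilates_def)
  next
    case False
    have "sv_form 1 n F (curve_pt j) (unit_vec j) (unit_vec k) = 0"
      using F[of j] ijk by (simp add: sv_annihilates_def)
    then have fj: "?f 0 + of_nat j * ?f 1 = 0" unfolding sv_form_curve_pt_1 .
    have "sv_form 1 n F (curve_pt k) (unit_vec k) (unit_vec j) = 0"
      using F[of k] ijk by (simp add: sv_annihilates_def)
    then have "?f 0 + of_nat k * ?f 1 = 0"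
      unfolding sv_form_commute[of 1 n F _ "unit_vec k"] sv_form_curve_pt_1 .
    with fj have "(of_nat j - of_nat k) * ?f 1 = 0" by algebra
    then have "?f 1 = 0" using False by simp
    moreover from this have "?f 0 = 0" using fj by simp
    ultimately show ?thesis using ijk(2) by (cases i) auto
  qed
  then show "F a = 0" using sv_form_unit[OF ijk(2-4), of F] ijk(1) by (simp split: if_splits)
qed simp_all

lemma odd_even_cases:
  fixes j k :: nat
  assumes "j \<le> 2 * k"
  obtains "j = 0" | r where "r < k" "j = 2 * r + 1" | r where "r < k" "j = 2 * r + 2"
proof (cases "even j")
  case True
  then obtain r where "j = 2 * r" by blast
  then show ?thesis using that(1) that(3)[of "r - 1"] assms by (cases r) auto
next
  case False
  then obtain r where "j = 2 * r + 1" by (auto elim: oddE)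
  then show ?thesis using that(2)[of r] assms by auto
qed

text \<open>For \<open>m = 2\<close> and \<open>n = 2 k\<close>: \<open>k\<close> triples, with \<open>e\<close> a further basis vector.\<close>

lemma even_triples_vanish:
  assumes "point_triples n k F (unit_vec 0) (\<lambda>r. unit_vec (2 * r + 1)) (\<lambda>r. unit_vec (2 * r + 2))"
    and "i \<le> 2 * k" "j \<le> 2 * k"
  shows "sv_vanishes n F (unit_vec i) (unit_vec j)"
proof -
  let ?S = "{unit_vec 0} \<union> (\<lambda>r. unit_vec (2 * r + 1)) ` {..<k} \<union> (\<lambda>r. unit_vec (2 * r + 2)) ` {..<k}
    :: (nat \<Rightarrow> complex) set"
  have mem: "unit_vec j \<in> ?S" if "j \<le> 2 * k" for j
    using that by (cases rule: odd_even_cases) auto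
  show ?thesis
    by (rule point_triples.vanishes_span[OF assms(1) mem[OF assms(2)] mem[OF assms(3)]])
qed

abbreviation even_pt :: "nat \<Rightarrow> nat \<Rightarrow> complex" where
  "even_pt \<equiv> triple_pt (unit_vec 0) (\<lambda>r. unit_vec (2 * r + 1)) (\<lambda>r. unit_vec (2 * r + 2))"

lemma even_pt_nonzero:
  assumes "l < 3 * k" "2 * k \<le> n"
  shows "\<exists>j\<le>n. even_pt l j \<noteq> 0"
proof (rule triple_pt_nonzero[OF assms(1)])
  fix r assume r: "r < k"
  show "\<exists>j\<le>n. unit_vec (2 * r + 1) j = (1 :: complex) \<and> unit_vec 0 j = (0 :: complex) \<and>
      unit_vec (2 * r + 2) j = (0 :: complex)"
    using r assms(2) by (intro exI[of _ "2 * r + 1"]) (auto simp: unit_vec_def)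
  show "\<exists>j\<le>n. unit_vec (2 * r + 2) j = (1 :: complex)"
    using r assms(2) by (intro exI[of _ "2 * r + 2"]) (auto simp: unit_vec_def)
qed

text \<open>With a further point over \<open>e\<close> itself the tangent spaces fill the ambient space; without it,
  the coordinates of \<open>e \<sqdot> e\<close> are missing.\<close>

lemma tangents_span_even_fill: "sv_tangents_span 2 (2 * k) (3 * k + 1) 0"
proof (rule sv_tangents_span_coordinatesI[where x = "\<lambda>l. curve_pt (l + 1)" and J = "{}"
      and y = "\<lambda>l. if l < 3 * k then even_pt l else unit_vec 0"])
  show "\<exists>j\<le>2 * k. (if l < 3 * k then even_pt l else unit_vec 0) j \<noteq> 0" for l
    using even_pt_nonzero[of l k "2 * k"] by (auto simp: unit_vec_def)
  fix F a
  assume F: "\<And>l. l < 3 * k + 1 \<Longrightarrow>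
      sv_annihilates 2 (2 * k) F (curve_pt (l + 1)) (if l < 3 * k then even_pt l else unit_vec 0)"
    and a: "a \<in> sv_index 2 (2 * k)"
  have "sv_vanishes (2 * k) F (unit_vec 0) (unit_vec 0)"
    using F[of "3 * k"] by (simp add: sv_vanishes_def sv_annihilates_def)
  moreover have "sv_annihilates 2 (2 * k) F (curve_pt (l + 1)) (even_pt l)" if "l < 3 * k" for l
    using F[of l] that by simp
  ultimately have "point_triples (2 * k) k F (unit_vec 0) (\<lambda>r. unit_vec (2 * r + 1)) (\<lambda>r. unit_vec (2 * r + 2))"
    by (intro point_triplesI)
  from functional_zero[OF even_triples_vanish[OF this] a] show "F a = 0" .
qed simp_all

lemma tangents_span_even_indep: "sv_tangents_span 2 (2 * k) (3 * k) 3"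
proof (rule sv_tangents_span_coordinatesI[where x = "\<lambda>l. curve_pt (l + 1)" and y = even_pt
      and J = "{(0, 0, 0), (1, 0, 0), (2, 0, 0)}"])
  show "\<exists>j\<le>2 * k. even_pt l j \<noteq> 0" if "l < 3 * k" for l
    using even_pt_nonzero[OF that] by blast
  fix F a
  assume F: "\<And>l. l < 3 * k \<Longrightarrow> sv_annihilates 2 (2 * k) F (curve_pt (l + 1)) (even_pt l)"
    and J: "\<And>b. b \<in> {(0, 0, 0), (1, 0, 0), (2, 0, 0)} \<Longrightarrow> F b = 0"
    and a: "a \<in> sv_index 2 (2 * k)"
  have "sv_vanishes (2 * k) F (unit_vec 0) (unit_vec 0)"
    using J by (intro sv_vanishes_unit) auto
  with F have "point_triples (2 * k) k F (unit_vec 0) (\<lambda>r. unit_vec (2 * r + 1)) (\<lambda>r. unit_vec (2 * r + 2))"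
    by (rule point_triplesI)
  from functional_zero[OF even_triples_vanish[OF this] a] show "F a = 0" .
qed (auto simp: sv_index_def)

text \<open>For \<open>m = 2\<close> and \<open>n = 2 k + 1\<close>: \<open>k + 1\<close> triples and \<open>e = 0\<close> fill the space.\<close>

lemma tangents_span_odd_fill: "sv_tangents_span 2 (2 * k + 1) (3 * (k + 1)) 0"
proof (rule sv_tangents_span_coordinatesI[where x = "\<lambda>l. curve_pt (l + 1)" and J = "{}"
      and y = "triple_pt (\<lambda>_. 0) (\<lambda>r. unit_vec (2 * r)) (\<lambda>r. unit_vec (2 * r + 1))"])
  let ?n = "2 * k + 1"
  let ?y = "triple_pt (\<lambda>_. 0) (\<lambda>r. unit_vec (2 * r)) (\<lambda>r. unit_vec (2 * r + 1))"
  show "\<exists>j\<le>?n. ?y l j \<noteq> 0" if "l < 3 * (k + 1)" for l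
  proof (rule triple_pt_nonzero[OF that])
    fix r assume r: "r < k + 1"
    show "\<exists>j\<le>?n. unit_vec (2 * r) j = (1 :: complex) \<and> (0 :: complex) = 0 \<and>
        unit_vec (2 * r + 1) j = (0 :: complex)"
      using r by (intro exI[of _ "2 * r"]) (auto simp: unit_vec_def)
    show "\<exists>j\<le>?n. unit_vec (2 * r + 1) j = (1 :: complex)"
      using r by (intro exI[of _ "2 * r + 1"]) (auto simp: unit_vec_def)
  qed
  fix F a
  assume F: "\<And>l. l < 3 * (k + 1) \<Longrightarrow> sv_annihilates 2 ?n F (curve_pt (l + 1)) (?y l)"
    and a: "a \<in> sv_index 2 ?n"
  have "sv_vanishes ?n F (\<lambda>_. 0) (\<lambda>_. 0)"
    by (simp add: sv_vanishes_def sv_form_def)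
  with F have T: "point_triples ?n (k + 1) F (\<lambda>_. 0) (\<lambda>r. unit_vec (2 * r)) (\<lambda>r. unit_vec (2 * r + 1))"
    by (rule point_triplesI)
  have S: "unit_vec j \<in> {\<lambda>_. 0} \<union> (\<lambda>r. unit_vec (2 * r)) ` {..<k + 1} \<union>
      (\<lambda>r. unit_vec (2 * r + 1)) ` {..<k + 1}" if "j \<le> ?n" for j
    using that by (cases "even j") (auto elim!: evenE oddE)
  show "F a = 0"
    by (rule functional_zero[OF point_triples.vanishes_span[OF T S S] a])
qed simp_all

text \<open>For \<open>m = 2\<close> and \<open>n = 2 k + 1\<close>, the configuration for \<open>2 k\<close> and one point whose second
  component is the new basis vector \<open>f\<close> have independent tangent spaces.  The complementary
  coordinates are those of \<open>e \<sqdot> e\<close>, two of \<open>e \<sqdot> f\<close>, and one of each \<open>a\<^sub>r \<sqdot> f\<close>.\<close>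

lemma tangents_span_odd_indep: "sv_tangents_span 2 (2 * k + 1) (3 * k + 1) (k + 5)"
proof (rule sv_tangents_span_coordinatesI[where x = "\<lambda>l. curve_pt (l + 1)"
      and y = "\<lambda>l. if l < 3 * k then even_pt l else unit_vec (2 * k + 1)"
      and J = "{(0, 0, 0), (1, 0, 0), (2, 0, 0), (1, 0, 2 * k + 1), (2, 0, 2 * k + 1)} \<union>
        (\<lambda>r. (2, 2 * r + 1, 2 * k + 1)) ` {..<k}"])
  let ?n = "2 * k + 1"
  let ?f = "unit_vec ?n :: nat \<Rightarrow> complex"
  let ?J1 = "{(0, 0, 0), (1, 0, 0), (2, 0, 0), (1, 0, ?n), (2, 0, ?n)} :: (nat \<times> nat \<times> nat) set"
  let ?J2 = "(\<lambda>r. (2, 2 * r + 1, ?n)) ` {..<k} :: (nat \<times> nat \<times> nat) set"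
  show "\<exists>j\<le>?n. (if l < 3 * k then even_pt l else ?f) j \<noteq> 0" for l
    using even_pt_nonzero[of l k ?n] by (auto simp: unit_vec_def)
  show "?J1 \<union> ?J2 \<subseteq> sv_index 2 ?n"
    by (auto simp: sv_index_def)
  have "card ?J1 \<le> 5" by (simp add: card_insert_if)
  moreover have "card ?J2 \<le> k" using card_image_le[of "{..<k}" "\<lambda>r. (2::nat, 2 * r + 1, ?n)"] by simp
  ultimately show "card (?J1 \<union> ?J2) \<le> k + 5" using card_Un_le[of ?J1 ?J2] by linarith
  fix F a
  assume F: "\<And>l. l < 3 * k + 1 \<Longrightarrow>
      sv_annihilates 2 ?n F (curve_pt (l + 1)) (if l < 3 * k then even_pt l else ?f)"
    and J: "\<And>b. b \<in> ?J1 \<union> ?J2 \<Longrightarrow> F b = 0"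
    and a: "a \<in> sv_index 2 ?n"
  let ?p = "curve_pt (3 * k + 1)"
  have ff: "sv_vanishes ?n F ?f ?f" and fp: "sv_form 2 ?n F ?p z ?f = 0" for z
    using F[of "3 * k"] by (simp_all add: sv_vanishes_def sv_annihilates_def sv_form_commute[of _ _ _ _ z])
  have "sv_vanishes ?n F (unit_vec 0) (unit_vec 0)"
    using J by (intro sv_vanishes_unit) auto
  moreover have "sv_annihilates 2 ?n F (curve_pt (l + 1)) (even_pt l)" if "l < 3 * k" for l
    using F[of l] that by simp
  ultimately interpret point_triples ?n k F "unit_vec 0" "\<lambda>r. unit_vec (2 * r + 1)" "\<lambda>r. unit_vec (2 * r + 2)"
    by (intro point_triplesI)
  have "sv_form 2 ?n F (unit_vec 1) (unit_vec 0) ?f = 0" "sv_form 2 ?n F (unit_vec 2) (unit_vec 0) ?f = 0"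
    using J by (simp_all add: sv_form_unit)
  with fp[of "unit_vec 0"] have ef: "sv_vanishes ?n F (unit_vec 0) ?f"
    by (intro sv_vanishesI) (simp_all add: sv_form_curve_pt_2)
  have af: "sv_vanishes ?n F (unit_vec (2 * r + 1)) ?f" if r: "r < k" for r
  proof -
    have C: "sv_form 2 ?n F (unit_vec 2) (unit_vec (2 * r + 1)) ?f = 0"
      using J[of "(2, 2 * r + 1, ?n)"] r by (simp add: sv_form_unit)
    have "sv_form 2 ?n F (curve_pt (3 * r + 1)) (unit_vec (2 * r + 1)) ?f = 0"
      by (rule line_a[OF r ef])
    with fp[of "unit_vec (2 * r + 1)"]
    show ?thesis
      using sparse_cubic_two_roots[of "sv_form 2 ?n F (unit_vec 0) (unit_vec (2 * r + 1)) ?f"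
          "of_nat (3 * r + 1)" "sv_form 2 ?n F (unit_vec 1) (unit_vec (2 * r + 1)) ?f"
          "sv_form 2 ?n F (unit_vec 2) (unit_vec (2 * r + 1)) ?f" "of_nat (3 * k + 1)"] C r
      by (intro sv_vanishesI) (simp_all only: sv_form_curve_pt_2 of_nat_eq_iff, simp_all)
  qed
  have bf: "sv_vanishes ?n F (unit_vec (2 * r + 2)) ?f" if r: "r < k" for r
  proof (rule sv_vanishes_three_points)
    show "sv_form 2 ?n F (curve_pt (3 * r + 2)) (unit_vec (2 * r + 2)) ?f = 0"
      by (rule line_b[OF r])
    show "sv_form 2 ?n F (curve_pt (3 * r + 3)) (unit_vec (2 * r + 2)) ?f = 0"
      using line_ab[OF r, of ?f] sv_vanishesD[OF af[OF r]] by simp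
    show "sv_form 2 ?n F ?p (unit_vec (2 * r + 2)) ?f = 0" by (rule fp)
  qed (use r in auto)
  have f: "sv_vanishes ?n F (unit_vec j) ?f" if "j \<le> ?n" for j
  proof (cases "j = ?n")
    case False
    then have "j \<le> 2 * k" using that by simp
    then show ?thesis
      by (cases rule: odd_even_cases) (use ef af bf in auto)
  qed (use ff in simp)
  have "sv_vanishes ?n F (unit_vec i) (unit_vec j)" if "i \<le> ?n" "j \<le> ?n" for i j
    using f[OF that(1)] sv_vanishes_commute[OF f[OF that(2)]] that
      even_triples_vanish[OF point_triples_axioms, of i j]
    by (cases "i = ?n"; cases "j = ?n") auto
  from functional_zero[OF this a] show "F a = 0" .
qed simp

text \<open>The case \<open>n = 1\<close>, \<open>s = 2\<close> lies strictly between the two configurations for odd \<open>n\<close>.\<close>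

lemma tangents_span_2_1_2: "sv_tangents_span 2 1 2 1"
proof (rule sv_tangents_span_coordinatesI[where x = curve_pt and y = unit_vec and J = "{(2, 0, 1)}"])
  show "\<exists>j\<le>1. (unit_vec l j :: complex) \<noteq> 0" if "l < 2" for l :: nat
    using that by (intro exI[of _ l]) (simp add: unit_vec_def)
  fix F a
  assume F: "\<And>l. l < 2 \<Longrightarrow> sv_annihilates 2 1 F (curve_pt l) (unit_vec l)"
    and J: "\<And>b. b \<in> {(2, 0, 1)} \<Longrightarrow> F b = 0" and a: "a \<in> sv_index 2 1"
  let ?f = "\<lambda>i. sv_form 2 1 F (unit_vec i) (unit_vec 0) (unit_vec 1)"
  have "?f 2 = 0" using J by (simp add: sv_form_unit)
  moreover have "sv_form 2 1 F (curve_pt 0) (unit_vec 0) (unit_vec 1) = 0"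
    using F[of 0] by (simp add: sv_annihilates_def)
  moreover have "sv_form 2 1 F (curve_pt 1) (unit_vec 0) (unit_vec 1) = 0"
    using F[of 1] by (simp add: sv_annihilates_def sv_form_commute[of _ _ _ _ "unit_vec 0"])
  ultimately have v: "sv_vanishes 1 F (unit_vec 0) (unit_vec 1)"
    by (intro sv_vanishesI) (simp_all add: sv_form_curve_pt_2)
  have d: "sv_vanishes 1 F (unit_vec l) (unit_vec l)" if "l < 2" for l
    using F[OF that] by (simp add: sv_vanishes_def sv_annihilates_def)
  have "sv_vanishes 1 F (unit_vec i) (unit_vec j)" if "i \<le> 1" "j \<le> 1" for i j
    using that v sv_vanishes_commute[OF v] d by (cases i; cases j) auto
  from functional_zero[OF this a] show "F a = 0" .
qed (auto simp: sv_index_def)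

lemma choose_two_double: "2 * (n + 2 choose 2) = (n + 2) * (n + 1)"
  by (simp add: choose_two)

theorem corollary1p4:
  fixes m n :: nat
  shows "(m = 1 \<longrightarrow> (\<forall>s\<ge>1. sv_secant_has_expected_dim m n s)) \<and>
         (m = 2 \<longrightarrow> (\<forall>s\<ge>1. \<not> (\<exists>k\<ge>1. (n, s) = (2 * k + 1, 3 * k + 2)) \<longrightarrow>
                              sv_secant_has_expected_dim m n s))"
proof (intro conjI impI allI)
  fix s :: nat assume m: "m = 1" and s: "1 \<le> s"
  show "sv_secant_has_expected_dim m n s"
  proof (cases "s \<le> n + 1")
    case True
    then obtain d where d: "n + 1 = s + d" using le_iff_add by blast
    then have "sv_tangents_span 1 n (s + d) 0" using tangents_span_1[of n] by metis
    then have "sv_tangents_span 1 n s (0 + d * (1 + n + 1))"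
      by (rule sv_tangents_span_fewer_points)
    moreover have "0 + d * (1 + n + 1) = (1 + 1) * (n + 2 choose 2) - s * (1 + n + 1)"
    proof -
      have "(1 + 1) * (n + 2 choose 2) = (n + 1) * (n + 2)"
        using choose_two_double[of n] by simp
      also have "\<dots> = s * (1 + n + 1) + d * (1 + n + 1)" unfolding d by (simp add: algebra_simps)
      finally show ?thesis by simp
    qed
    ultimately show ?thesis using expected_dim_if_tangents_span s m by blast
  next
    case False
    have "sv_tangents_span 1 n s 0"
      using sv_tangents_span_more_points[OF tangents_span_1] False by simp
    moreover have "0 = (1 + 1) * (n + 2 choose 2) - s * (1 + n + 1)"
    proof -
      have "(n + 1) * (n + 2) \<le> s * (n + 2)" using False by (intro mult_right_mono) auto
      then show ?thesis using choose_two_double[of n] by (simp add: algebra_simps)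
    qed
    ultimately show ?thesis using expected_dim_if_tangents_span s m by blast
  qed
next
  fix s :: nat
  assume m: "m = 2" and s: "1 \<le> s" and exc: "\<not> (\<exists>k\<ge>1. (n, s) = (2 * k + 1, 3 * k + 2))"
  have goal: "sv_secant_has_expected_dim m n s"
    if "sv_tangents_span 2 n s q" "q = 3 * (n + 2 choose 2) - s * (n + 3)" for q
  proof -
    have "(2 :: nat) + 1 = 3" "2 + n + 1 = n + 3" by simp_all
    then have "q = (2 + 1) * (n + 2 choose 2) - s * (2 + n + 1)"
      using that(2) by (simp only:)
    from expected_dim_if_tangents_span[OF that(1) s this] show ?thesis by (simp only: m)
  qed
  show "sv_secant_has_expected_dim m n s"
  proof (cases "even n")
    case True
    then obtain k where n: "n = 2 * k" by blast
    have total: "3 * (n + 2 choose 2) = 3 * k * (n + 3) + 3"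
      using choose_two_double[of n] by (simp add: n algebra_simps)
    show ?thesis
    proof (cases "s \<le> 3 * k")
      case True
      then obtain d where d: "3 * k = s + d" using le_iff_add by blast
      then have "sv_tangents_span 2 n (s + d) 3" using tangents_span_even_indep[of k] n by metis
      then have "sv_tangents_span 2 n s (3 + d * (2 + n + 1))"
        by (rule sv_tangents_span_fewer_points)
      moreover have "3 + d * (2 + n + 1) = 3 * (n + 2 choose 2) - s * (n + 3)"
        unfolding total d by (simp add: algebra_simps)
      ultimately show ?thesis by (rule goal)
    next
      case False
      then have "sv_tangents_span 2 n s 0"
        using sv_tangents_span_more_points[OF tangents_span_even_fill, of k s] n by simp
      moreover have "0 = 3 * (n + 2 choose 2) - s * (n + 3)"
      proof -
        have "(3 * k + 1) * (n + 3) \<le> s * (n + 3)" using False by (intro mult_right_mono) auto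
        then show ?thesis unfolding total by simp
      qed
      ultimately show ?thesis by (rule goal)
    qed
  next
    case False
    then obtain k where n: "n = 2 * k + 1" by (auto elim: oddE)
    have total: "3 * (n + 2 choose 2) = (3 * k + 1) * (n + 3) + (k + 5)"
      using choose_two_double[of n] by (simp add: n algebra_simps)
    consider "s \<le> 3 * k + 1" | "s = 3 * k + 2" | "s \<ge> 3 * k + 3" by linarith
    then show ?thesis
    proof cases
      case 1
      then obtain d where d: "3 * k + 1 = s + d" using le_iff_add by blast
      then have "sv_tangents_span 2 n (s + d) (k + 5)" using tangents_span_odd_indep[of k] n by metis
      then have "sv_tangents_span 2 n s (k + 5 + d * (2 + n + 1))"
        by (rule sv_tangents_span_fewer_points)
      moreover have "k + 5 + d * (2 + n + 1) = 3 * (n + 2 choose 2) - s * (n + 3)"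
        unfolding total d by (simp add: algebra_simps)
      ultimately show ?thesis by (rule goal)
    next
      case 2
      then have "k = 0" using exc n by auto
      then have ns: "n = 1" "s = 2" using n 2 by simp_all
      have "sv_tangents_span 2 n s 1" unfolding ns by (rule tangents_span_2_1_2)
      moreover have "1 = 3 * (n + 2 choose 2) - s * (n + 3)" by (simp add: ns choose_two)
      ultimately show ?thesis by (rule goal)
    next
      case 3
      then have "sv_tangents_span 2 n s 0"
        using sv_tangents_span_more_points[OF tangents_span_odd_fill, of k s] n by simp
      moreover have "0 = 3 * (n + 2 choose 2) - s * (n + 3)"
      proof -
        have "3 * (n + 2 choose 2) \<le> (3 * k + 3) * (n + 3)"
          unfolding total by (simp add: n algebra_simps)
        also have "\<dots> \<le> s * (n + 3)" using 3 by (intro mult_right_mono) auto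
        finally show ?thesis by simp
      qed
      ultimately show ?thesis by (rule goal)
    qed
  qed
qed

end
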